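(* Let $X$ be an infinite-dimensional Banach space with the Radon--Nikodym property. Then there exists a symmetrically $(1+)$-separated family of unit vectors in $X$, with cardinality $w^*\text{-}\mathrm{dens}\, X^*$.
   Context: Banach spaces are over the real or the complex field. $w^*\text{-}\mathrm{dens}\,X^*$ is the density character of $X^*$ in the $w^*$-topology. A subset $A$ of a normed space is symmetrically $(1+)$-separated if $\|x-y\|>1$ and $\|x+y\|>1$ for all distinct $x,y\in A$. *)

theory Defs
  imports "HOL-Analysis.Analysis"
begin

unbundle cardinal_syntax

text \<open>
  Banach spaces over \<open>\<real>\<close> or \<open>\<complex>\<close>: the type class \<^class>\<open>banach\<close> only provides real scalars, so
  the scalar multiplication over the scalar field \<open>'k\<close> is an explicit parameter. It extends the
  real scalar multiplication of the type; for \<open>'k = real\<close> it is forced to be \<^const>\<open>scaleR\<close>.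
\<close>

definition real_or_complex_field :: "'k::real_normed_field itself \<Rightarrow> bool" where
  "real_or_complex_field _ \<longleftrightarrow>
     (\<exists>h :: 'k \<Rightarrow> complex.
        (\<forall>a b. h (a + b) = h a + h b) \<and> (\<forall>a b. h (a * b) = h a * h b) \<and>
        (\<forall>r. h (of_real r) = of_real r) \<and> (\<forall>a. norm (h a) = norm a) \<and>
        (range h = \<real> \<or> range h = UNIV))"

lemma real_or_complex_field_real: "real_or_complex_field TYPE(real)"
  unfolding real_or_complex_field_def
  by (rule exI[of _ complex_of_real]) (auto simp: Reals_def)

lemma real_or_complex_field_complex: "real_or_complex_field TYPE(complex)"
  unfolding real_or_complex_field_def
  by (rule exI[of _ "\<lambda>z. z"]) auto

locale normed_space_over = vector_space smul
  for smul :: "'k::real_normed_field \<Rightarrow> 'a::real_normed_vector \<Rightarrow> 'a" +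
  assumes scale_of_real: "smul (of_real r) x = r *\<^sub>R x"
    and norm_scale: "norm (smul c x) = norm c * norm x"

lemma normed_space_over_scaleR:
  "normed_space_over (scaleR :: real \<Rightarrow> 'a::real_normed_vector \<Rightarrow> 'a)"
  by unfold_locales (auto simp: algebra_simps)

lemma normed_space_over_complex: "normed_space_over ((*) :: complex \<Rightarrow> complex \<Rightarrow> complex)"
  by unfold_locales (auto simp: algebra_simps scaleR_conv_of_real norm_mult)

definition infinite_dimensional :: "('k::real_normed_field \<Rightarrow> 'a::ab_group_add \<Rightarrow> 'a) \<Rightarrow> bool" where
  "infinite_dimensional smul \<longleftrightarrow> \<not> (\<exists>B. finite B \<and> module.span smul B = UNIV)"


definition dual_space ::
  "('k::real_normed_field \<Rightarrow> 'a::real_normed_vector \<Rightarrow> 'a) \<Rightarrow> ('a \<Rightarrow> 'k) set" where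
  "dual_space smul =
     {f. Vector_Spaces.linear smul (*) f \<and> (\<exists>C. \<forall>x. norm (f x) \<le> C * norm x)}"

text \<open>The topology of pointwise convergence on the dual space.\<close>

definition weak_star_topology ::
  "('k::real_normed_field \<Rightarrow> 'a::real_normed_vector \<Rightarrow> 'a) \<Rightarrow> ('a \<Rightarrow> 'k) topology" where
  "weak_star_topology smul =
     subtopology (product_topology (\<lambda>_. euclidean) UNIV) (dual_space smul)"

definition dense_in :: "'b topology \<Rightarrow> 'b set \<Rightarrow> bool" where
  "dense_in T D \<longleftrightarrow> D \<subseteq> topspace T \<and> T closure_of D = topspace T"

text \<open>
  The density character as a cardinal, in the sense of the HOL cardinals (a minimal well-order).
  The choice does not matter up to \<open>=o\<close>, and a set as chosen exists by
  \<open>density_character_attained\<close> below.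
\<close>

definition density_character :: "'b topology \<Rightarrow> 'b rel" where
  "density_character T = card_of (SOME D. dense_in T D \<and> (\<forall>E. dense_in T E \<longrightarrow> |D| \<le>o |E| ))"

lemma density_character_attained:
  "\<exists>D. dense_in T D \<and> |D| = density_character T \<and> (\<forall>E. dense_in T E \<longrightarrow> |D| \<le>o |E| )"
proof -
  have "dense_in T (topspace T)"
    by (simp add: dense_in_def)
  then have "card_of ` {D. dense_in T D} \<noteq> {}"
    by blast
  then have "\<exists>r\<in>card_of ` {D. dense_in T D}. \<forall>r'\<in>card_of ` {D. dense_in T D}. r \<le>o r'"
    by (rule exists_minim_Card_order) (auto simp: card_of_Card_order)
  then have "\<exists>D. dense_in T D \<and> (\<forall>E. dense_in T E \<longrightarrow> |D| \<le>o |E| )"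
    by blast
  from someI_ex[OF this] show ?thesis
    unfolding density_character_def by blast
qed


text \<open>
  The library's \<^const>\<open>has_bochner_integral\<close> requires a second countable target space.
  The following is the same definition without that restriction. The approximation by simple
  functions in \<open>L\<^sup>1\<close> forces \<open>f\<close> to be strongly measurable (essentially separably valued).
\<close>

definition has_bochner_integral_nonsep ::
  "'w measure \<Rightarrow> ('w \<Rightarrow> 'a::real_normed_vector) \<Rightarrow> 'a \<Rightarrow> bool" where
  "has_bochner_integral_nonsep M f x \<longleftrightarrow>
     f \<in> borel_measurable M \<and>
     (\<exists>s. (\<forall>i. Bochner_Integration.simple_bochner_integrable M (s i)) \<and>
          (\<lambda>i. \<integral>\<^sup>+ w. ennreal (norm (f w - s i w)) \<partial>M) \<longlonglongrightarrow> 0 \<and>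
          (\<lambda>i. Bochner_Integration.simple_bochner_integral M (s i)) \<longlonglongrightarrow> x)"

definition vector_measure :: "'w measure \<Rightarrow> ('w set \<Rightarrow> 'a::real_normed_vector) \<Rightarrow> bool" where
  "vector_measure M G \<longleftrightarrow>
     (\<forall>E. range E \<subseteq> sets M \<and> disjoint_family E \<longrightarrow>
        (\<lambda>n::nat. G (E n)) sums G (\<Union>n. E n))"

definition bounded_variation :: "'w measure \<Rightarrow> ('w set \<Rightarrow> 'a::real_normed_vector) \<Rightarrow> bool" where
  "bounded_variation M G \<longleftrightarrow>
     (\<exists>C. \<forall>P. finite P \<and> P \<subseteq> sets M \<and> disjoint P \<and> \<Union>P = space M \<longrightarrow>
        (\<Sum>E\<in>P. norm (G E)) \<le> C)"

text \<open>
  The Radon--Nikodym property: every vector measure of bounded variation that is absolutely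
  continuous with respect to a finite measure \<open>M\<close> has a Bochner integrable density. A definition
  in HOL cannot quantify over measure spaces on all types; \<open>M\<close> ranges over the finite measure
  spaces whose underlying set is a set of reals, with an arbitrary \<open>\<sigma>\<close>-algebra on it. This is
  formally weaker than, but equivalent to, the condition for all finite measure spaces, because
  Lebesgue measure on the unit interval already suffices to characterize the property.
  For complex spaces the notion only depends on the underlying real space.
\<close>

definition radon_nikodym_property :: "'a::banach itself \<Rightarrow> bool" where
  "radon_nikodym_property _ \<longleftrightarrow>
     (\<forall>(M :: real measure) (G :: real set \<Rightarrow> 'a).
        finite_measure M \<and> vector_measure M G \<and> bounded_variation M G \<and>
        (\<forall>E\<in>null_sets M. G E = 0) \<longrightarrow>
        (\<exists>g. \<forall>E\<in>sets M. has_bochner_integral_nonsep M (\<lambda>w. indicator E w *\<^sub>R g w) (G E)))"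


definition symmetrically_one_plus_separated :: "'a::real_normed_vector set \<Rightarrow> bool" where
  "symmetrically_one_plus_separated A \<longleftrightarrow>
     (\<forall>x\<in>A. \<forall>y\<in>A. x \<noteq> y \<longrightarrow> norm (x - y) > 1 \<and> norm (x + y) > 1)"

end

theory Submission
  imports Defs
begin

text \<open>
  Let the cardinal \<open>w\<^sup>*-dens X\<^sup>*\<close> be given as a well-order whose proper initial segments have smaller
  cardinality. Along it, unit vectors \<open>x \<alpha>\<close> and functionals \<open>f \<alpha>\<close> are chosen by recursion. Let \<open>Y \<alpha>\<close> be
  the common kernel of all \<open>f \<beta>\<close> with \<open>\<beta> < \<alpha>\<close>. If \<open>Y \<alpha>\<close> is not \<open>{0}\<close>, the Radon--Nikodym property
  provides a point \<open>x \<alpha>\<close> of the unit ball of \<open>Y \<alpha>\<close> that is exposed by a real functional \<open>g \<alpha>\<close>: on this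
  ball, \<open>g \<alpha>\<close> attains its maximum at \<open>x \<alpha>\<close> only. Let \<open>f \<alpha>\<close> be a functional over the scalar field
  whose kernel is contained in that of \<open>g \<alpha>\<close>. For \<open>\<beta> < \<alpha>\<close> the vectors \<open>x \<beta> + x \<alpha>\<close> and \<open>x \<beta> - x \<alpha>\<close> lie in
  \<open>Y \<beta>\<close>, differ from \<open>x \<beta>\<close>, and have the same value under \<open>g \<beta>\<close> as \<open>x \<beta>\<close>. So they are outside the unit
  ball, which is the required separation.

  The recursion does not stop early, because fewer than \<open>w\<^sup>*-dens X\<^sup>*\<close> functionals are never total. For
  finitely many functionals this holds by infinite dimension. If an infinite set \<open>F\<close> of functionals is
  total, the combinations of \<open>F\<close> with coefficients in a countable dense set of scalars are
  \<open>w\<^sup>*\<close>-dense (\<open>density_character_le_total\<close>), and there are only \<open>|F|\<close> of them.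

  The core is the existence of exposed points (\<open>RNP_exposed_point_of_ball\<close>). Suppose that in a
  bounded set \<open>D\<close> each point \<open>x\<close> with \<open>\<phi> x > a\<close>, for a linear functional \<open>\<phi>\<close>, is a convex combination of
  points of \<open>D\<close> at distance at least \<open>\<epsilon>\<close> from \<open>x\<close>. Repeated decomposition along finer and finer partitions
  of the interval \<open>[0, 1)\<close> gives a bounded martingale of step functions, stopped where \<open>\<phi> \<le> a\<close>. Its
  increments are bounded below in \<open>L\<^sup>1\<close>, because a fixed proportion of the mass is never stopped. The
  limits of its integrals form a vector measure of bounded variation, and the density of this
  measure would be the \<open>L\<^sup>1\<close> limit of the martingale (\<open>radon_nikodym_increments_small\<close>); this is a
  contradiction. So some \<open>x\<close> with \<open>\<phi> x > a\<close> is far from convex combinations of distant points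
  (\<open>RNP_denting_point\<close>). Applied to the union of the unit ball and a large disc in the kernel of \<open>\<phi>\<close>, this
  gives a functional close to \<open>\<phi>\<close> with a small slice of the unit ball (\<open>slice_perturbation\<close>), and
  iteration leads to a functional that exposes a point.
\<close>

section \<open>The Hahn--Banach theorem\<close>

definition sublinear :: "('a::real_vector \<Rightarrow> real) \<Rightarrow> bool" where
  "sublinear p \<longleftrightarrow> (\<forall>x y. p (x + y) \<le> p x + p y) \<and> (\<forall>t x. t \<ge> 0 \<longrightarrow> p (t *\<^sub>R x) = t * p x)"

lemma sublinear_zero: "sublinear p \<Longrightarrow> p 0 = 0"
  unfolding sublinear_def by (metis order_refl mult_zero_left scaleR_zero_left)

lemma sublinear_lower: "sublinear p \<Longrightarrow> - p (- x) \<le> p x"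
  using sublinear_zero[of p] unfolding sublinear_def by (metis add.right_inverse add.commute minus_le_iff
   le_add_same_cancel1 diff_ge_0_iff_ge diff_minus_eq_add)

text \<open>
  The set \<open>Q\<close> is a convex cone of pairs \<open>(v, c)\<close>, each of which stands for the requirement
  \<open>g v \<ge> c\<close> on a linear functional \<open>g \<le> p\<close>. All the requirements are built into a smaller
  sublinear functional \<open>q\<close>: from \<open>g \<le> q\<close> follows \<open>g (- v) \<le> q (- v) \<le> - c\<close>.
\<close>

lemma sublinear_reduce:
  assumes p: "sublinear p" and Q0: "(0, 0) \<in> Q"
    and Qadd: "\<And>v c w d. (v, c) \<in> Q \<Longrightarrow> (w, d) \<in> Q \<Longrightarrow> (v + w, c + d) \<in> Q"
    and Qscale: "\<And>t v c. t > 0 \<Longrightarrow> (v, c) \<in> Q \<Longrightarrow> (t *\<^sub>R v, t * c) \<in> Q"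
    and Qle: "\<And>v c. (v, c) \<in> Q \<Longrightarrow> c \<le> p v"
  obtains q where "sublinear q" "\<And>x. q x \<le> p x" "\<And>v c. (v, c) \<in> Q \<Longrightarrow> q (- v) \<le> - c"
proof
  define q where "q x = (INF (v, c)\<in>Q. p (x + v) - c)" for x
  have lower: "- p (- x) \<le> p (x + v) - c" if "(v, c) \<in> Q" for x v c
  proof -
    have "c \<le> p ((x + v) + (- x))" using Qle[OF that] by simp
    also have "\<dots> \<le> p (x + v) + p (- x)" using p unfolding sublinear_def by blast
    finally show ?thesis by simp
  qed
  have bdd: "bdd_below ((\<lambda>(v, c). p (x + v) - c) ` Q)" for x
    by (rule bdd_belowI[of _ "- p (- x)"]) (auto intro: lower)
  have ne: "Q \<noteq> {}" using Q0 by auto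
  have q_le: "q x \<le> p (x + v) - c" if "(v, c) \<in> Q" for x v c
    unfolding q_def using cINF_lower[OF bdd that] by simp
  have q_ge: "m \<le> q x" if "\<And>v c. (v, c) \<in> Q \<Longrightarrow> m \<le> p (x + v) - c" for m x
    unfolding q_def using ne that by (intro cINF_greatest) auto
  show "q x \<le> p x" for x using q_le[OF Q0, of x] by simp
  show "q (- v) \<le> - c" if "(v, c) \<in> Q" for v c
    using q_le[OF that, of "- v"] sublinear_zero[OF p] by simp
  \<comment> \<open>the cone is closed under addition, so requirements used for \<open>x\<close> and for \<open>y\<close> combine into one for \<open>x + y\<close>\<close>
  have add: "q (x + y) \<le> q x + q y" for x y
  proof -
    have "q (x + y) - (p (y + w) - d) \<le> q x" if wd: "(w, d) \<in> Q" for w d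
    proof (rule q_ge)
      fix v c assume vc: "(v, c) \<in> Q"
      have "q (x + y) \<le> p (x + y + (v + w)) - (c + d)" by (rule q_le[OF Qadd[OF vc wd]])
      also have "p (x + y + (v + w)) \<le> p (x + v) + p (y + w)"
        using p unfolding sublinear_def by (metis add.assoc add.left_commute)
      finally show "q (x + y) - (p (y + w) - d) \<le> p (x + v) - c" by simp
    qed
    then have "q (x + y) - q x \<le> q y" by (intro q_ge) (smt (verit))
    then show ?thesis by simp
  qed
  have scale_le: "t * q x \<le> q (t *\<^sub>R x)" if t: "t > 0" for t x
  proof (rule q_ge)
    fix v c assume vc: "(v, c) \<in> Q"
    have "q x \<le> p (x + (1 / t) *\<^sub>R v) - (1 / t) * c"
      using t by (intro q_le Qscale vc) simp
    then have "t * q x \<le> t * p (x + (1 / t) *\<^sub>R v) - c"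
      using t by (simp add: field_simps)
    also have "t * p (x + (1 / t) *\<^sub>R v) = p (t *\<^sub>R (x + (1 / t) *\<^sub>R v))"
      using p t unfolding sublinear_def by (metis less_imp_le)
    also have "t *\<^sub>R (x + (1 / t) *\<^sub>R v) = t *\<^sub>R x + v"
      using t by (simp add: scaleR_add_right)
    finally show "t * q x \<le> p (t *\<^sub>R x + v) - c" .
  qed
  have q0: "q 0 = 0"
  proof (rule antisym)
    show "q 0 \<le> 0" using q_le[OF Q0, of 0] sublinear_zero[OF p] by simp
    show "0 \<le> q 0" by (rule q_ge) (use Qle in auto)
  qed
  have "q (t *\<^sub>R x) = t * q x" if t: "t \<ge> 0" for t x
  proof (cases "t = 0")
    case True then show ?thesis by (simp add: q0)
  next
    case False
    then have t: "t > 0" using t by simp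
    have "(1 / t) * q (t *\<^sub>R x) \<le> q ((1 / t) *\<^sub>R t *\<^sub>R x)" using t by (intro scale_le) simp
    then have "q (t *\<^sub>R x) \<le> t * q x" using t by (simp add: field_simps)
    then show ?thesis using scale_le[OF t, of x] by simp
  qed
  with add show "sublinear q" unfolding sublinear_def by blast
qed

text \<open>
  A minimal sublinear functional \<open>q\<close> is linear: requiring \<open>q x \<le> g x\<close> on the ray through \<open>x\<close> does
  not make it smaller, so \<open>q (- x) \<le> - q x\<close>.
\<close>

lemma sublinear_minimal_linear:
  assumes q: "sublinear q" and min: "\<And>q'. sublinear q' \<Longrightarrow> (\<forall>x. q' x \<le> q x) \<Longrightarrow> q' = q"
  shows "linear q"
proof -
  have odd: "q (- x) = - q x" for x
  proof -
    obtain q' where q': "sublinear q'" "\<And>y. q' y \<le> q y"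
      "\<And>v c. (v, c) \<in> (\<lambda>t. (t *\<^sub>R x, t * q x)) ` {0..} \<Longrightarrow> q' (- v) \<le> - c"
    proof (rule sublinear_reduce[OF q, of "(\<lambda>t. (t *\<^sub>R x, t * q x)) ` {0..}"])
      fix v w :: 'a and c d :: real
      assume "(v, c) \<in> (\<lambda>t. (t *\<^sub>R x, t * q x)) ` {0..}" "(w, d) \<in> (\<lambda>t. (t *\<^sub>R x, t * q x)) ` {0..}"
      then obtain s t where "s \<ge> 0" "t \<ge> 0" "v = s *\<^sub>R x" "c = s * q x" "w = t *\<^sub>R x" "d = t * q x"
        by auto
      then show "(v + w, c + d) \<in> (\<lambda>t. (t *\<^sub>R x, t * q x)) ` {0..}"
        by (intro image_eqI[of _ _ "s + t"]) (auto simp: algebra_simps)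
    next
      fix t c :: real and v :: 'a
      assume "t > 0" "(v, c) \<in> (\<lambda>t. (t *\<^sub>R x, t * q x)) ` {0..}"
      then obtain s where "s \<ge> 0" "v = s *\<^sub>R x" "c = s * q x" by auto
      with \<open>t > 0\<close> show "(t *\<^sub>R v, t * c) \<in> (\<lambda>t. (t *\<^sub>R x, t * q x)) ` {0..}"
        by (intro image_eqI[of _ _ "t * s"]) auto
    qed (use q in \<open>auto simp: sublinear_def image_iff\<close>)
    have "q' = q" using min q' by blast
    moreover have "q' (- x) \<le> - q x"
      by (rule q'(3)) (auto intro!: image_eqI[of _ _ 1])
    ultimately show ?thesis using sublinear_lower[OF q, of x] by simp
  qed
  have add: "q (x + y) = q x + q y" for x y
  proof (rule antisym)
    show "q (x + y) \<le> q x + q y" using q unfolding sublinear_def by blast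
    have "q x \<le> q (x + y) + q (- y)"
      using q unfolding sublinear_def by (metis add.right_neutral add.assoc add.right_inverse)
    then show "q x + q y \<le> q (x + y)" by (simp add: odd)
  qed
  have "q (r *\<^sub>R x) = r * q x" for r x
  proof (cases "r \<ge> 0")
    case True then show ?thesis using q unfolding sublinear_def by blast
  next
    case False
    then have "- r \<ge> 0" by simp
    then have "q ((- r) *\<^sub>R (- x)) = (- r) * q (- x)" using q unfolding sublinear_def by blast
    then show ?thesis by (simp add: odd)
  qed
  with add show ?thesis by (intro linearI) auto
qed

text \<open>
  Zorn's lemma gives a minimal sublinear functional below \<open>p\<close>, and it is linear. The pointwise
  infimum of a chain is finite because every \<open>q \<le> p\<close> satisfies \<open>q x \<ge> - q (- x) \<ge> - p (- x)\<close>.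
\<close>

lemma sublinear_dominates_linear:
  fixes p :: "'a::real_vector \<Rightarrow> real"
  assumes p: "sublinear p"
  obtains g where "linear g" "\<And>x. g x \<le> p x"
proof -
  define S where "S = {q. sublinear q \<and> (\<forall>x. q x \<le> p x)}"
  define r where "r = {(q, q'). q \<in> S \<and> q' \<in> S \<and> (\<forall>x. q' x \<le> q x)}"
  have Field: "Field r = S" unfolding r_def Field_def by auto
  have "\<exists>m\<in>Field r. \<forall>a\<in>Field r. (m, a) \<in> r \<longrightarrow> a = m"
  proof (rule Zorns_po_lemma)
    have "r \<subseteq> S \<times> S" "refl_on S r" by (auto simp: r_def refl_on_def)
    moreover have "trans r"
      by (rule transI) (auto simp: r_def intro: order_trans)
    moreover have "antisym r"
      by (rule antisymI) (auto simp: r_def intro!: ext antisym)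
    ultimately show "Partial_order r"
      unfolding Field partial_order_on_def preorder_on_def by blast
    fix C assume C: "C \<in> Chains r"
    show "\<exists>u\<in>Field r. \<forall>a\<in>C. (a, u) \<in> r"
    proof (cases "C = {}")
      case True then show ?thesis using p by (auto simp: Field S_def)
    next
      case False
      have CS: "C \<subseteq> S" using C unfolding Chains_def r_def by auto
      have chain: "(\<forall>x. a x \<le> b x) \<or> (\<forall>x. b x \<le> a x)" if "a \<in> C" "b \<in> C" for a b
        using C that unfolding Chains_def r_def by blast
      define u where "u x = (INF q\<in>C. q x)" for x
      have low: "- p (- x) \<le> q x" if "q \<in> C" for q x
      proof -
        have "q (- x) \<le> p (- x)" "- q (- x) \<le> q x"
          using CS that sublinear_lower[of q x] by (auto simp: S_def)
        then show ?thesis by simp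
      qed
      have bdd: "bdd_below ((\<lambda>q. q x) ` C)" for x
        by (rule bdd_belowI[of _ "- p (- x)"]) (auto intro: low)
      have u_le: "u x \<le> q x" if "q \<in> C" for q x
        unfolding u_def using cINF_lower[OF bdd that] .
      have u_ge: "m \<le> u x" if "\<And>q. q \<in> C \<Longrightarrow> m \<le> q x" for m x
        unfolding u_def using False that by (intro cINF_greatest) auto
      have "sublinear u" unfolding sublinear_def
      proof (intro conjI allI impI)
        fix x y
        have "u (x + y) - b y \<le> u x" if b: "b \<in> C" for b
        proof (rule u_ge)
          fix a assume a: "a \<in> C"
          have sub: "sublinear a" "sublinear b" using CS a b by (auto simp: S_def)
          from chain[OF a b] show "u (x + y) - b y \<le> a x"
          proof
            assume "\<forall>x. a x \<le> b x"
            then have "a y \<le> b y" by blast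
            moreover have "u (x + y) \<le> a x + a y"
              using u_le[OF a, of "x + y"] sub(1) unfolding sublinear_def by (meson order_trans)
            ultimately show ?thesis by simp
          next
            assume "\<forall>x. b x \<le> a x"
            then have "b x \<le> a x" by blast
            moreover have "u (x + y) \<le> b x + b y"
              using u_le[OF b, of "x + y"] sub(2) unfolding sublinear_def by (meson order_trans)
            ultimately show ?thesis by simp
          qed
        qed
        then have "u (x + y) - u x \<le> u y" by (intro u_ge) (smt (verit))
        then show "u (x + y) \<le> u x + u y" by simp
      next
        fix t :: real and x assume t: "t \<ge> 0"
        have hom: "q (t *\<^sub>R x) = t * q x" if "q \<in> C" for q
          using CS that t unfolding S_def sublinear_def by blast
        show "u (t *\<^sub>R x) = t * u x"
        proof (cases "t = 0")
          case True
          have "(INF q\<in>C. q 0) = (INF q\<in>C. 0)" using hom True by (intro INF_cong refl) auto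
          then show ?thesis using True False by (simp add: u_def)
        next
          case nz: False
          with t have t: "t > 0" by simp
          have "t * u x \<le> u (t *\<^sub>R x)"
            using t by (intro u_ge) (auto simp: hom u_le)
          moreover have "(1 / t) * u (t *\<^sub>R x) \<le> u x"
          proof (rule u_ge)
            fix q assume q: "q \<in> C"
            show "(1 / t) * u (t *\<^sub>R x) \<le> q x"
              using u_le[OF q, of "t *\<^sub>R x"] hom[OF q] t by (simp add: field_simps)
          qed
          then have "u (t *\<^sub>R x) \<le> t * u x" using t by (simp add: field_simps)
          ultimately show ?thesis by simp
        qed
      qed
      moreover have "u x \<le> p x" for x
      proof -
        obtain q where "q \<in> C" using False by blast
        then have "u x \<le> q x" "q x \<le> p x" using u_le CS by (auto simp: S_def)
        then show ?thesis by (rule order_trans)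
      qed
      ultimately have "u \<in> S" by (simp add: S_def)
      then show ?thesis unfolding Field using u_le CS by (intro bexI[of _ u]) (auto simp: r_def)
    qed
  qed
  then obtain m where m: "m \<in> S" "\<And>a. a \<in> S \<Longrightarrow> (m, a) \<in> r \<Longrightarrow> a = m"
    using Field by blast
  have "linear m"
  proof (rule sublinear_minimal_linear)
    fix q' assume "sublinear q'" "\<forall>x. q' x \<le> m x"
    then have "q' \<in> S" "(m, q') \<in> r" using m(1) unfolding S_def r_def by (auto intro: order_trans)
    then show "q' = m" using m(2) by blast
  qed (use m in \<open>simp add: S_def\<close>)
  then show ?thesis using m(1) by (intro that) (auto simp: S_def)
qed

text \<open>
  This form of the Hahn--Banach theorem covers extension (\<open>Q\<close> the graph of a functional),
  norming functionals (\<open>Q\<close> a ray) and separation (\<open>Q\<close> the cone over a convex set).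
\<close>

theorem Hahn_Banach_cone:
  fixes p :: "'a::real_vector \<Rightarrow> real"
  assumes p: "sublinear p" and Q0: "(0, 0) \<in> Q"
    and Qadd: "\<And>v c w d. (v, c) \<in> Q \<Longrightarrow> (w, d) \<in> Q \<Longrightarrow> (v + w, c + d) \<in> Q"
    and Qscale: "\<And>t v c. t > 0 \<Longrightarrow> (v, c) \<in> Q \<Longrightarrow> (t *\<^sub>R v, t * c) \<in> Q"
    and Qle: "\<And>v c. (v, c) \<in> Q \<Longrightarrow> c \<le> p v"
  obtains g where "linear g" "\<And>x. g x \<le> p x" "\<And>v c. (v, c) \<in> Q \<Longrightarrow> c \<le> g v"
proof -
  obtain q where q: "sublinear q" "\<And>x. q x \<le> p x" "\<And>v c. (v, c) \<in> Q \<Longrightarrow> q (- v) \<le> - c"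
    using sublinear_reduce[OF assms] by blast
  obtain g where g: "linear g" "\<And>x. g x \<le> q x"
    using sublinear_dominates_linear[OF q(1)] by blast
  show ?thesis
  proof (rule that[OF g(1)])
    show "g x \<le> p x" for x using g(2) q(2) order_trans by blast
    show "c \<le> g v" if "(v, c) \<in> Q" for v c
      using g(2)[of "- v"] q(3)[OF that] linear_neg[OF g(1), of v] by simp
  qed
qed

lemma sublinear_norm: "K \<ge> 0 \<Longrightarrow> sublinear (\<lambda>x::'a::real_normed_vector. K * norm x)"
  unfolding sublinear_def
  by (auto simp: norm_triangle_ineq mult_left_mono simp flip: distrib_left)

lemma linear_bound_abs:
  fixes g :: "'a::real_normed_vector \<Rightarrow> real"
  assumes "linear g" "\<And>x. g x \<le> K * norm x"
  shows "\<bar>g x\<bar> \<le> K * norm x"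
  using assms(2)[of x] assms(2)[of "- x"] linear_neg[OF assms(1), of x] by simp

corollary Hahn_Banach_extension:
  fixes f :: "'a::real_normed_vector \<Rightarrow> real"
  assumes Y: "subspace Y" and K: "K \<ge> 0"
    and add: "\<And>x y. x \<in> Y \<Longrightarrow> y \<in> Y \<Longrightarrow> f (x + y) = f x + f y"
    and scale: "\<And>r x. x \<in> Y \<Longrightarrow> f (r *\<^sub>R x) = r * f x"
    and bound: "\<And>x. x \<in> Y \<Longrightarrow> f x \<le> K * norm x"
  obtains g where "linear g" "\<And>x. \<bar>g x\<bar> \<le> K * norm x" "\<And>y. y \<in> Y \<Longrightarrow> g y = f y"
proof -
  have "0 \<in> Y" using Y by (rule subspace_0)
  then have f0: "f 0 = 0" using scale[of 0 0] by simp
  obtain g where g: "linear g" "\<And>x. g x \<le> K * norm x"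
      "\<And>v c. (v, c) \<in> (\<lambda>y. (y, f y)) ` Y \<Longrightarrow> c \<le> g v"
  proof (rule Hahn_Banach_cone[OF sublinear_norm[OF K], of "(\<lambda>y. (y, f y)) ` Y"])
    show "(0, 0) \<in> (\<lambda>y. (y, f y)) ` Y" using \<open>0 \<in> Y\<close> f0 by force
    show "(v + w, c + d) \<in> (\<lambda>y. (y, f y)) ` Y"
      if "(v, c) \<in> (\<lambda>y. (y, f y)) ` Y" "(w, d) \<in> (\<lambda>y. (y, f y)) ` Y" for v c w d
      using that Y add by (auto simp: image_iff subspace_add)
    show "(t *\<^sub>R v, t * c) \<in> (\<lambda>y. (y, f y)) ` Y" if "(v, c) \<in> (\<lambda>y. (y, f y)) ` Y" for t v c
      using that Y scale by (auto simp: image_iff subspace_scale)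
  qed (use bound in auto)
  have ge: "f y \<le> g y" if "y \<in> Y" for y using g(3) that by blast
  show ?thesis
  proof (rule that[OF g(1) linear_bound_abs[OF g(1,2)]])
    fix y assume y: "y \<in> Y"
    have "f (- y) \<le> g (- y)" using Y y by (intro ge subspace_neg)
    then show "g y = f y" using ge[OF y] scale[OF y, of "-1"] linear_neg[OF g(1), of y] by simp
  qed
qed

corollary Hahn_Banach_norming:
  fixes x :: "'a::real_normed_vector"
  obtains g :: "'a \<Rightarrow> real" where "linear g" "\<And>y. \<bar>g y\<bar> \<le> norm y" "g x = norm x"
proof -
  obtain g where g: "linear g" "\<And>y. g y \<le> 1 * norm y"
      "\<And>v c. (v, c) \<in> (\<lambda>t. (t *\<^sub>R x, t * norm x)) ` {0..} \<Longrightarrow> c \<le> g v"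
  proof (rule Hahn_Banach_cone[OF sublinear_norm[of 1], of "(\<lambda>t. (t *\<^sub>R x, t * norm x)) ` {0..}"])
    fix v w :: 'a and c d :: real
    assume "(v, c) \<in> (\<lambda>t. (t *\<^sub>R x, t * norm x)) ` {0..}" "(w, d) \<in> (\<lambda>t. (t *\<^sub>R x, t * norm x)) ` {0..}"
    then obtain s t where "s \<ge> 0" "t \<ge> 0" "v = s *\<^sub>R x" "c = s * norm x" "w = t *\<^sub>R x" "d = t * norm x"
      by auto
    then show "(v + w, c + d) \<in> (\<lambda>t. (t *\<^sub>R x, t * norm x)) ` {0..}"
      by (intro image_eqI[of _ _ "s + t"]) (auto simp: algebra_simps)
  next
    fix t c :: real and v :: 'a
    assume "t > 0" "(v, c) \<in> (\<lambda>t. (t *\<^sub>R x, t * norm x)) ` {0..}"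
    then obtain s where "s \<ge> 0" "v = s *\<^sub>R x" "c = s * norm x" by auto
    with \<open>t > 0\<close> show "(t *\<^sub>R v, t * c) \<in> (\<lambda>t. (t *\<^sub>R x, t * norm x)) ` {0..}"
      by (intro image_eqI[of _ _ "t * s"]) auto
  qed (auto simp: image_iff)
  have "norm x \<le> g x" by (rule g(3)) (auto intro!: image_eqI[of _ _ 1])
  with g(2)[of x] have "g x = norm x" by simp
  then show ?thesis using g(1) linear_bound_abs[OF g(1,2)] by (intro that[of g]) auto
qed

text \<open>
  With \<open>\<delta>\<close> the distance of \<open>x\<close> from \<open>S\<close>, the requirements \<open>g (x - k) \<ge> \<delta>\<close> for \<open>k \<in> S\<close> span the cone
  of all \<open>(t (x - k), t \<delta>)\<close>, and the norm respects them.
\<close>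

corollary Hahn_Banach_separation:
  fixes S :: "'a::real_normed_vector set"
  assumes S: "convex S" "S \<noteq> {}" and x: "x \<notin> closure S"
  obtains g :: "'a \<Rightarrow> real" and s where "linear g" "\<And>y. \<bar>g y\<bar> \<le> norm y"
    "\<And>y. y \<in> S \<Longrightarrow> g y \<le> s" "s < g x"
proof -
  obtain d where d: "d > 0" "\<And>y. y \<in> S \<Longrightarrow> d \<le> norm (x - y)"
    using x unfolding closure_approachable by (auto simp: not_less dist_norm norm_minus_commute)
  let ?Q = "(\<lambda>(t, y). (t *\<^sub>R (x - y), t * d)) ` ({0..} \<times> S)"
  obtain g where g: "linear g" "\<And>y. g y \<le> 1 * norm y" "\<And>v c. (v, c) \<in> ?Q \<Longrightarrow> c \<le> g v"
  proof (rule Hahn_Banach_cone[OF sublinear_norm[of 1], of ?Q])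
    show "(0, 0) \<in> ?Q" using S(2) by (auto simp: image_iff)
  next
    fix v w :: 'a and c e :: real assume "(v, c) \<in> ?Q" "(w, e) \<in> ?Q"
    then obtain t y u z where h: "t \<ge> 0" "y \<in> S" "v = t *\<^sub>R (x - y)" "c = t * d"
        "u \<ge> 0" "z \<in> S" "w = u *\<^sub>R (x - z)" "e = u * d" by auto
    show "(v + w, c + e) \<in> ?Q"
    proof (cases "t + u = 0")
      case True
      then have "t = 0" "u = 0" using h by auto
      then show ?thesis using h by (auto simp: image_iff)
    next
      case False
      then have tu: "t + u > 0" using h by simp
      let ?y = "(t / (t + u)) *\<^sub>R y + (u / (t + u)) *\<^sub>R z"
      have "?y \<in> S" 
        using S(1) h(1,2,5,6) tu by (intro convexD) (auto simp flip: add_divide_distrib)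
      moreover have "v + w = (t + u) *\<^sub>R (x - ?y)"
      proof -
        have "(t + u) *\<^sub>R ?y = t *\<^sub>R y + u *\<^sub>R z" using tu by (simp add: scaleR_add_right)
        then show ?thesis using h by (simp add: scaleR_diff_right scaleR_add_left)
      qed
      moreover have "c + e = (t + u) * d" using h by (simp add: algebra_simps)
      ultimately show ?thesis using tu by (intro image_eqI[of _ _ "(t + u, ?y)"]) auto
    qed
  next
    fix t c :: real and v :: 'a assume "t > 0" "(v, c) \<in> ?Q"
    then obtain u y where "u \<ge> 0" "y \<in> S" "v = u *\<^sub>R (x - y)" "c = u * d" by auto
    with \<open>t > 0\<close> show "(t *\<^sub>R v, t * c) \<in> ?Q" by (intro image_eqI[of _ _ "(t * u, y)"]) auto
  next
    fix v :: 'a and c :: real assume "(v, c) \<in> ?Q"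
    then show "c \<le> 1 * norm v" using d(2) by (auto intro!: mult_left_mono)
  qed (simp, rule that)
  show ?thesis
  proof (rule that[OF g(1), of "g x - d"])
    show "\<bar>g y\<bar> \<le> norm y" for y using linear_bound_abs[OF g(1,2)] by simp
    show "g y \<le> g x - d" if "y \<in> S" for y
    proof -
      have "d \<le> g (x - y)" using that by (intro g(3)) (auto intro!: image_eqI[of _ _ "(1, y)"])
      then show ?thesis by (simp add: linear_diff[OF g(1)])
    qed
  qed (use d in simp)
qed

section \<open>Bochner integrals without second countability\<close>

text \<open>
  In a space that is not second countable the difference of two Borel functions can fail to be
  Borel. A simple function takes finitely many values, and on each piece the difference is a
  translate of \<open>f\<close>.
\<close>

lemma borel_measurable_norm_diff_simple:
  fixes f :: "'w \<Rightarrow> 'a::real_normed_vector"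
  assumes f: "f \<in> borel_measurable M" and s: "simple_function M s"
  shows "(\<lambda>w. norm (f w - s w)) \<in> borel_measurable M"
proof (rule measurable_compose_countable'[where g = s and I = "s ` space M" and f = "\<lambda>v w. norm (f w - v)"])
  show "(\<lambda>w. norm (f w - v)) \<in> borel_measurable M" for v
    by (rule measurable_compose[OF f]) (intro borel_measurable_continuous_onI continuous_intros)
  show "s \<in> measurable M (count_space (s ` space M))"
    by (rule measurable_count_space_eq2[THEN iffD2])
       (use s in \<open>auto simp: simple_function_def\<close>)
  show "countable (s ` space M)" using s by (simp add: simple_function_def countable_finite)
qed

text \<open>
  All that is used about a density: its integral is compared with that of a simple function by
  means of the \<open>L\<^sup>1\<close> distance.
\<close>

lemma has_bochner_integral_nonsep_norm_diff_le:
  fixes h :: "'w \<Rightarrow> 'a::real_normed_vector"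
  assumes h: "has_bochner_integral_nonsep M h x" and t: "Bochner_Integration.simple_bochner_integrable M t"
  shows "ennreal (norm (x - Bochner_Integration.simple_bochner_integral M t)) \<le> (\<integral>\<^sup>+ w. norm (h w - t w) \<partial>M)"
proof -
  obtain s where hm: "h \<in> borel_measurable M" and s: "\<And>i. Bochner_Integration.simple_bochner_integrable M (s i)"
    and s0: "(\<lambda>i. \<integral>\<^sup>+ w. ennreal (norm (h w - s i w)) \<partial>M) \<longlonglongrightarrow> 0"
    and sx: "(\<lambda>i. Bochner_Integration.simple_bochner_integral M (s i)) \<longlonglongrightarrow> x"
    using h unfolding has_bochner_integral_nonsep_def by blast
  have sf: "simple_function M (s i)" "simple_function M t" for i
    using s t by (auto elim: simple_bochner_integrable.cases)
  have "ennreal (norm (Bochner_Integration.simple_bochner_integral M (s i) - Bochner_Integration.simple_bochner_integral M t)) \<le>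
      (\<integral>\<^sup>+ w. norm (h w - s i w) \<partial>M) + (\<integral>\<^sup>+ w. norm (h w - t w) \<partial>M)" (is "?l i \<le> ?r i") for i
  proof -
    have "ennreal (norm (Bochner_Integration.simple_bochner_integral M (s i) - Bochner_Integration.simple_bochner_integral M t)) =
        norm (Bochner_Integration.simple_bochner_integral M (\<lambda>w. s i w - t w))"
      using s t by (subst simple_bochner_integral_diff) auto
    also have "\<dots> \<le> Bochner_Integration.simple_bochner_integral M (\<lambda>w. norm (s i w - t w))"
      using simple_bochner_integrable_compose2[of "(-)" M "s i" "t"] s t
      by (auto intro!: simple_bochner_integral_norm_bound)
    also have "\<dots> = (\<integral>\<^sup>+w. norm (s i w - t w) \<partial>M)"
      using simple_bochner_integrable_compose2[of "\<lambda>x y. norm (x - y)" M "s i" "t"] s t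
      by (auto intro!: simple_bochner_integral_eq_nn_integral)
    also have "\<dots> \<le> (\<integral>\<^sup>+w. ennreal (norm (h w - s i w)) + ennreal (norm (h w - t w)) \<partial>M)"
    proof (rule nn_integral_mono)
      fix w
      have "norm (s i w - t w) \<le> norm (h w - s i w) + norm (h w - t w)"
        by (metis dual_order.refl norm_diff_triangle_le norm_minus_commute)
      then show "ennreal (norm (s i w - t w)) \<le> ennreal (norm (h w - s i w)) + ennreal (norm (h w - t w))"
        by (simp flip: ennreal_plus)
    qed
    also have "\<dots> = (\<integral>\<^sup>+ w. norm (h w - s i w) \<partial>M) + (\<integral>\<^sup>+ w. norm (h w - t w) \<partial>M)"
      using borel_measurable_norm_diff_simple[OF hm sf(1)[of i]] borel_measurable_norm_diff_simple[OF hm sf(2)]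
      by (intro nn_integral_add) auto
    finally show ?thesis .
  qed
  moreover have "(\<lambda>i. ennreal (norm (Bochner_Integration.simple_bochner_integral M (s i) - Bochner_Integration.simple_bochner_integral M t)))
      \<longlonglongrightarrow> ennreal (norm (x - Bochner_Integration.simple_bochner_integral M t))"
    by (intro tendsto_intros sx)
  moreover have "(\<lambda>i. (\<integral>\<^sup>+ w. norm (h w - s i w) \<partial>M) + (\<integral>\<^sup>+ w. norm (h w - t w) \<partial>M))
      \<longlonglongrightarrow> 0 + (\<integral>\<^sup>+ w. norm (h w - t w) \<partial>M)"
    by (intro tendsto_intros s0)
  ultimately have "ennreal (norm (x - Bochner_Integration.simple_bochner_integral M t)) \<le>
      0 + (\<integral>\<^sup>+ w. norm (h w - t w) \<partial>M)"
    using LIMSEQ_le by blast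
  then show ?thesis by simp
qed

section \<open>Martingales of step functions\<close>

text \<open>
  A bounded vector-valued martingale of step functions, in combinatorial form: the step function of
  stage \<open>n\<close> has the value \<open>x n I\<close> on the part \<open>I\<close> of the partition \<open>\<P> n\<close>, and the average of the next
  step function over \<open>I\<close> is again \<open>x n I\<close>. The partitions generate the \<open>\<sigma>\<close>-algebra; this makes the
  density of the limit measure the limit of the step functions.
\<close>

locale tagged_refinements = finite_measure M for M :: "'w measure" +
  fixes \<P> :: "nat \<Rightarrow> 'w set set" and x :: "nat \<Rightarrow> 'w set \<Rightarrow> 'a::banach" and K :: real
  assumes finite_parts: "finite (\<P> n)"
    and parts: "partition_on (space M) (\<P> n)"
    and parts_sets: "\<P> n \<subseteq> sets M"
    and generated: "sets M = sigma_sets (space M) {\<Union>S | n S. S \<subseteq> \<P> n}"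
    and refine: "J \<in> \<P> (Suc n) \<Longrightarrow> \<exists>I\<in>\<P> n. J \<subseteq> I"
    and average: "I \<in> \<P> n \<Longrightarrow>
      measure M I *\<^sub>R x n I = (\<Sum>J | J \<in> \<P> (Suc n) \<and> J \<subseteq> I. measure M J *\<^sub>R x (Suc n) J)"
    and bound: "I \<in> \<P> n \<Longrightarrow> norm (x n I) \<le> K"
begin

lemma parts_disjnt: "I \<in> \<P> n \<Longrightarrow> J \<in> \<P> n \<Longrightarrow> I \<noteq> J \<Longrightarrow> I \<inter> J = {}"
  using parts[of n] unfolding partition_on_def disjoint_def by blast

lemma parts_nonempty: "I \<in> \<P> n \<Longrightarrow> I \<noteq> {}"
  using parts[of n] unfolding partition_on_def by blast

lemma parts_Union: "\<Union>(\<P> n) = space M"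
  using parts[of n] unfolding partition_on_def by blast

lemma parts_measurable: "I \<in> \<P> n \<Longrightarrow> I \<in> sets M"
  using parts_sets by blast

lemma refine_cases:
  assumes "J \<in> \<P> (Suc n)" "I \<in> \<P> n"
  shows "J \<subseteq> I \<or> J \<inter> I = {}"
  using refine[OF assms(1)] parts_disjnt[OF _ assms(2)] by blast

lemma part_eq_Union: "I \<in> \<P> n \<Longrightarrow> I = \<Union>{J \<in> \<P> (Suc n). J \<subseteq> I}"
  using parts_Union[of n] parts_Union[of "Suc n"] refine_cases[of _ n I] by blast

text \<open>
  The algebra generated by the partition of stage \<open>n\<close>.
\<close>

definition level :: "nat \<Rightarrow> 'w set set" where
  "level n = {\<Union>S | S. S \<subseteq> \<P> n}"

lemma level_Suc: "level n \<subseteq> level (Suc n)"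
proof
  fix A assume "A \<in> level n"
  then obtain S where S: "S \<subseteq> \<P> n" "A = \<Union>S" unfolding level_def by blast
  have "\<Union>S = (\<Union>I\<in>S. \<Union>{J \<in> \<P> (Suc n). J \<subseteq> I})"
  proof -
    have "I = \<Union>{J \<in> \<P> (Suc n). J \<subseteq> I}" if "I \<in> S" for I
      using part_eq_Union[of I n] S(1) that by blast
    then have "(\<Union>I\<in>S. I) = (\<Union>I\<in>S. \<Union>{J \<in> \<P> (Suc n). J \<subseteq> I})" by (rule SUP_cong[OF refl])
    then show ?thesis by simp
  qed
  also have "\<dots> = \<Union>{J \<in> \<P> (Suc n). \<exists>I\<in>S. J \<subseteq> I}" by blast
  finally have "\<Union>S = \<Union>{J \<in> \<P> (Suc n). \<exists>I\<in>S. J \<subseteq> I}" .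
  then show "A \<in> level (Suc n)" unfolding level_def S(2) by blast
qed

lemma level_mono: "m \<le> n \<Longrightarrow> level m \<subseteq> level n"
  using lift_Suc_mono_le[of level, OF level_Suc] .

lemma level_sets: "A \<in> level n \<Longrightarrow> A \<in> sets M"
proof -
  assume "A \<in> level n"
  then obtain S where S: "S \<subseteq> \<P> n" "A = \<Union>S" unfolding level_def by blast
  then show ?thesis
    using finite_parts[of n] parts_sets[of n] by (metis finite_subset sets.finite_Union subset_trans)
qed

lemma level_Un: "A \<in> level n \<Longrightarrow> B \<in> level n \<Longrightarrow> A \<union> B \<in> level n"
proof -
  assume "A \<in> level n" "B \<in> level n"
  then obtain S T where "S \<subseteq> \<P> n" "A = \<Union>S" "T \<subseteq> \<P> n" "B = \<Union>T" unfolding level_def by blast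
  then show ?thesis unfolding level_def by (auto intro!: exI[of _ "S \<union> T"])
qed

lemma level_Compl: "A \<in> level n \<Longrightarrow> space M - A \<in> level n"
proof -
  assume "A \<in> level n"
  then obtain S where S: "S \<subseteq> \<P> n" "A = \<Union>S" unfolding level_def by blast
  have "space M - A = \<Union>(\<P> n - S)"
  proof -
    have "I \<inter> J = {}" if "I \<in> \<P> n - S" "J \<in> S" for I J
      using that S(1) by (intro parts_disjnt[of I n J]) auto
    then have "(\<Union>(\<P> n - S)) \<inter> \<Union>S = {}" by blast
    moreover have "\<Union>(\<P> n - S) \<union> \<Union>S = space M"
      unfolding Union_Un_distrib[symmetric] using S(1) parts_Union[of n] by (simp add: Un_absorb2)
    ultimately show ?thesis unfolding S(2) by blast
  qed
  then show ?thesis unfolding level_def by blast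
qed

lemma level_cases:
  assumes "A \<in> level n" "I \<in> \<P> n"
  shows "I \<subseteq> A \<or> A \<inter> I = {}"
  using assms parts_disjnt[of _ n I] unfolding level_def by blast

text \<open>
  The sets with the approximation property form a \<open>\<sigma>\<close>-algebra. For a countable union, a finite part
  of the union is approximated, and finitely many approximating sets lie in a common level.
\<close>

lemma approx_level:
  assumes "A \<in> sets M" "\<delta> > 0"
  shows "\<exists>n. \<exists>B\<in>level n. measure M ((A - B) \<union> (B - A)) < \<delta>"
proof -
  have "A \<in> sigma_sets (space M) {\<Union>S | n S. S \<subseteq> \<P> n}" using assms(1) generated by simp
  then show ?thesis using assms(2)
  proof (induction arbitrary: \<delta> rule: sigma_sets.induct)
    case (Basic a)
    then obtain n where "a \<in> level n" unfolding level_def by blast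
    then show ?case using Basic by (intro exI[of _ n] bexI[of _ a]) auto
  next
    case Empty
    have "{} \<in> level 0" unfolding level_def by blast
    then show ?case using Empty by (intro exI[of _ 0] bexI[of _ "{}"]) auto
  next
    case (Compl a)
    then obtain n B where B: "B \<in> level n" "measure M ((a - B) \<union> (B - a)) < \<delta>" by blast
    have "a \<subseteq> space M"
      using Compl.hyps generated sets.sets_into_space by blast
    moreover have "B \<subseteq> space M" using level_sets[OF B(1)] sets.sets_into_space by blast
    ultimately have "(space M - a - (space M - B)) \<union> (space M - B - (space M - a)) = (a - B) \<union> (B - a)"
      by blast
    then show ?case using B level_Compl by metis
  next
    case (Union a)
    have aM: "a i \<in> sets M" for i using Union.hyps generated by blast
    let ?A = "\<Union>i. a i"
    have "(\<lambda>n. measure M (\<Union>i\<le>n. a i)) \<longlonglongrightarrow> measure M (\<Union>n. \<Union>i\<le>n. a i)"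
      by (rule finite_Lim_measure_incseq) (use aM in \<open>force simp: incseq_def\<close>)+
    also have "(\<Union>n. \<Union>i\<le>n. a i) = ?A" by auto
    finally obtain N where N: "dist (measure M (\<Union>i\<le>N. a i)) (measure M ?A) < \<delta> / 2"
      using Union.prems metric_LIMSEQ_D[of _ _ "\<delta> / 2"] by (metis half_gt_zero order_refl)
    let ?d = "\<delta> / (2 * (real N + 1))"
    have "?d > 0" using Union.prems by simp
    then have "\<forall>i. \<exists>n. \<exists>B\<in>level n. measure M ((a i - B) \<union> (B - a i)) < ?d"
      using Union.IH by blast
    then obtain k B where kB: "\<And>i. B i \<in> level (k i)" "\<And>i. measure M ((a i - B i) \<union> (B i - a i)) < ?d"
      by metis
    define m where "m = Max (k ` {..N})"
    have Bm: "B i \<in> level m" if "i \<le> N" for i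
      using kB(1)[of i] level_mono[of "k i" m] that by (auto simp: m_def)
    have "(\<Union>i\<le>j. B i) \<in> level m" if "j \<le> N" for j
      using that
    proof (induction j)
      case (Suc j)
      then show ?case using level_Un[of "\<Union>i\<le>j. B i" m "B (Suc j)"] Bm[of "Suc j"] 
        by (simp add: atMost_Suc Un_commute)
    qed (use Bm in auto)
    then have BN: "(\<Union>i\<le>N. B i) \<in> level m" by simp
    have BM: "B i \<in> sets M" for i using kB(1) level_sets by blast
    have "measure M ((?A - (\<Union>i\<le>N. B i)) \<union> ((\<Union>i\<le>N. B i) - ?A)) \<le>
        measure M ((?A - (\<Union>i\<le>N. a i)) \<union> (\<Union>i\<le>N. (a i - B i) \<union> (B i - a i)))"
      by (rule finite_measure_mono) (use aM BM in auto)
    also have "\<dots> \<le> measure M (?A - (\<Union>i\<le>N. a i)) + measure M (\<Union>i\<le>N. (a i - B i) \<union> (B i - a i))"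
      by (rule measure_Un_le) (use aM BM in auto)
    also have "measure M (?A - (\<Union>i\<le>N. a i)) = measure M ?A - measure M (\<Union>i\<le>N. a i)"
      by (rule finite_measure_Diff) (use aM in auto)
    also have "measure M (\<Union>i\<le>N. (a i - B i) \<union> (B i - a i)) \<le> (\<Sum>i\<le>N. measure M ((a i - B i) \<union> (B i - a i)))"
      by (rule finite_measure_subadditive_finite) (use aM BM in auto)
    also have "\<dots> \<le> (\<Sum>i\<le>N. ?d)" by (rule sum_mono) (use kB(2) less_imp_le in blast)
    also have "\<dots> = \<delta> / 2" by (simp add: field_simps)
    finally have "measure M ((?A - (\<Union>i\<le>N. B i)) \<union> ((\<Union>i\<le>N. B i) - ?A)) < \<delta>"
      using N abs_ge_minus_self[of "measure M (\<Union>i\<le>N. a i) - measure M ?A"]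
      unfolding dist_real_def by linarith
    then show ?case using BN by blast
  qed
qed

text \<open>
  The integral over \<open>E\<close> of the step function of stage \<open>n\<close>.
\<close>

definition stage :: "nat \<Rightarrow> 'w set \<Rightarrow> 'a" where
  "stage n E = (\<Sum>J\<in>\<P> n. measure M (E \<inter> J) *\<^sub>R x n J)"

lemma sum_measure_parts:
  assumes E: "E \<in> sets M"
  shows "(\<Sum>J\<in>\<P> n. measure M (E \<inter> J)) = measure M E"
proof -
  have "measure M (\<Union>J\<in>\<P> n. E \<inter> J) = (\<Sum>J\<in>\<P> n. measure M (E \<inter> J))"
  proof (intro finite_measure_finite_Union finite_parts)
    show "disjoint_family_on ((\<inter>) E) (\<P> n)"
      unfolding disjoint_family_on_def using parts_disjnt[of _ n] by blast
  qed (use E parts_measurable in blast)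
  moreover have "(\<Union>J\<in>\<P> n. E \<inter> J) = E"
    using sets.sets_into_space[OF E] parts_Union[of n] by blast
  ultimately show ?thesis by simp
qed

lemma norm_stage_diff_le:
  assumes E: "E \<in> sets M" and B: "B \<in> sets M"
  shows "norm (stage n E - stage n B) \<le> K * measure M ((E - B) \<union> (B - E))"
proof -
  let ?D = "(E - B) \<union> (B - E)"
  have "stage n E - stage n B = (\<Sum>J\<in>\<P> n. (measure M (E \<inter> J) - measure M (B \<inter> J)) *\<^sub>R x n J)"
    by (simp add: stage_def sum_subtractf scaleR_diff_left)
  also have "norm \<dots> \<le> (\<Sum>J\<in>\<P> n. measure M (?D \<inter> J) * K)"
  proof (rule sum_norm_le)
    fix J assume J: "J \<in> \<P> n"
    have JM: "J \<in> sets M" using parts_measurable J .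
    have "measure M (E \<inter> J) \<le> measure M ((B \<inter> J) \<union> (?D \<inter> J))"
      "measure M (B \<inter> J) \<le> measure M ((E \<inter> J) \<union> (?D \<inter> J))"
      by (intro finite_measure_mono; use E B JM in auto)+
    moreover have "measure M ((B \<inter> J) \<union> (?D \<inter> J)) \<le> measure M (B \<inter> J) + measure M (?D \<inter> J)"
      "measure M ((E \<inter> J) \<union> (?D \<inter> J)) \<le> measure M (E \<inter> J) + measure M (?D \<inter> J)"
      by (intro measure_Un_le; use E B JM in auto)+
    ultimately have "\<bar>measure M (E \<inter> J) - measure M (B \<inter> J)\<bar> \<le> measure M (?D \<inter> J)" by linarith
    then show "norm ((measure M (E \<inter> J) - measure M (B \<inter> J)) *\<^sub>R x n J) \<le> measure M (?D \<inter> J) * K"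
      using bound[OF J] by (simp add: mult_mono)
  qed
  also have "\<dots> = K * measure M ?D"
    using sum_measure_parts[of ?D n] E B by (simp flip: sum_distrib_right add: mult.commute[of K])
  finally show ?thesis .
qed

lemma stage_Un:
  assumes "E \<in> sets M" "F \<in> sets M" "E \<inter> F = {}"
  shows "stage n (E \<union> F) = stage n E + stage n F"
proof -
  have "measure M ((E \<union> F) \<inter> J) = measure M (E \<inter> J) + measure M (F \<inter> J)" if "J \<in> \<P> n" for J
    using assms parts_measurable[OF that]
    by (subst finite_measure_Union[symmetric]) (auto intro!: arg_cong[where f = "measure M"])
  then show ?thesis by (simp add: stage_def sum.distrib[symmetric] scaleR_add_left)
qed

lemma sum_refine:
  fixes f :: "'w set \<Rightarrow> 'b::comm_monoid_add"
  shows "(\<Sum>J\<in>\<P> (Suc n). f J) = (\<Sum>I\<in>\<P> n. \<Sum>J | J \<in> \<P> (Suc n) \<and> J \<subseteq> I. f J)"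
proof -
  have "\<P> (Suc n) = (\<Union>I\<in>\<P> n. {J. J \<in> \<P> (Suc n) \<and> J \<subseteq> I})"
    using refine[of _ n] by auto
  also have "(\<Sum>J\<in>\<dots>. f J) = (\<Sum>I\<in>\<P> n. \<Sum>J | J \<in> \<P> (Suc n) \<and> J \<subseteq> I. f J)"
  proof (rule sum.UNION_disjoint)
    show "\<forall>i\<in>\<P> n. \<forall>j\<in>\<P> n. i \<noteq> j \<longrightarrow>
        {J \<in> \<P> (Suc n). J \<subseteq> i} \<inter> {J \<in> \<P> (Suc n). J \<subseteq> j} = {}"
    proof (intro ballI impI)
      fix I J assume "I \<in> \<P> n" "J \<in> \<P> n" "I \<noteq> J"
      then have "I \<inter> J = {}" by (rule parts_disjnt)
      then show "{L \<in> \<P> (Suc n). L \<subseteq> I} \<inter> {L \<in> \<P> (Suc n). L \<subseteq> J} = {}"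
        using parts_nonempty[of _ "Suc n"] by force
    qed
  qed (use finite_parts in auto)
  finally show ?thesis .
qed

lemma stage_part: "I \<in> \<P> n \<Longrightarrow> stage n I = measure M I *\<^sub>R x n I"
proof -
  assume I: "I \<in> \<P> n"
  have "stage n I = (\<Sum>J\<in>\<P> n. if J = I then measure M I *\<^sub>R x n I else 0)"
    unfolding stage_def using parts_disjnt[OF _ I] by (intro sum.cong refl) (auto simp: Int_commute)
  then show ?thesis using I finite_parts by simp
qed

lemma stage_Suc:
  assumes A: "A \<in> level n"
  shows "stage (Suc n) A = stage n A"
  unfolding stage_def[of "Suc n"] sum_refine unfolding stage_def
proof (rule sum.cong[OF refl])
  fix I assume I: "I \<in> \<P> n"
  show "(\<Sum>J | J \<in> \<P> (Suc n) \<and> J \<subseteq> I. measure M (A \<inter> J) *\<^sub>R x (Suc n) J) = measure M (A \<inter> I) *\<^sub>R x n I"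
    using level_cases[OF A I]
  proof
    assume IA: "I \<subseteq> A"
    then have "A \<inter> I = I" "\<And>J. J \<subseteq> I \<Longrightarrow> A \<inter> J = J" by auto
    then show ?thesis using average[OF I] by (auto intro!: sum.cong)
  next
    assume "A \<inter> I = {}"
    moreover from this have "A \<inter> J = {}" if "J \<subseteq> I" for J using that by blast
    ultimately show ?thesis by (auto intro!: sum.neutral)
  qed
qed

lemma stage_level:
  assumes A: "A \<in> level n" and "n \<le> m"
  shows "stage m A = stage n A"
  using assms(2)
proof (induction m rule: dec_induct)
  case (step m)
  then show ?case using stage_Suc[of A m] level_mono[of n m] A by auto
qed simp

text \<open>
  On a set of some level the integrals are eventually constant by the averaging property, and they
  depend on the set in a Lipschitz way, uniformly in the stage.
\<close>

lemma stage_convergent: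
  assumes E: "E \<in> sets M"
  shows "convergent (\<lambda>n. stage n E)"
proof (rule Cauchy_convergent, rule metric_CauchyI)
  fix e :: real assume e: "e > 0"
  define d where "d = e / (2 * (\<bar>K\<bar> + 1))"
  have d: "d > 0" using e by (simp add: d_def)
  obtain n B where B: "B \<in> level n" "measure M ((E - B) \<union> (B - E)) < d"
    using approx_level[OF E d] by blast
  have "K * measure M ((E - B) \<union> (B - E)) \<le> \<bar>K\<bar> * d"
    by (rule mult_mono) (use B(2) in auto)
  also have "\<dots> < (\<bar>K\<bar> + 1) * d" using d by simp
  also have "\<dots> = e / 2" by (simp add: d_def field_simps)
  finally have close: "norm (stage m E - stage m B) < e / 2" for m
    using norm_stage_diff_le[OF E level_sets[OF B(1)], of m] by simp
  show "\<exists>N. \<forall>m\<ge>N. \<forall>k\<ge>N. dist (stage m E) (stage k E) < e"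
  proof (intro exI allI impI)
    fix m k assume "n \<le> m" "n \<le> k"
    then have "stage m B = stage k B" using stage_level[OF B(1)] by metis
    then have "stage m E - stage k E = (stage m E - stage m B) - (stage k E - stage k B)" by simp
    also have "norm \<dots> \<le> norm (stage m E - stage m B) + norm (stage k E - stage k B)"
      by (rule norm_triangle_ineq4)
    also have "\<dots> < e" using close[of m] close[of k] by simp
    finally show "dist (stage m E) (stage k E) < e" by (simp add: dist_norm)
  qed
qed

definition limit_measure :: "'w set \<Rightarrow> 'a" where
  "limit_measure E = lim (\<lambda>n. stage n E)"

lemma stage_LIMSEQ: "E \<in> sets M \<Longrightarrow> (\<lambda>n. stage n E) \<longlonglongrightarrow> limit_measure E"
  using stage_convergent unfolding limit_measure_def by (simp add: convergent_LIMSEQ_iff)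

lemma limit_measure_Un:
  assumes "E \<in> sets M" "F \<in> sets M" "E \<inter> F = {}"
  shows "limit_measure (E \<union> F) = limit_measure E + limit_measure F"
proof (rule LIMSEQ_unique)
  show "(\<lambda>n. stage n (E \<union> F)) \<longlonglongrightarrow> limit_measure (E \<union> F)"
    using assms by (intro stage_LIMSEQ) auto
  show "(\<lambda>n. stage n (E \<union> F)) \<longlonglongrightarrow> limit_measure E + limit_measure F"
    using tendsto_add[OF stage_LIMSEQ[OF assms(1)] stage_LIMSEQ[OF assms(2)]]
    by (simp add: stage_Un[OF assms])
qed

lemma limit_measure_empty: "limit_measure {} = 0"
  using limit_measure_Un[of "{}" "{}"] by simp

lemma norm_limit_measure_le:
  assumes E: "E \<in> sets M"
  shows "norm (limit_measure E) \<le> K * measure M E"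
proof (rule LIMSEQ_le_const2[OF tendsto_norm[OF stage_LIMSEQ[OF E]]])
  have "stage n {} = 0" for n by (simp add: stage_def)
  then show "\<exists>N. \<forall>n\<ge>N. norm (stage n E) \<le> K * measure M E"
    using norm_stage_diff_le[OF E, of "{}"] by simp
qed

lemma limit_measure_level:
  assumes A: "A \<in> level n"
  shows "limit_measure A = stage n A"
proof (rule LIMSEQ_unique[OF stage_LIMSEQ[OF level_sets[OF A]]])
  show "(\<lambda>m. stage m A) \<longlonglongrightarrow> stage n A"
    by (rule tendsto_eventually, unfold eventually_sequentially) (blast intro: stage_level[OF A])
qed

lemma limit_measure_part:
  assumes I: "I \<in> \<P> n"
  shows "limit_measure I = measure M I *\<^sub>R x n I"
proof -
  have "I \<in> level n" unfolding level_def using I by (auto intro!: exI[of _ "{I}"])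
  then show ?thesis using limit_measure_level stage_part[OF I] by simp
qed

text \<open>
  Finite additivity passes to the limit, and the domination by \<open>K\<close> times the scalar measure turns it
  into countable additivity.
\<close>

lemma vector_measure_limit_measure: "vector_measure M limit_measure"
  unfolding vector_measure_def
proof (intro allI impI, elim conjE)
  fix E :: "nat \<Rightarrow> 'w set" assume E: "range E \<subseteq> sets M" "disjoint_family E"
  have EM: "E i \<in> sets M" for i using E by blast
  have fin: "(\<Sum>i<n. limit_measure (E i)) = limit_measure (\<Union>i<n. E i)" for n
  proof (induction n)
    case (Suc n)
    have "E i \<inter> E n = {}" if "i < n" for i
      using disjoint_family_onD[OF E(2), of i n] that by simp
    then have "(\<Union>i<n. E i) \<inter> E n = {}" by blast
    then have "limit_measure ((\<Union>i<n. E i) \<union> E n) = limit_measure (\<Union>i<n. E i) + limit_measure (E n)"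
      using EM by (intro limit_measure_Un) auto
    then show ?case using Suc by (simp add: lessThan_Suc Un_commute)
  qed (simp add: limit_measure_empty)
  have "norm (limit_measure (\<Union>i. E i) - (\<Sum>i<n. limit_measure (E i))) \<le>
      K * (measure M (\<Union>i. E i) - measure M (\<Union>i<n. E i))" for n
  proof -
    let ?F = "\<Union>i<n. E i" and ?A = "\<Union>i. E i"
    have FM: "?F \<in> sets M" "?A \<in> sets M" using EM by auto
    have "limit_measure (?F \<union> (?A - ?F)) = limit_measure ?F + limit_measure (?A - ?F)"
      by (rule limit_measure_Un) (use FM in auto)
    moreover have "?F \<union> (?A - ?F) = ?A" by auto
    ultimately have "limit_measure ?A - (\<Sum>i<n. limit_measure (E i)) = limit_measure (?A - ?F)"
      by (simp add: fin)
    also have "norm \<dots> \<le> K * measure M (?A - ?F)"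
      by (rule norm_limit_measure_le) (use FM in auto)
    also have "measure M (?A - ?F) = measure M ?A - measure M ?F"
      by (rule finite_measure_Diff) (use FM in auto)
    finally show ?thesis .
  qed
  moreover have "(\<lambda>n. K * (measure M (\<Union>i. E i) - measure M (\<Union>i<n. E i))) \<longlonglongrightarrow> 0"
  proof -
    have "(\<lambda>n. measure M (\<Union>i<n. E i)) \<longlonglongrightarrow> measure M (\<Union>n. \<Union>i<n. E i)"
      by (rule finite_Lim_measure_incseq) (use EM in \<open>force simp: incseq_def\<close>)+
    moreover have "(\<Union>n. \<Union>i<n. E i) = (\<Union>i. E i)" by auto
    ultimately have "(\<lambda>n. K * (measure M (\<Union>i. E i) - measure M (\<Union>i<n. E i))) \<longlonglongrightarrow>
        K * (measure M (\<Union>i. E i) - measure M (\<Union>i. E i))"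
      by (intro tendsto_intros) simp
    then show ?thesis by simp
  qed
  ultimately have "(\<lambda>n. limit_measure (\<Union>i. E i) - (\<Sum>i<n. limit_measure (E i))) \<longlonglongrightarrow> 0"
    by (rule_tac Lim_null_comparison[rotated]) (auto intro!: always_eventually)
  then show "(\<lambda>n. limit_measure (E n)) sums limit_measure (\<Union>n. E n)"
    unfolding sums_def by (rule Lim_transform2[OF tendsto_const])
qed

lemma bounded_variation_limit_measure: "bounded_variation M limit_measure"
  unfolding bounded_variation_def
proof (intro exI allI impI, elim conjE)
  fix P assume P: "finite P" "P \<subseteq> sets M" "disjoint P" "\<Union>P = space M"
  have "(\<Sum>E\<in>P. norm (limit_measure E)) \<le> (\<Sum>E\<in>P. K * measure M E)"
    using P(2) by (intro sum_mono norm_limit_measure_le) auto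
  also have "\<dots> = K * (\<Sum>E\<in>P. measure M E)" by (simp add: sum_distrib_left)
  also have "(\<Sum>E\<in>P. measure M E) = measure M (\<Union>E\<in>P. E)"
    using P by (intro finite_measure_finite_Union[symmetric])
      (auto simp: disjoint_family_on_def disjoint_def)
  finally show "(\<Sum>E\<in>P. norm (limit_measure E)) \<le> K * measure M (space M)" using P(4) by simp
qed

text \<open>
  Step functions of the partitions are \<open>L\<^sup>1\<close>-dense in the simple functions: the fibres of \<open>s\<close> are
  replaced by nearby sets of a common level.
\<close>

lemma step_approx:
  fixes s :: "'w \<Rightarrow> 'a"
  assumes s: "simple_function M s" and \<delta>: "\<delta> > 0"
  obtains N y where "simple_function M y" "(\<integral>\<^sup>+ w. norm (s w - y w) \<partial>M) < ennreal \<delta>"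
    "\<And>J v w. J \<in> \<P> N \<Longrightarrow> v \<in> J \<Longrightarrow> w \<in> J \<Longrightarrow> y v = (y w :: 'a)"
proof -
  define V where "V = s ` space M"
  have V: "finite V" using s by (simp add: V_def simple_function_def)
  define A where "A v = s -` {v} \<inter> space M" for v
  have A: "A v \<in> sets M" for v
    unfolding A_def using s by (rule simple_functionD(2))
  \<comment> \<open>the weight of the value \<open>v\<close> is at most \<open>norm v\<close>; the summand 1 keeps the denominator positive\<close>
  define d where "d = \<delta> / (1 + (\<Sum>v\<in>V. norm v))"
  have d: "d > 0" using \<delta> unfolding d_def by (intro divide_pos_pos add_pos_nonneg sum_nonneg) auto
  have "\<forall>v. \<exists>n. \<exists>B\<in>level n. measure M ((A v - B) \<union> (B - A v)) < d"
    using approx_level[OF A d] by blast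
  then obtain k B where kB: "\<And>v. B v \<in> level (k v)" "\<And>v. measure M ((A v - B v) \<union> (B v - A v)) < d"
    by metis
  define N where "N = Max (insert 0 (k ` V))"
  have BN: "B v \<in> level N" if "v \<in> V" for v
    using kB(1)[of v] level_mono[of "k v" N] that V by (auto simp: N_def)
  have BM: "B v \<in> sets M" for v using kB(1) level_sets by blast
  define y where "y w = (\<Sum>v\<in>V. indicator (B v) w *\<^sub>R v)" for w
  have sy: "simple_function M y"
    unfolding y_def
    by (intro simple_function_sum simple_function_compose1[of M "indicator (B _)" "\<lambda>r. r *\<^sub>R _", unfolded o_def]
        simple_function_indicator BM)
  have s_eq: "s w = (\<Sum>v\<in>V. indicator (A v) w *\<^sub>R v)" if w: "w \<in> space M" for w
  proof -
    have "(\<Sum>v\<in>V. indicator (A v) w *\<^sub>R v) = (\<Sum>v\<in>V. if v = s w then v else 0)"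
      using w by (intro sum.cong refl) (auto simp: A_def indicator_def)
    then show ?thesis using w V by (simp add: V_def)
  qed
  let ?D = "\<lambda>v. (A v - B v) \<union> (B v - A v)"
  have "(\<integral>\<^sup>+ w. norm (s w - y w) \<partial>M) \<le> (\<integral>\<^sup>+ w. (\<Sum>v\<in>V. ennreal (norm v) * indicator (?D v) w) \<partial>M)"
  proof (rule nn_integral_mono)
    fix w assume w: "w \<in> space M"
    have "s w - y w = (\<Sum>v\<in>V. (indicator (A v) w - indicator (B v) w) *\<^sub>R v)"
      unfolding s_eq[OF w] y_def by (simp add: sum_subtractf scaleR_diff_left)
    also have "norm \<dots> \<le> (\<Sum>v\<in>V. norm v * indicator (?D v) w)"
      by (rule sum_norm_le) (auto simp: indicator_def)
    finally have "ennreal (norm (s w - y w)) \<le> ennreal (\<Sum>v\<in>V. norm v * indicator (?D v) w)"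
      by (rule ennreal_leI)
    also have "\<dots> = (\<Sum>v\<in>V. ennreal (norm v * indicator (?D v) w))"
      by (rule sum_ennreal[symmetric]) auto
    also have "\<dots> = (\<Sum>v\<in>V. ennreal (norm v) * indicator (?D v) w)"
      by (intro sum.cong refl) (auto simp: indicator_def)
    finally show "ennreal (norm (s w - y w)) \<le> (\<Sum>v\<in>V. ennreal (norm v) * indicator (?D v) w)" .
  qed
  also have "\<dots> = (\<Sum>v\<in>V. \<integral>\<^sup>+ w. ennreal (norm v) * indicator (?D v) w \<partial>M)"
    using A BM by (intro nn_integral_sum) auto
  also have "\<dots> = (\<Sum>v\<in>V. ennreal (norm v * measure M (?D v)))"
  proof (rule sum.cong[OF refl])
    fix v
    have "?D v \<in> sets M" using A BM by auto
    then show "(\<integral>\<^sup>+ w. ennreal (norm v) * indicator (?D v) w \<partial>M) = ennreal (norm v * measure M (?D v))"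
      by (subst nn_integral_cmult_indicator) (simp_all add: emeasure_eq_measure ennreal_mult)
  qed
  also have "\<dots> = ennreal (\<Sum>v\<in>V. norm v * measure M (?D v))"
    by (rule sum_ennreal) auto
  also have "\<dots> < ennreal \<delta>"
  proof (rule ennreal_lessI[OF \<delta>])
    have "(\<Sum>v\<in>V. norm v * measure M (?D v)) \<le> (\<Sum>v\<in>V. norm v * d)"
      by (intro sum_mono mult_left_mono order.strict_implies_order[OF kB(2)]) auto
    also have "\<dots> = (\<Sum>v\<in>V. norm v) * d" by (simp add: sum_distrib_right)
    also have "\<dots> < (1 + (\<Sum>v\<in>V. norm v)) * d" by (rule mult_strict_right_mono[OF _ d]) simp
    also have "\<dots> = \<delta>" 
    proof -
      have "1 + (\<Sum>v\<in>V. norm v) > 0" by (intro add_pos_nonneg sum_nonneg) auto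
      then show ?thesis unfolding d_def by simp
    qed
    finally show "(\<Sum>v\<in>V. norm v * measure M (?D v)) < \<delta>" .
  qed
  finally have close: "(\<integral>\<^sup>+ w. norm (s w - y w) \<partial>M) < ennreal \<delta>" .
  show ?thesis
  proof (rule that[OF sy close])
    fix J u w assume J: "J \<in> \<P> N" "u \<in> J" "w \<in> J"
    show "y u = y w"
      unfolding y_def
    proof (intro sum.cong refl)
      fix v assume "v \<in> V"
      then show "indicator (B v) u *\<^sub>R v = indicator (B v) w *\<^sub>R v"
        using level_cases[OF BN J(1)] J(2,3) by (auto simp: indicator_def)
    qed
  qed
qed


lemma sum_measure_children:
  assumes I: "I \<in> \<P> n"
  shows "(\<Sum>J | J \<in> \<P> (Suc n) \<and> J \<subseteq> I. measure M J) = measure M I"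
proof -
  have "(\<Sum>J | J \<in> \<P> (Suc n) \<and> J \<subseteq> I. measure M J) = (\<Sum>J | J \<in> \<P> (Suc n) \<and> J \<subseteq> I. measure M (I \<inter> J))"
    by (rule sum.cong) (auto simp: Int_absorb1)
  also have "\<dots> = (\<Sum>J\<in>\<P> (Suc n). measure M (I \<inter> J))"
  proof (rule sum.mono_neutral_left)
    show "\<forall>J\<in>\<P> (Suc n) - {J. J \<in> \<P> (Suc n) \<and> J \<subseteq> I}. measure M (I \<inter> J) = 0"
    proof
      fix J assume "J \<in> \<P> (Suc n) - {J. J \<in> \<P> (Suc n) \<and> J \<subseteq> I}"
      then have "I \<inter> J = {}" using refine_cases[OF _ I, of J] by blast
      then show "measure M (I \<inter> J) = 0" by simp
    qed
  qed (use finite_parts in auto)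
  also have "\<dots> = measure M I" by (rule sum_measure_parts[OF parts_measurable[OF I]])
  finally show ?thesis .
qed

lemma simple_bochner_integral_indicator:
  assumes J: "J \<in> sets M"
  shows "Bochner_Integration.simple_bochner_integrable M (\<lambda>w. indicator J w *\<^sub>R v)"
    and "Bochner_Integration.simple_bochner_integral M (\<lambda>w. indicator J w *\<^sub>R v) = measure M J *\<^sub>R v"
proof -
  have sf: "simple_function M (\<lambda>w. indicator J w :: real)"
    using J by (rule simple_function_indicator)
  have int: "Bochner_Integration.simple_bochner_integrable M (\<lambda>w. indicator J w :: real)"
    by (rule simple_bochner_integrable.intros[OF sf]) (simp add: emeasure_eq_measure)
  have "simple_function M (\<lambda>w. indicator J w *\<^sub>R v)"
    using simple_function_compose1[OF sf, of "\<lambda>r. r *\<^sub>R v"] by simp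
  then show "Bochner_Integration.simple_bochner_integrable M (\<lambda>w. indicator J w *\<^sub>R v)"
    by (rule simple_bochner_integrable.intros) (simp add: emeasure_eq_measure)
  have "ennreal (Bochner_Integration.simple_bochner_integral M (\<lambda>w. indicator J w :: real)) =
      (\<integral>\<^sup>+ w. ennreal (indicator J w) \<partial>M)"
    by (rule simple_bochner_integral_eq_nn_integral[OF int]) simp
  also have "\<dots> = ennreal (measure M J)"
    using J by (simp add: ennreal_indicator emeasure_eq_measure)
  finally have "Bochner_Integration.simple_bochner_integral M (\<lambda>w. indicator J w :: real) = measure M J"
    by (simp add: simple_bochner_integral_nonneg)
  then show "Bochner_Integration.simple_bochner_integral M (\<lambda>w. indicator J w *\<^sub>R v) = measure M J *\<^sub>R v"
    using simple_bochner_integral_linear[OF linear_scaleR_left int, of v] by simp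
qed

text \<open>
  The martingale converges in \<open>L\<^sup>1\<close> to the density \<open>g\<close> of its limit measure. Let \<open>y\<close> be a step function
  of stage \<open>N\<close> close to \<open>g\<close>. The values of stages \<open>N\<close> and \<open>Suc N\<close> are averages of \<open>g\<close>, so both step
  functions are as close to \<open>y\<close> as \<open>g\<close> is.
\<close>

lemma increments_small:
  assumes g: "\<And>E. E \<in> sets M \<Longrightarrow>
      has_bochner_integral_nonsep M (\<lambda>w. indicator E w *\<^sub>R g w) (limit_measure E)"
    and c: "c > 0"
  obtains n where
    "(\<Sum>I\<in>\<P> n. \<Sum>J | J \<in> \<P> (Suc n) \<and> J \<subseteq> I. measure M J * norm (x (Suc n) J - x n I)) < c"
proof -
  define h where "h w = indicator (space M) w *\<^sub>R g w" for w
  have "has_bochner_integral_nonsep M h (limit_measure (space M))"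
    using g[OF sets.top] unfolding h_def .
  then obtain s where hm: "h \<in> borel_measurable M"
    and s: "\<And>i. Bochner_Integration.simple_bochner_integrable M (s i)"
    and s0: "(\<lambda>i. \<integral>\<^sup>+ w. ennreal (norm (h w - s i w)) \<partial>M) \<longlonglongrightarrow> 0"
    unfolding has_bochner_integral_nonsep_def by blast
  have "eventually (\<lambda>i. (\<integral>\<^sup>+ w. ennreal (norm (h w - s i w)) \<partial>M) < ennreal (c / 4)) sequentially"
    by (rule order_tendstoD(2)[OF s0]) (use c in simp)
  then obtain i where i: "(\<integral>\<^sup>+ w. ennreal (norm (h w - s i w)) \<partial>M) < ennreal (c / 4)"
    by (auto simp: eventually_sequentially)
  have sf: "simple_function M (s i)" using s[of i] by (auto elim: simple_bochner_integrable.cases)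
  have c4: "c / 4 > 0" using c by simp
  obtain N y where y: "simple_function M y" "(\<integral>\<^sup>+ w. norm (s i w - y w) \<partial>M) < ennreal (c / 4)"
    and const: "\<And>J v w. J \<in> \<P> N \<Longrightarrow> v \<in> J \<Longrightarrow> w \<in> J \<Longrightarrow> y v = y w"
    by (rule step_approx[OF sf c4]) (rule that)
  have hy_meas: "(\<lambda>w. norm (h w - y w)) \<in> borel_measurable M"
    by (rule borel_measurable_norm_diff_simple[OF hm y(1)])
  have "(\<integral>\<^sup>+ w. norm (h w - y w) \<partial>M) \<le>
      (\<integral>\<^sup>+ w. ennreal (norm (h w - s i w)) + ennreal (norm (s i w - y w)) \<partial>M)"
  proof (rule nn_integral_mono)
    fix w
    have "norm (h w - y w) \<le> norm (h w - s i w) + norm (s i w - y w)"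
      by (metis dual_order.refl norm_diff_triangle_le)
    then show "ennreal (norm (h w - y w)) \<le> ennreal (norm (h w - s i w)) + ennreal (norm (s i w - y w))"
      by (simp flip: ennreal_plus)
  qed
  also have "\<dots> = (\<integral>\<^sup>+ w. norm (h w - s i w) \<partial>M) + (\<integral>\<^sup>+ w. norm (s i w - y w) \<partial>M)"
    using borel_measurable_norm_diff_simple[OF hm sf]
      borel_measurable_norm_diff_simple[OF borel_measurable_simple_function[OF sf] y(1)]
    by (intro nn_integral_add) auto
  also have "\<dots> < ennreal (c / 4) + ennreal (c / 4)" using i y(2) by (rule add_strict_mono)
  also have "\<dots> = ennreal (c / 2)" using c by (simp flip: ennreal_plus)
  finally have hy: "(\<integral>\<^sup>+ w. norm (h w - y w) \<partial>M) < ennreal (c / 2)" .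
  \<comment> \<open>the constant value of \<open>y\<close> on a part of stage \<open>N\<close> or \<open>Suc N\<close>\<close>
  define Y where "Y J = y (SOME w. w \<in> J)" for J
  have Y: "y w = Y J" if J: "J \<in> \<P> n" "n = N \<or> n = Suc N" "w \<in> J" for n J w
  proof -
    have "(SOME w. w \<in> J) \<in> J" using \<open>w \<in> J\<close> by (rule someI)
    moreover obtain I where "I \<in> \<P> N" "J \<subseteq> I" using J(1,2) refine[of J N] by blast
    ultimately show ?thesis unfolding Y_def using const[of I w] \<open>w \<in> J\<close> by blast
  qed
  \<comment> \<open>the \<open>L\<^sup>1\<close> distance between the step function of stage \<open>n\<close> and \<open>y\<close>\<close>
  define S where "S n = (\<Sum>J\<in>\<P> n. measure M J * norm (x n J - Y J))" for n
  have S: "S n < c / 2" if n: "n = N \<or> n = Suc N" for n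
  proof -
    have le: "ennreal (measure M J * norm (x n J - Y J)) \<le>
        (\<integral>\<^sup>+ w. ennreal (norm (h w - y w)) * indicator J w \<partial>M)" if J: "J \<in> \<P> n" for J
    proof -
      have JM: "J \<in> sets M" by (rule parts_measurable[OF J])
      have "ennreal (norm (limit_measure J - measure M J *\<^sub>R Y J)) \<le>
          (\<integral>\<^sup>+ w. norm (indicator J w *\<^sub>R g w - indicator J w *\<^sub>R Y J) \<partial>M)"
        using has_bochner_integral_nonsep_norm_diff_le[OF g[OF JM] simple_bochner_integral_indicator(1)[OF JM, of "Y J"]]
        by (simp only: simple_bochner_integral_indicator(2)[OF JM])
      also have "\<dots> = (\<integral>\<^sup>+ w. ennreal (norm (h w - y w)) * indicator J w \<partial>M)"
        using Y[OF J n] by (intro nn_integral_cong) (auto simp: h_def indicator_def)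
      also have "norm (limit_measure J - measure M J *\<^sub>R Y J) = measure M J * norm (x n J - Y J)"
        by (simp add: limit_measure_part[OF J] flip: scaleR_diff_right)
      finally show ?thesis .
    qed
    have "ennreal (S n) = (\<Sum>J\<in>\<P> n. ennreal (measure M J * norm (x n J - Y J)))"
      unfolding S_def by (rule sum_ennreal[symmetric]) simp
    also have "\<dots> \<le> (\<Sum>J\<in>\<P> n. \<integral>\<^sup>+ w. ennreal (norm (h w - y w)) * indicator J w \<partial>M)"
      by (rule sum_mono[OF le])
    also have "\<dots> = (\<integral>\<^sup>+ w. (\<Sum>J\<in>\<P> n. ennreal (norm (h w - y w)) * indicator J w) \<partial>M)"
      using hy_meas parts_measurable by (intro nn_integral_sum[symmetric]) auto
    also have "\<dots> = (\<integral>\<^sup>+ w. ennreal (norm (h w - y w)) \<partial>M)"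
    proof (rule nn_integral_cong)
      fix w assume "w \<in> space M"
      then obtain I where I: "I \<in> \<P> n" "w \<in> I" using parts_Union[of n] by blast
      have "(\<Sum>J\<in>\<P> n. ennreal (norm (h w - y w)) * indicator J w) =
          (\<Sum>J\<in>\<P> n. if J = I then ennreal (norm (h w - y w)) else 0)"
        using parts_disjnt[OF _ I(1)] I(2) by (intro sum.cong refl) (auto simp: indicator_def)
      then show "(\<Sum>J\<in>\<P> n. ennreal (norm (h w - y w)) * indicator J w) = ennreal (norm (h w - y w))"
        using I(1) finite_parts by simp
    qed
    also have "\<dots> < ennreal (c / 2)" by (rule hy)
    finally show ?thesis by (simp add: ennreal_less_iff S_def sum_nonneg)
  qed
  have "(\<Sum>I\<in>\<P> N. \<Sum>J | J \<in> \<P> (Suc N) \<and> J \<subseteq> I. measure M J * norm (x (Suc N) J - x N I)) \<le>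
      (\<Sum>I\<in>\<P> N. (\<Sum>J | J \<in> \<P> (Suc N) \<and> J \<subseteq> I. measure M J * norm (x (Suc N) J - Y J)) +
        measure M I * norm (x N I - Y I))"
  proof (rule sum_mono)
    fix I assume I: "I \<in> \<P> N"
    have "(\<Sum>J | J \<in> \<P> (Suc N) \<and> J \<subseteq> I. measure M J * norm (x (Suc N) J - x N I)) \<le>
       (\<Sum>J | J \<in> \<P> (Suc N) \<and> J \<subseteq> I. measure M J * norm (x (Suc N) J - Y J) +
          measure M J * norm (x N I - Y I))"
    proof (rule sum_mono)
      fix J assume J: "J \<in> {J. J \<in> \<P> (Suc N) \<and> J \<subseteq> I}"
      then obtain w where "w \<in> J" using parts_nonempty by blast
      then have "Y J = Y I" using Y[of J "Suc N" w] Y[of I N w] J I by auto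
      then have "norm (x (Suc N) J - x N I) \<le> norm (x (Suc N) J - Y J) + norm (x N I - Y I)"
        by (metis dual_order.refl norm_diff_triangle_le norm_minus_commute)
      then show "measure M J * norm (x (Suc N) J - x N I) \<le> measure M J * norm (x (Suc N) J - Y J) +
          measure M J * norm (x N I - Y I)"
        by (simp add: mult_left_mono flip: distrib_left)
    qed
    then show "(\<Sum>J | J \<in> \<P> (Suc N) \<and> J \<subseteq> I. measure M J * norm (x (Suc N) J - x N I)) \<le>
       (\<Sum>J | J \<in> \<P> (Suc N) \<and> J \<subseteq> I. measure M J * norm (x (Suc N) J - Y J)) +
        measure M I * norm (x N I - Y I)"
      by (simp add: sum.distrib sum_measure_children[OF I] flip: sum_distrib_right)
  qed
  also have "\<dots> = S (Suc N) + S N"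
    unfolding S_def sum_refine by (simp add: sum.distrib)
  also have "\<dots> < c" using S[of N] S[of "Suc N"] by simp
  finally show ?thesis by (rule that)
qed

end

theorem radon_nikodym_increments_small:
  fixes M :: "real measure" and x :: "nat \<Rightarrow> real set \<Rightarrow> 'a::banach"
  assumes RNP: "radon_nikodym_property TYPE('a)" and M: "tagged_refinements M P x K" and c: "c > 0"
  obtains n where
    "(\<Sum>I\<in>P n. \<Sum>J | J \<in> P (Suc n) \<and> J \<subseteq> I. measure M J * norm (x (Suc n) J - x n I)) < c"
proof -
  interpret tagged_refinements M P x K by fact
  have "finite_measure M" by unfold_locales
  moreover have "limit_measure E = 0" if "E \<in> null_sets M" for E
    using that norm_limit_measure_le[of E] by (auto simp: null_sets_def measure_def)
  ultimately have "\<exists>g. \<forall>E\<in>sets M.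
      has_bochner_integral_nonsep M (\<lambda>w. indicator E w *\<^sub>R g w) (limit_measure E)"
    using RNP[unfolded radon_nikodym_property_def, rule_format, of M limit_measure]
      vector_measure_limit_measure bounded_variation_limit_measure by simp
  then obtain g where g: "\<And>E. E \<in> sets M \<Longrightarrow>
      has_bochner_integral_nonsep M (\<lambda>w. indicator E w *\<^sub>R g w) (limit_measure E)" by blast
  show ?thesis by (rule increments_small[OF g c], assumption) (rule that)
qed

section \<open>Points that are far from convex combinations of distant points\<close>

definition half_open_interval :: "real set \<Rightarrow> bool" where
  "half_open_interval I \<longleftrightarrow> (\<exists>c d. c < d \<and> I = {c..<d})"

lemma half_open_intervalI: "c < d \<Longrightarrow> half_open_interval {c..<d}"
  unfolding half_open_interval_def by blast

lemma half_open_interval_nonempty: "half_open_interval I \<Longrightarrow> I \<noteq> {}"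
  unfolding half_open_interval_def by auto

lemma half_open_interval_borel: "half_open_interval I \<Longrightarrow> I \<in> sets borel"
  unfolding half_open_interval_def by auto

lemma split_half_open_interval:
  fixes u :: "'i \<Rightarrow> real"
  assumes "finite S" "\<And>i. i \<in> S \<Longrightarrow> u i > 0"
  shows "\<exists>J. (\<forall>i\<in>S. half_open_interval (J i) \<and> measure lborel (J i) = u i) \<and>
    disjoint_family_on J S \<and> (\<Union>i\<in>S. J i) = {a..<a + sum u S}"
  using assms
proof (induction S rule: finite_induct)
  case empty
  then show ?case by (auto simp: disjoint_family_on_def)
next
  case (insert k S)
  obtain J where J: "\<And>i. i \<in> S \<Longrightarrow> half_open_interval (J i) \<and> measure lborel (J i) = u i"
    "disjoint_family_on J S" "(\<Union>i\<in>S. J i) = {a..<a + sum u S}"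
    using insert.IH insert.prems by (metis insertCI)
  define L where "L = {a + sum u S..<a + sum u S + u k}"
  have uk: "u k > 0" using insert by simp
  have L: "half_open_interval L" "measure lborel L = u k"
    using uk unfolding L_def by (auto intro!: half_open_intervalI)
  have disj: "J i \<inter> L = {}" if "i \<in> S" for i
  proof -
    have "J i \<subseteq> {a..<a + sum u S}" using J(3) that by blast
    moreover have "{a..<a + sum u S} \<inter> L = {}" unfolding L_def by auto
    ultimately show ?thesis by blast
  qed
  show ?case
  proof (intro exI[of _ "J(k := L)"] conjI ballI)
    show "half_open_interval ((J(k := L)) i)" "measure lborel ((J(k := L)) i) = u i" if "i \<in> insert k S" for i
      using that J(1)[of i] L by auto
    have J_eq: "(J(k := L)) i = J i" if "i \<in> S" for i using that insert.hyps by auto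
    show "disjoint_family_on (J(k := L)) (insert k S)"
      using J(2) disj insert.hyps(2) unfolding disjoint_family_on_def by (auto simp: Int_commute)
    have "(\<Union>i\<in>S. (J(k := L)) i) = (\<Union>i\<in>S. J i)" by (rule SUP_cong) (auto simp only: J_eq)
    then have "(\<Union>i\<in>insert k S. (J(k := L)) i) = (\<Union>i\<in>S. J i) \<union> L"
      by (simp only: UN_insert fun_upd_same Un_commute)
    also have "\<dots> = {a..<a + sum u (insert k S)}"
      unfolding J(3) L_def using insert.hyps uk insert.prems sum_nonneg[of S u]
      by (subst ivl_disj_un_two(3)) (auto simp: algebra_simps less_imp_le)
    finally show "(\<Union>i\<in>insert k S. (J(k := L)) i) = {a..<a + sum u (insert k S)}" .
  qed
qed

text \<open>
  A convex combination is realized by cutting \<open>I\<close> into intervals whose lengths are proportional to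
  its coefficients. Points with coefficient 0 are dropped first, because they would give empty
  intervals, which cannot carry a tag.
\<close>

lemma split_tagged_interval:
  fixes x :: "'a::real_vector"
  assumes I: "half_open_interval I" and x: "x \<in> convex hull S"
  obtains C y where "finite C" "partition_on I C" "\<And>J. J \<in> C \<Longrightarrow> half_open_interval J \<and> y J \<in> S"
    "measure lborel I *\<^sub>R x = (\<Sum>J\<in>C. measure lborel J *\<^sub>R y J)"
proof -
  obtain c d where cd: "c < d" "I = {c..<d}" using I unfolding half_open_interval_def by blast
  obtain F u where F: "finite F" "F \<subseteq> S" "\<forall>v\<in>F. 0 \<le> u v" "sum u F = 1" "(\<Sum>v\<in>F. u v *\<^sub>R v) = x"
    using x unfolding convex_hull_explicit by blast
  define G where "G = {v \<in> F. u v > 0}"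
  have G: "finite G" "G \<subseteq> S" using F(1,2) by (auto simp: G_def)
  have u0: "\<forall>v\<in>F - G. u v = 0" using F(3) by (force simp: G_def)
  have sumG: "sum u G = 1" "(\<Sum>v\<in>G. u v *\<^sub>R v) = x"
  proof -
    have GF: "G \<subseteq> F" by (auto simp: G_def)
    show "sum u G = 1" using sum.mono_neutral_left[OF F(1) GF u0] F(4) by simp
    have u0v: "\<forall>v\<in>F - G. u v *\<^sub>R v = 0" using u0 by simp
    show "(\<Sum>v\<in>G. u v *\<^sub>R v) = x" using sum.mono_neutral_left[OF F(1) GF u0v] F(5) by (rule trans)
  qed
  obtain J where J: "\<And>v. v \<in> G \<Longrightarrow> half_open_interval (J v) \<and> measure lborel (J v) = (d - c) * u v"
    "disjoint_family_on J G" "(\<Union>v\<in>G. J v) = {c..<c + (\<Sum>v\<in>G. (d - c) * u v)}"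
  proof -
    have "(d - c) * u v > 0" if "v \<in> G" for v using that cd by (simp add: G_def)
    from split_half_open_interval[of G "\<lambda>v. (d - c) * u v" c, OF G(1) this] show ?thesis
      using that by auto
  qed
  have UJ: "(\<Union>v\<in>G. J v) = I"
    unfolding J(3) cd(2) by (simp add: sumG(1) flip: sum_distrib_left)
  have inj: "inj_on J G"
  proof (rule inj_onI, rule ccontr)
    fix v w assume "v \<in> G" "w \<in> G" "J v = J w" "v \<noteq> w"
    then have "J v \<inter> J w = {}" by (intro disjoint_family_onD[OF J(2)])
    then have "J v = {}" using \<open>J v = J w\<close> by simp
    then show False using half_open_interval_nonempty J(1)[OF \<open>v \<in> G\<close>] by metis
  qed
  define y where "y = the_inv_into G J"
  have y: "y (J v) = v" if "v \<in> G" for v unfolding y_def by (rule the_inv_into_f_f[OF inj that])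
  show ?thesis
  proof (rule that[of "J ` G" y])
    show "partition_on I (J ` G)"
    proof (rule partition_onI)
      show "disjnt p q" if "p \<in> J ` G" "q \<in> J ` G" "p \<noteq> q" for p q
      proof -
        obtain v w where "v \<in> G" "w \<in> G" "p = J v" "q = J w" using \<open>p \<in> J ` G\<close> \<open>q \<in> J ` G\<close> by blast
        then show ?thesis
          using disjoint_family_onD[OF J(2), of v w] \<open>p \<noteq> q\<close> unfolding disjnt_def by metis
      qed
      show "{} \<notin> J ` G"
      proof
        assume "{} \<in> J ` G"
        then obtain v where "v \<in> G" "J v = {}" by force
        then show False using J(1) half_open_interval_nonempty by metis
      qed
    qed (use UJ in simp)
    show "half_open_interval K \<and> y K \<in> S" if "K \<in> J ` G" for K
      using that J(1) y G(2) by auto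
    have "(\<Sum>K\<in>J ` G. measure lborel K *\<^sub>R y K) = (\<Sum>v\<in>G. ((d - c) * u v) *\<^sub>R v)"
      by (subst sum.reindex[OF inj]) (auto intro!: sum.cong simp: J(1) y)
    also have "\<dots> = (d - c) *\<^sub>R x"
      by (simp add: scaleR_sum_right flip: sumG(2))
    finally show "measure lborel I *\<^sub>R x = (\<Sum>K\<in>J ` G. measure lborel K *\<^sub>R y K)"
      using cd by simp
  qed (use G in auto)
qed

definition tagged_partition :: "'a set \<Rightarrow> real set set \<times> (real set \<Rightarrow> 'a) \<Rightarrow> bool" where
  "tagged_partition D p \<longleftrightarrow> finite (fst p) \<and> partition_on {0..<1} (fst p) \<and>
     (\<forall>I\<in>fst p. half_open_interval I \<and> snd p I \<in> D)"

text \<open>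
  One step of the martingale; tags that satisfy \<open>R\<close> move by at least \<open>\<epsilon>\<close>.
\<close>

definition tagged_refinement ::
  "('a::real_normed_vector \<Rightarrow> bool) \<Rightarrow> real \<Rightarrow> real set set \<times> (real set \<Rightarrow> 'a) \<Rightarrow>
     real set set \<times> (real set \<Rightarrow> 'a) \<Rightarrow> bool" where
  "tagged_refinement R \<epsilon> p q \<longleftrightarrow>
     (\<forall>J\<in>fst q. \<exists>I\<in>fst p. J \<subseteq> I) \<and>
     (\<forall>I\<in>fst p. measure lborel I *\<^sub>R snd p I =
        (\<Sum>J | J \<in> fst q \<and> J \<subseteq> I. measure lborel J *\<^sub>R snd q J)) \<and>
     (\<forall>I\<in>fst p. \<forall>J\<in>fst q. J \<subseteq> I \<longrightarrow> R (snd p I) \<longrightarrow> \<epsilon> \<le> norm (snd q J - snd p I))"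

text \<open>
  Tags that satisfy \<open>R\<close> are split into far away points of \<open>D\<close>; the other tags stay, which stops the
  martingale there.
\<close>

lemma tagged_refinement_exists:
  assumes p: "tagged_partition D p"
    and split: "\<And>x. x \<in> D \<Longrightarrow> R x \<Longrightarrow> x \<in> convex hull (D - ball x \<epsilon>)"
  shows "\<exists>q. tagged_partition D q \<and> tagged_refinement R \<epsilon> p q"
proof -
  obtain P x where P: "p = (P, x)" by (cases p)
  have fin: "finite P" and part: "partition_on {0..<1} P"
    and tags: "\<And>I. I \<in> P \<Longrightarrow> half_open_interval I \<and> x I \<in> D"
    using p unfolding tagged_partition_def P by auto
  define good where "good I C y \<longleftrightarrow> finite C \<and> partition_on I C \<and>
      (\<forall>J\<in>C. half_open_interval J \<and> y J \<in> D) \<and>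
      measure lborel I *\<^sub>R x I = (\<Sum>J\<in>C. measure lborel J *\<^sub>R y J) \<and>
      (R (x I) \<longrightarrow> (\<forall>J\<in>C. \<epsilon> \<le> norm (y J - x I)))" for I C y
  have "\<exists>C y. good I C y" if I: "I \<in> P" for I
  proof -
    let ?S = "if R (x I) then D - ball (x I) \<epsilon> else {x I}"
    have half: "half_open_interval I" using tags[OF I] by simp
    have hull: "x I \<in> convex hull ?S" using split[of "x I"] tags[OF I] by auto
    obtain C y where C: "finite C" "partition_on I C"
        "\<And>J. J \<in> C \<Longrightarrow> half_open_interval J \<and> y J \<in> ?S"
        "measure lborel I *\<^sub>R x I = (\<Sum>J\<in>C. measure lborel J *\<^sub>R y J)"
      by (rule split_tagged_interval[OF half hull]) (rule that)
    have "y J \<in> D" if "J \<in> C" for J using C(3)[OF that] tags[OF I] by (auto split: if_splits)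
    moreover have "\<epsilon> \<le> norm (y J - x I)" if "J \<in> C" "R (x I)" for J
      using C(3)[OF that(1)] that(2) by (auto simp: dist_norm norm_minus_commute)
    ultimately have "good I C y" using C unfolding good_def by simp
    then show ?thesis by blast
  qed
  then obtain C y where Cy: "\<And>I. I \<in> P \<Longrightarrow> good I (C I) (y I)" by metis
  have fC: "finite (C I)" and pC: "partition_on I (C I)"
    and yC: "J \<in> C I \<Longrightarrow> half_open_interval J \<and> y I J \<in> D"
    and avC: "measure lborel I *\<^sub>R x I = (\<Sum>J\<in>C I. measure lborel J *\<^sub>R y I J)"
    and sepC: "J \<in> C I \<Longrightarrow> R (x I) \<Longrightarrow> \<epsilon> \<le> norm (y I J - x I)" if "I \<in> P" for I J
    using Cy[OF that] unfolding good_def by simp_all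
  have CI: "J \<subseteq> I" "J \<noteq> {}" if "I \<in> P" "J \<in> C I" for I J
    using pC[OF that(1)] that(2) unfolding partition_on_def by blast+
  have uniq: "I = I'" if "I \<in> P" "I' \<in> P" "J \<noteq> {}" "J \<subseteq> I" "J \<subseteq> I'" for I I' J
  proof (rule ccontr)
    assume "I \<noteq> I'"
    then have "I \<inter> I' = {}"
      using partition_onD2[OF part] that(1,2) unfolding disjoint_def by blast
    then show False using that by blast
  qed
  define Q where "Q = (\<Union>I\<in>P. C I)"
  define z where "z J = y (THE I. I \<in> P \<and> J \<subseteq> I) J" for J
  have z: "z J = y I J" if "I \<in> P" "J \<in> C I" for I J
  proof -
    have "(THE I. I \<in> P \<and> J \<subseteq> I) = I"
    proof (rule the_equality)
      show "I \<in> P \<and> J \<subseteq> I" using that CI(1)[OF that] by simp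
      show "L = I" if L: "L \<in> P \<and> J \<subseteq> L" for L
        using L that CI[OF \<open>I \<in> P\<close> \<open>J \<in> C I\<close>] \<open>I \<in> P\<close> by (intro uniq[of L I J]) simp_all
    qed
    then show ?thesis by (simp add: z_def)
  qed
  have children: "{J. J \<in> Q \<and> J \<subseteq> I} = C I" if I: "I \<in> P" for I
  proof
    show "C I \<subseteq> {J. J \<in> Q \<and> J \<subseteq> I}" using I CI(1) by (auto simp: Q_def)
    show "{J. J \<in> Q \<and> J \<subseteq> I} \<subseteq> C I"
    proof
      fix J assume "J \<in> {J. J \<in> Q \<and> J \<subseteq> I}"
      then obtain I' where I': "I' \<in> P" "J \<in> C I'" "J \<subseteq> I" by (auto simp: Q_def)
      have "I' = I" by (rule uniq[OF I'(1) I CI(2)[OF I'(1,2)] CI(1)[OF I'(1,2)] I'(3)])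
      then show "J \<in> C I" using I'(2) by simp
    qed
  qed
  have "partition_on {0..<1} Q"
  proof (rule partition_onI)
    have "\<Union>Q = (\<Union>I\<in>P. \<Union>(C I))" by (auto simp: Q_def)
    also have "\<dots> = (\<Union>I\<in>P. I)" using pC unfolding partition_on_def by (intro SUP_cong) auto
    also have "\<dots> = {0..<1}" using partition_onD1[OF part] by simp
    finally show "\<Union>Q = {0..<1}" .
    show "{} \<notin> Q" using CI(2) by (auto simp: Q_def)
    show "disjnt J L" if JL: "J \<in> Q" "L \<in> Q" "J \<noteq> L" for J L
    proof -
      obtain I I' where I: "I \<in> P" "J \<in> C I" "I' \<in> P" "L \<in> C I'" using JL by (auto simp: Q_def)
      show ?thesis
      proof (cases "I = I'")
        case True
        then show ?thesis using pC[OF I(1)] I JL(3) unfolding partition_on_def disjoint_def disjnt_def by auto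
      next
        case False
        then have "I \<inter> I' = {}" using partition_onD2[OF part] I unfolding disjoint_def by blast
        then show ?thesis using CI(1)[OF I(1,2)] CI(1)[OF I(3,4)] unfolding disjnt_def by blast
      qed
    qed
  qed
  moreover have "finite Q" unfolding Q_def using fin fC by blast
  ultimately have "tagged_partition D (Q, z)"
    unfolding tagged_partition_def using yC z by (auto simp: Q_def)
  moreover have "tagged_refinement R \<epsilon> p (Q, z)"
    unfolding tagged_refinement_def P fst_conv snd_conv
  proof (intro conjI ballI impI)
    fix J assume "J \<in> Q"
    then show "\<exists>I\<in>P. J \<subseteq> I" using CI(1) by (auto simp: Q_def)
  next
    fix I assume I: "I \<in> P"
    show "measure lborel I *\<^sub>R x I = (\<Sum>J | J \<in> Q \<and> J \<subseteq> I. measure lborel J *\<^sub>R z J)"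
      unfolding children[OF I] avC[OF I] by (rule sum.cong) (auto simp: z[OF I])
  next
    fix I J assume "I \<in> P" "J \<in> Q" "J \<subseteq> I" "R (x I)"
    moreover from this have "J \<in> C I" using children[of I] by blast
    ultimately show "\<epsilon> \<le> norm (z J - x I)" using sepC z by metis
  qed
  ultimately show ?thesis by blast
qed

text \<open>
  The lengths of the intervals need not tend to 0, so the scalar measure is Lebesgue measure on the
  \<open>\<sigma>\<close>-algebra that the intervals generate, which can be smaller than the Borel \<open>\<sigma>\<close>-algebra.
\<close>

lemma tagged_partitions_give_tagged_refinements:
  fixes p :: "nat \<Rightarrow> real set set \<times> (real set \<Rightarrow> 'a::banach)"
  assumes part: "\<And>n. tagged_partition D (p n)" and ref: "\<And>n. tagged_refinement R \<epsilon> (p n) (p (Suc n))"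
    and D: "\<And>x. x \<in> D \<Longrightarrow> norm x \<le> K"
  obtains M where "tagged_refinements M (\<lambda>n. fst (p n)) (\<lambda>n. snd (p n)) K" "space M = {0..<1}"
    "\<And>E. E \<in> sets M \<Longrightarrow> measure M E = measure lborel E"
proof -
  define \<A> where "\<A> = {\<Union>S | n S. S \<subseteq> fst (p n)}"
  define M where "M = measure_of {0..<1} \<A> (emeasure lborel)"
  have P: "finite (fst (p n))" "partition_on {0..<1} (fst (p n))"
    "\<And>I. I \<in> fst (p n) \<Longrightarrow> half_open_interval I" "\<And>I. I \<in> fst (p n) \<Longrightarrow> snd (p n) I \<in> D" for n
    using part[of n] unfolding tagged_partition_def by auto
  have \<A>_Pow: "\<A> \<subseteq> Pow {0..<1}"
    using partition_onD1[OF P(2)] unfolding \<A>_def by blast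
  have space: "space M = {0..<1}" unfolding M_def by (rule space_measure_of[OF \<A>_Pow])
  have sets: "sets M = sigma_sets {0..<1} \<A>" unfolding M_def by (rule sets_measure_of[OF \<A>_Pow])
  have borel: "sets M \<subseteq> sets borel"
  proof -
    have "\<A> \<subseteq> sets borel"
    proof
      fix A assume "A \<in> \<A>"
      then obtain n S where S: "S \<subseteq> fst (p n)" "A = \<Union>S" unfolding \<A>_def by blast
      show "A \<in> sets borel"
        unfolding S(2)
      proof (rule sets.finite_Union)
        show "finite S" by (rule finite_subset[OF S(1) P(1)])
        show "S \<subseteq> sets borel" using S(1) P(3)[of _ n] half_open_interval_borel by blast
      qed
    qed
    then have "sigma_sets {0..<1} \<A> \<subseteq> sets (borel :: real measure)"
      by (intro sets.sigma_sets_subset') auto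
    then show ?thesis unfolding sets .
  qed
  have emeasure: "emeasure M E = emeasure lborel E" if "E \<in> sets M" for E
  proof (rule emeasure_measure_of[OF M_def \<A>_Pow _ _ that])
    show "positive (sets M) (emeasure lborel)" by (simp add: positive_def)
    show "countably_additive (sets M) (emeasure lborel)"
      unfolding countably_additive_def
    proof (intro allI impI suminf_emeasure)
      show "range A \<subseteq> sets lborel" if "range A \<subseteq> sets M" for A using that borel by auto
    qed
  qed
  then have meas: "measure M E = measure lborel E" if "E \<in> sets M" for E
    using that by (simp add: measure_def)
  interpret finite_measure M
    by (rule finite_measureI) (use emeasure[OF sets.top] in \<open>simp add: space\<close>)
  have PM: "fst (p n) \<subseteq> sets M" for n
  proof
    fix I assume "I \<in> fst (p n)"
    then have "I \<in> \<A>" unfolding \<A>_def by (auto intro!: exI[of _ n] exI[of _ "{I}"])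
    then show "I \<in> sets M" unfolding sets by (rule sigma_sets.Basic)
  qed
  have "tagged_refinements M (\<lambda>n. fst (p n)) (\<lambda>n. snd (p n)) K"
  proof
    show "finite (fst (p n))" "partition_on (space M) (fst (p n))" for n
      using P(1,2) unfolding space by auto
    show "fst (p n) \<subseteq> sets M" for n by (rule PM)
    show "sets M = sigma_sets (space M) {\<Union>S | n S. S \<subseteq> fst (p n)}"
      unfolding sets space \<A>_def ..
    show "\<exists>I\<in>fst (p n). J \<subseteq> I" if "J \<in> fst (p (Suc n))" for J n
      using ref[of n] that by (simp add: tagged_refinement_def)
    show "measure M I *\<^sub>R snd (p n) I =
        (\<Sum>J | J \<in> fst (p (Suc n)) \<and> J \<subseteq> I. measure M J *\<^sub>R snd (p (Suc n)) J)"
      if I: "I \<in> fst (p n)" for I n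
    proof -
      have "measure M I *\<^sub>R snd (p n) I = measure lborel I *\<^sub>R snd (p n) I"
        using meas PM I by auto
      also have "\<dots> = (\<Sum>J | J \<in> fst (p (Suc n)) \<and> J \<subseteq> I. measure lborel J *\<^sub>R snd (p (Suc n)) J)"
        using ref[of n] I by (simp add: tagged_refinement_def)
      also have "\<dots> = (\<Sum>J | J \<in> fst (p (Suc n)) \<and> J \<subseteq> I. measure M J *\<^sub>R snd (p (Suc n)) J)"
        using meas PM[of "Suc n"] by (intro sum.cong) auto
      finally show ?thesis .
    qed
    show "norm (snd (p n) I) \<le> K" if "I \<in> fst (p n)" for n I using P(4)[OF that] D by blast
  qed
  then show ?thesis using space meas by (rule that)
qed

text \<open>
  Otherwise the points above level \<open>a\<close> can be decomposed again and again. This gives a martingale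
  which starts at \<open>x0\<close> and is stopped as soon as \<open>\<phi> \<le> a\<close>. The mean of \<open>\<phi>\<close> stays equal to \<open>\<phi> x0 > a\<close> and
  \<open>\<phi>\<close> is at most \<open>b\<close>, so at each stage a mass of at least \<open>(\<phi> x0 - a) / (b - a)\<close> has not been stopped and
  moves by at least \<open>\<epsilon>\<close>. The increments then do not become small in \<open>L\<^sup>1\<close>.
\<close>

theorem RNP_undecomposable_point:
  fixes D :: "'a::banach set"
  assumes RNP: "radon_nikodym_property TYPE('a)"
    and D: "bounded D" and \<phi>: "linear \<phi>" "\<And>x. x \<in> D \<Longrightarrow> \<phi> x \<le> (b::real)"
    and x0: "x0 \<in> D" "\<phi> x0 > a" and \<epsilon>: "\<epsilon> > 0"
  shows "\<exists>x\<in>D. \<phi> x > a \<and> x \<notin> convex hull (D - ball x \<epsilon>)"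
proof (rule ccontr)
  assume "\<not> ?thesis"
  then have split: "x \<in> convex hull (D - ball x \<epsilon>)" if "x \<in> D" "a < \<phi> x" for x using that by blast
  obtain K where K: "\<And>x. x \<in> D \<Longrightarrow> norm x \<le> K" using D unfolding bounded_iff by blast
  define p0 :: "real set set \<times> (real set \<Rightarrow> 'a)" where "p0 = ({{0..<1}}, \<lambda>_. x0)"
  have "\<exists>p. \<forall>n. (tagged_partition D (p n) \<and> (n = 0 \<longrightarrow> p n = p0)) \<and>
      tagged_refinement (\<lambda>x. a < \<phi> x) \<epsilon> (p n) (p (Suc n))"
  proof (rule dependent_nat_choice)
    have "tagged_partition D p0"
      unfolding tagged_partition_def p0_def using x0(1)
      by (auto simp: partition_on_def intro!: half_open_intervalI)
    then show "\<exists>p. tagged_partition D p \<and> (0 = (0::nat) \<longrightarrow> p = p0)" by blast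
    show "\<exists>q. (tagged_partition D q \<and> (Suc n = 0 \<longrightarrow> q = p0)) \<and> tagged_refinement (\<lambda>x. a < \<phi> x) \<epsilon> p q"
      if "tagged_partition D p \<and> (n = 0 \<longrightarrow> p = p0)" for p n
      using tagged_refinement_exists[of D p "\<lambda>x. a < \<phi> x" \<epsilon>] that split by blast
  qed
  then obtain p where part: "\<And>n. tagged_partition D (p n)" and p0: "p 0 = p0"
    and ref: "\<And>n. tagged_refinement (\<lambda>x. a < \<phi> x) \<epsilon> (p n) (p (Suc n))" by blast
  obtain M where M: "tagged_refinements M (\<lambda>n. fst (p n)) (\<lambda>n. snd (p n)) K" "space M = {0..<1}"
    "\<And>E. E \<in> sets M \<Longrightarrow> measure M E = measure lborel E"
    by (rule tagged_partitions_give_tagged_refinements[where p = p, OF part ref K]) (assumption, rule that)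
  interpret tagged_refinements M "\<lambda>n. fst (p n)" "\<lambda>n. snd (p n)" K by (rule M(1))
  have one: "measure M (space M) = 1" using M(3)[OF sets.top] by (simp add: M(2))
  have ab: "a < b" using x0 \<phi>(2) by fastforce
  define c where "c = \<epsilon> * ((\<phi> x0 - a) / (b - a))"
  have c: "c > 0" unfolding c_def using x0(2) ab \<epsilon> by simp
  have "c \<le> (\<Sum>I\<in>fst (p n). \<Sum>J | J \<in> fst (p (Suc n)) \<and> J \<subseteq> I.
      measure M J * norm (snd (p (Suc n)) J - snd (p n) I))" (is "_ \<le> ?inc") for n
  proof -
    let ?P = "fst (p n)" and ?x = "snd (p n)"
    \<comment> \<open>the parts that have not been stopped at stage \<open>n\<close>\<close>
    define A where "A = {I \<in> ?P. a < \<phi> (?x I)}"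
    have A: "finite A" "A \<subseteq> ?P" using finite_parts by (auto simp: A_def)
    have space_level: "space M \<in> level m" for m
      unfolding level_def using parts_Union[of m] by blast
    have int: "space M \<inter> J = J" if "J \<in> fst (p m)" for J m
      using parts_measurable[OF that] sets.sets_into_space by blast
    have "stage n (space M) = stage 0 (space M)" by (rule stage_level[OF space_level]) simp
    also have "stage 0 (space M) = x0" using one M(2) by (simp add: stage_def p0 p0_def)
    also have "stage n (space M) = (\<Sum>I\<in>?P. measure M I *\<^sub>R ?x I)"
      unfolding stage_def using int by (intro sum.cong) auto
    finally have "\<phi> x0 = (\<Sum>I\<in>?P. measure M I * \<phi> (?x I))"
      by (auto simp: linear_sum[OF \<phi>(1)] linear_scale[OF \<phi>(1)])
    also have "\<dots> \<le> (\<Sum>I\<in>?P. measure M I * a + (b - a) * (if I \<in> A then measure M I else 0))"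
    proof (rule sum_mono)
      fix I assume I: "I \<in> ?P"
      have "?x I \<in> D" using part[of n] I unfolding tagged_partition_def by blast
      then have "\<phi> (?x I) \<le> b" by (rule \<phi>(2))
      then have "measure M I * \<phi> (?x I) \<le> measure M I * (if I \<in> A then b else a)"
        using I by (intro mult_left_mono) (auto simp: A_def)
      then show "measure M I * \<phi> (?x I) \<le> measure M I * a + (b - a) * (if I \<in> A then measure M I else 0)"
        by (simp add: algebra_simps split: if_splits)
    qed
    also have "\<dots> = (\<Sum>I\<in>?P. measure M I) * a + (b - a) * (\<Sum>I\<in>A. measure M I)"
      using finite_parts A(2)
      by (simp add: sum.distrib sum_distrib_right[symmetric] sum_distrib_left[symmetric] sum.If_cases Int_absorb1)
    also have "(\<Sum>I\<in>?P. measure M I) = 1"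
      using sum_measure_parts[OF sets.top, of n] int[of _ n] one by simp
    finally have mass: "(\<phi> x0 - a) / (b - a) \<le> (\<Sum>I\<in>A. measure M I)"
      using ab by (simp add: pos_divide_le_eq algebra_simps)
    have "c \<le> \<epsilon> * (\<Sum>I\<in>A. measure M I)"
      unfolding c_def using mass \<epsilon> by (intro mult_left_mono) auto
    also have "\<dots> = (\<Sum>I\<in>A. \<Sum>J | J \<in> fst (p (Suc n)) \<and> J \<subseteq> I. measure M J * \<epsilon>)"
      unfolding sum_distrib_left
    proof (rule sum.cong[OF refl])
      fix I assume "I \<in> A"
      then have "I \<in> ?P" using A(2) by blast
      show "\<epsilon> * measure M I = (\<Sum>J | J \<in> fst (p (Suc n)) \<and> J \<subseteq> I. measure M J * \<epsilon>)"
        unfolding sum_measure_children[OF \<open>I \<in> ?P\<close>, symmetric] sum_distrib_left by (simp add: mult.commute)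
    qed
    also have "\<dots> \<le> (\<Sum>I\<in>A. \<Sum>J | J \<in> fst (p (Suc n)) \<and> J \<subseteq> I.
      measure M J * norm (snd (p (Suc n)) J - snd (p n) I))"
    proof (intro sum_mono mult_left_mono)
      fix I J assume "I \<in> A" "J \<in> {J. J \<in> fst (p (Suc n)) \<and> J \<subseteq> I}"
      then show "\<epsilon> \<le> norm (snd (p (Suc n)) J - snd (p n) I)"
        using ref[of n] unfolding tagged_refinement_def A_def by blast
    qed simp
    also have "\<dots> \<le> ?inc"
      using A finite_parts by (intro sum_mono2 sum_nonneg) auto
    finally show ?thesis .
  qed
  moreover obtain n where "(\<Sum>I\<in>fst (p n). \<Sum>J | J \<in> fst (p (Suc n)) \<and> J \<subseteq> I.
      measure M J * norm (snd (p (Suc n)) J - snd (p n) I)) < c"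
    by (rule radon_nikodym_increments_small[OF RNP M(1) c])
  ultimately show False by (meson not_le)
qed

text \<open>
  The passage from convex hulls to closed convex hulls: if \<open>x\<close> is only a limit of convex combinations
  of points of \<open>D - ball x \<epsilon>\<close>, then in a neighbourhood \<open>E\<close> of \<open>D\<close> the error can be absorbed by a translation,
  and points of \<open>E\<close> become exact convex combinations of far away points of \<open>E\<close>. The level is raised
  from \<open>a\<close> to the midpoint of \<open>a\<close> and \<open>\<phi> x0\<close>, so that points of \<open>E\<close> above it are near points of \<open>D\<close>
  above \<open>a\<close>.
\<close>

theorem RNP_denting_point:
  fixes D :: "'a::banach set"
  assumes RNP: "radon_nikodym_property TYPE('a)"
    and D: "bounded D" and \<phi>: "linear \<phi>" "\<And>x. \<bar>\<phi> x\<bar> \<le> C * norm x"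
    and x0: "x0 \<in> D" "\<phi> x0 > (a::real)" and \<epsilon>: "\<epsilon> > 0"
  shows "\<exists>x\<in>D. \<phi> x > a \<and> x \<notin> closure (convex hull (D - ball x \<epsilon>))"
proof (rule ccontr)
  assume "\<not> ?thesis"
  then have split: "x \<in> closure (convex hull (D - ball x \<epsilon>))" if "x \<in> D" "a < \<phi> x" for x
    using that by blast
  define d where "d = \<bar>C\<bar> + 1"
  have d: "d > 0" by (simp add: d_def)
  have \<phi>d: "\<bar>\<phi> x\<bar> \<le> d * norm x" for x
  proof -
    have "C * norm x \<le> d * norm x" unfolding d_def by (intro mult_right_mono) auto
    with \<phi>(2)[of x] show ?thesis by (rule order_trans)
  qed
  define \<delta> where "\<delta> = (\<phi> x0 - a) / (2 * d)"
  have \<delta>: "\<delta> > 0" "d * \<delta> = (\<phi> x0 - a) / 2" using x0(2) d by (auto simp: \<delta>_def)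
  define E where "E = (\<Union>x\<in>D. ball x \<delta>)"
  obtain B where B: "\<And>x. x \<in> D \<Longrightarrow> norm x \<le> B" using D unfolding bounded_iff by blast
  have EB: "norm y \<le> B + \<delta>" if y: "y \<in> E" for y
  proof -
    obtain x where "x \<in> D" "dist x y < \<delta>" using y by (auto simp: E_def)
    then show ?thesis using B[of x] norm_triangle_sub[of y x] by (simp add: dist_norm norm_minus_commute)
  qed
  have "\<exists>y\<in>E. \<phi> y > (\<phi> x0 + a) / 2 \<and> y \<notin> convex hull (E - ball y (\<epsilon> / 2))"
  proof (rule RNP_undecomposable_point[OF RNP _ \<phi>(1)])
    show "bounded E" using EB unfolding bounded_iff by blast
    show "\<phi> y \<le> d * (B + \<delta>)" if "y \<in> E" for y
    proof -
      have "\<phi> y \<le> d * norm y" using \<phi>d[of y] by simp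
      also have "\<dots> \<le> d * (B + \<delta>)" using EB[OF that] d by (intro mult_left_mono) auto
      finally show ?thesis .
    qed
    show "x0 \<in> E" using x0(1) \<delta>(1) by (auto simp: E_def intro!: bexI[of _ x0])
  qed (use x0 \<epsilon> in auto)
  then obtain y where y: "y \<in> E" "\<phi> y > (\<phi> x0 + a) / 2" "y \<notin> convex hull (E - ball y (\<epsilon> / 2))" by blast
  obtain x where x: "x \<in> D" "dist x y < \<delta>" using y(1) by (auto simp: E_def)
  have "\<phi> y - \<phi> x \<le> d * norm (y - x)" using \<phi>d[of "y - x"] by (simp add: linear_diff[OF \<phi>(1)])
  also have "\<dots> < d * \<delta>" using x(2) d by (simp add: dist_norm norm_minus_commute)
  finally have "\<phi> x > a" using y(2) \<delta>(2) by (simp add: field_simps)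
  then have "x \<in> closure (convex hull (D - ball x \<epsilon>))" using split x(1) by blast
  moreover have "min (\<delta> - dist x y) (\<epsilon> / 2) > 0" using x(2) \<epsilon> by simp
  ultimately obtain x' where x': "x' \<in> convex hull (D - ball x \<epsilon>)" "dist x' x < min (\<delta> - dist x y) (\<epsilon> / 2)"
    unfolding closure_approachable by blast
  define u where "u = y - x'"
  have u: "norm u < \<delta>"
    using x'(2) dist_triangle[of x' y x] by (simp add: u_def dist_norm norm_minus_commute)
  have "(+) u ` (D - ball x \<epsilon>) \<subseteq> E - ball y (\<epsilon> / 2)"
  proof
    fix w assume "w \<in> (+) u ` (D - ball x \<epsilon>)"
    then obtain e where e: "e \<in> D" "dist x e \<ge> \<epsilon>" "w = u + e" by auto
    have "w \<in> E" using e u by (auto simp: E_def dist_norm intro!: bexI[of _ e])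
    moreover have "dist y w \<ge> \<epsilon> / 2"
    proof -
      have "y - w = x' - e" by (simp add: u_def e(3))
      then have "dist y w = dist x' e" by (simp add: dist_norm)
      then show ?thesis using dist_triangle[of x e x'] e(2) x'(2) by (simp add: dist_commute)
    qed
    ultimately show "w \<in> E - ball y (\<epsilon> / 2)" by simp
  qed
  then have "convex hull ((+) u ` (D - ball x \<epsilon>)) \<subseteq> convex hull (E - ball y (\<epsilon> / 2))"
    by (rule hull_mono)
  moreover have "y \<in> (+) u ` (convex hull (D - ball x \<epsilon>))"
    using x'(1) by (intro image_eqI[of _ _ x']) (auto simp: u_def)
  ultimately show False using y(3) by (auto simp: convex_hull_translation)
qed

section \<open>Exposed points of unit balls\<close>

text \<open>
  A functional \<open>f\<close> on \<open>Y\<close> can be moved slightly so that it cuts a small slice off the unit ball of \<open>Y\<close>.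
  Let \<open>D\<close> be the union of this ball and a large disc \<open>V\<close> in the kernel of \<open>f\<close>. Some point \<open>x\<close> of \<open>D\<close> above level
  \<open>a\<close> can be separated from \<open>D - ball x e\<close> by a functional \<open>g\<close>. The separation from the rest of the ball
  makes the slice small, and the separation from \<open>V\<close> makes \<open>g\<close> small on the kernel of \<open>f\<close>, hence close to a
  multiple of \<open>f\<close>.
\<close>

lemma slice_perturbation:
  fixes Y :: "'a::banach set" and f :: "'a \<Rightarrow> real"
  assumes RNP: "radon_nikodym_property TYPE('a)" and Y: "subspace Y"
    and f: "linear f" "\<And>x. \<bar>f x\<bar> \<le> C * norm x" and K: "\<And>y. y \<in> Y \<Longrightarrow> \<bar>f y\<bar> \<le> K * norm y"
    and y0: "y0 \<in> Y" "norm y0 \<le> 1" "f y0 > a" and a: "a > 0" and \<epsilon>: "\<epsilon> > 0" and \<eta>: "\<eta> > 0"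
  shows "\<exists>g x s. linear g \<and> (\<exists>B. \<forall>z. \<bar>g z\<bar> \<le> B * norm z) \<and>
    (\<forall>y\<in>Y. \<bar>g y - f y\<bar> \<le> \<eta> * norm y) \<and> x \<in> Y \<and> norm x \<le> 1 \<and> s < g x \<and>
    (\<forall>y\<in>Y. norm y \<le> 1 \<longrightarrow> s < g y \<longrightarrow> norm (y - x) < \<epsilon>)"
proof -
  have K0: "K > 0"
  proof (rule ccontr)
    assume "\<not> K > 0"
    then have "K * norm y0 \<le> 0" by (simp add: mult_nonpos_nonneg)
    then show False using K[OF y0(1)] y0(3) a by linarith
  qed
  \<comment> \<open>with this radius the ball around a point above level \<open>a\<close> misses the kernel of \<open>f\<close> in \<open>Y\<close>\<close>
  define e where "e = min \<epsilon> (a / K)"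
  have e: "e > 0" "e \<le> \<epsilon>" "K * e \<le> a"
    using \<epsilon> a K0 by (auto simp: e_def min_def field_simps)
  define r where "r = K * (1 + K / a) / \<eta>"
  have r: "r > 0" unfolding r_def using K0 a \<eta> by (intro divide_pos_pos mult_pos_pos add_pos_pos) auto
  define V where "V = {v \<in> Y. f v = 0 \<and> norm v \<le> r}"
  define D where "D = {y \<in> Y. norm y \<le> 1} \<union> V"
  have "bounded D"
    unfolding bounded_iff D_def V_def by (intro exI[of _ "max 1 r"]) auto
  moreover have "y0 \<in> D" using y0 by (simp add: D_def)
  ultimately obtain x where x: "x \<in> D" "f x > a" "x \<notin> closure (convex hull (D - ball x e))"
    using RNP_denting_point[OF RNP _ f(1) f(2), of D y0 a e] y0(3) e(1) by blast
  have xY: "x \<in> Y" "norm x \<le> 1" using x(1,2) a by (auto simp: D_def V_def)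
  have V: "V \<subseteq> D - ball x e"
  proof
    fix v assume v: "v \<in> V"
    have "x - v \<in> Y" using xY v Y by (auto simp: V_def intro: subspace_diff)
    then have "f (x - v) \<le> K * norm (x - v)" using K[of "x - v"] by simp
    then have "K * e < K * norm (x - v)" using x(2) e(3) v by (simp add: V_def linear_diff[OF f(1)])
    then have "e < norm (x - v)" using K0 by simp
    then show "v \<in> D - ball x e" using v by (simp add: D_def dist_norm)
  qed
  have zero: "0 \<in> V" using subspace_0[OF Y] r by (simp add: V_def linear_0[OF f(1)])
  then have ne: "convex hull (D - ball x e) \<noteq> {}" using V by auto
  obtain h s where h: "linear h" "\<And>y. \<bar>h y\<bar> \<le> norm y"
      "\<And>y. y \<in> convex hull (D - ball x e) \<Longrightarrow> h y \<le> s" "s < h x"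
    by (rule Hahn_Banach_separation[OF convex_convex_hull ne x(3)]) (rule that)
  have hs: "h y \<le> s" if "y \<in> D - ball x e" for y using h(3) that hull_inc by metis
  have "0 \<le> s" using hs[of 0] zero V linear_0[OF h(1)] by auto
  then have hx: "h x > 0" using h(4) by simp
  \<comment> \<open>the scaling that makes \<open>g\<close> agree with \<open>f\<close> at \<open>x\<close>\<close>
  define c where "c = f x / h x"
  have c: "c > 0" unfolding c_def using hx x(2) a by simp
  define g where "g y = c * h y" for y
  have g: "linear g" unfolding g_def using linear_compose_scale_right[OF h(1), of c] by simp
  have gx: "g x = f x" unfolding g_def c_def using hx by simp
  have fx: "f x \<le> K"
  proof -
    have "f x \<le> K * norm x" using K[OF xY(1)] by simp
    also have "\<dots> \<le> K * 1" using K0 xY(2) by (intro mult_left_mono) auto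
    finally show ?thesis by simp
  qed
  \<comment> \<open>on the kernel of \<open>f\<close> in \<open>Y\<close> the functional \<open>g\<close> is at most \<open>f x\<close> on a ball of radius \<open>r\<close>\<close>
  have small: "\<bar>g z\<bar> \<le> K / r * norm z" if z: "z \<in> Y" "f z = 0" for z
  proof (cases "z = 0")
    case True
    then show ?thesis by (simp add: linear_0[OF g])
  next
    case False
    have "t * g z \<le> K" if t: "\<bar>t\<bar> = r / norm z" for t
    proof -
      have "t *\<^sub>R z \<in> V"
        using z Y False r t by (simp add: V_def subspace_scale linear_scale[OF f(1)])
      then have "h (t *\<^sub>R z) \<le> s" using V hs by blast
      then have "h (t *\<^sub>R z) \<le> h x" using h(4) by simp
      then have "g (t *\<^sub>R z) \<le> g x" unfolding g_def using c by simp
      then show ?thesis using gx fx by (simp add: linear_scale[OF g])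
    qed
    from this[of "r / norm z"] this[of "- (r / norm z)"]
    have "r / norm z * g z \<le> K" "- (r / norm z * g z) \<le> K" using r by simp_all
    then have "r / norm z * \<bar>g z\<bar> \<le> K" by (cases "g z \<ge> 0") simp_all
    then show ?thesis using r False by (simp add: field_simps)
  qed
  have close: "\<bar>g y - f y\<bar> \<le> \<eta> * norm y" if y: "y \<in> Y" for y
  proof -
    \<comment> \<open>the component of \<open>y\<close> in the kernel of \<open>f\<close>; there \<open>g y - f y\<close> equals \<open>g z\<close>\<close>
    define z where "z = y - (f y / f x) *\<^sub>R x"
    have fx0: "f x > 0" using x(2) a by simp
    have z: "z \<in> Y" "f z = 0"
      unfolding z_def using y xY Y fx0
      by (auto intro: subspace_diff subspace_scale simp: linear_diff[OF f(1)] linear_scale[OF f(1)])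
    have "norm z \<le> norm y + \<bar>f y\<bar> / f x * norm x"
      unfolding z_def using norm_triangle_ineq4[of y "(f y / f x) *\<^sub>R x"] fx0 by simp
    also have "\<bar>f y\<bar> / f x * norm x \<le> K * norm y / a * 1"
      using K[OF y] x(2) a xY(2) by (intro mult_mono frac_le) auto
    finally have nz: "norm z \<le> (1 + K / a) * norm y" by (simp add: algebra_simps)
    have "g y - f y = g z"
      unfolding z_def using fx0 by (simp add: linear_diff[OF g] linear_scale[OF g] gx)
    then have "\<bar>g y - f y\<bar> \<le> K / r * norm z" using small[OF z] by simp
    also have "\<dots> \<le> K / r * ((1 + K / a) * norm y)"
      using nz K0 r by (intro mult_left_mono) auto
    also have "\<dots> = \<eta> * norm y"
    proof -
      have "K * (1 + K / a) = r * \<eta>" unfolding r_def using \<eta> by simp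
      then have "K / r * (1 + K / a) = \<eta>" using r by (simp add: field_simps)
      then show ?thesis by (metis mult.assoc)
    qed
    finally show ?thesis .
  qed
  have "norm (y - x) < \<epsilon>" if "y \<in> Y" "norm y \<le> 1" "c * s < g y" for y
  proof -
    have "h y > s" using that(3) c by (simp add: g_def)
    then have "y \<notin> D - ball x e" using hs[of y] by force
    then show ?thesis using that e(2) by (simp add: D_def dist_norm norm_minus_commute)
  qed
  moreover have "\<bar>g z\<bar> \<le> c * norm z" for z
    unfolding g_def using h(2)[of z] c by (simp add: abs_mult)
  moreover have "c * s < g x" using h(4) c by (simp add: g_def)
  ultimately show ?thesis using g close xY by blast
qed

text \<open>
  Starting from a norming functional, successive perturbations give functionals \<open>F n\<close> with slices of
  the unit ball of \<open>Y\<close> of diameter tending to 0. Each perturbation is small compared with the depth of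
  the previous slices, so the limit functional still cuts a non-empty slice inside each of them. Its
  maximizing sequences are then Cauchy, with the same limit: the maximum is attained at a single
  point. The limit is defined on \<open>Y\<close> only and is extended by the Hahn--Banach theorem.
\<close>

theorem RNP_exposed_point_of_ball:
  fixes Y :: "'a::banach set"
  assumes RNP: "radon_nikodym_property TYPE('a)" and Y: "subspace Y" "closed Y" "Y \<noteq> {0}"
  obtains x :: 'a and g :: "'a \<Rightarrow> real" and C where "x \<in> Y" "norm x = 1" "linear g" "\<And>z. \<bar>g z\<bar> \<le> C * norm z"
    "\<And>y. y \<in> Y \<Longrightarrow> norm y \<le> 1 \<Longrightarrow> y \<noteq> x \<Longrightarrow> g y < g x"
proof -
  obtain y where y: "y \<in> Y" "y \<noteq> 0" using Y subspace_0[OF Y(1)] by blast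
  define y0 where "y0 = (1 / norm y) *\<^sub>R y"
  have y0: "y0 \<in> Y" "norm y0 = 1" using y Y(1) by (auto simp: y0_def subspace_scale)
  obtain f0 :: "'a \<Rightarrow> real" where f0: "linear f0" "\<And>z. \<bar>f0 z\<bar> \<le> norm z" "f0 y0 = norm y0"
    by (rule Hahn_Banach_norming[of y0]) (rule that)
  \<comment> \<open>a state consists of a functional, a point of its slice, the level of the slice, and a margin
    \<open>\<theta>\<close>: moving the functional by at most \<open>\<theta>\<close> keeps the point in a slice within the old one\<close>
  define good :: "nat \<Rightarrow> ('a \<Rightarrow> real) \<times> 'a \<times> real \<times> real \<Rightarrow> bool" where
    "good n = (\<lambda>(f, x, s, \<theta>). linear f \<and> (\<exists>B. \<forall>z. \<bar>f z\<bar> \<le> B * norm z) \<and> \<theta> > 0 \<and>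
      (\<forall>y\<in>Y. \<bar>f y - f0 y\<bar> \<le> (1 / 4 - \<theta>) * norm y) \<and> x \<in> Y \<and> norm x \<le> 1 \<and> s + 4 * \<theta> \<le> f x \<and>
      (\<forall>y\<in>Y. norm y \<le> 1 \<longrightarrow> s < f y \<longrightarrow> norm (y - x) \<le> 2 / (real n + 1)))" for n
  define near :: "nat \<Rightarrow> ('a \<Rightarrow> real) \<times> 'a \<times> real \<times> real \<Rightarrow> ('a \<Rightarrow> real) \<times> 'a \<times> real \<times> real \<Rightarrow> bool" where
    "near n = (\<lambda>(f, x, s, \<theta>) (f', x', s', \<theta>'). \<theta>' \<le> \<theta> / 2 \<and>
      (\<forall>y\<in>Y. \<bar>f' y - f y\<bar> \<le> \<theta> / 2 * norm y))" for n
  have "\<exists>p. \<forall>n. good n (p n) \<and> near n (p n) (p (Suc n))"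
  proof (rule dependent_nat_choice)
    have "norm (z - y0) \<le> 2" if "norm z \<le> 1" for z
      using norm_triangle_ineq4[of z y0] that y0 by simp
    then have "good 0 (f0, y0, 0, 1 / 4)"
      unfolding good_def using f0 y0 by (auto intro!: exI[of _ 1])
    then show "\<exists>q. good 0 q" ..
  next
    fix p n assume p: "good n p"
    obtain f x s \<theta> where p_eq: "p = (f, x, s, \<theta>)" by (cases p)
    obtain B where f: "linear f" "\<And>z. \<bar>f z\<bar> \<le> B * norm z" "\<theta> > 0"
      "\<And>y. y \<in> Y \<Longrightarrow> \<bar>f y - f0 y\<bar> \<le> (1 / 4 - \<theta>) * norm y"
      using p unfolding p_eq good_def by auto
    have f_f0: "\<bar>f y - f0 y\<bar> \<le> 1 / 4 * norm y" if "y \<in> Y" for y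
      using f(4)[OF that] mult_right_mono[of "1 / 4 - \<theta>" "1 / 4" "norm y"] f(3) by simp
    have "\<bar>f y\<bar> \<le> 5 / 4 * norm y" if "y \<in> Y" for y
      using f_f0[OF that] f0(2)[of y] by linarith
    moreover have "\<bar>f y0 - 1\<bar> \<le> 1 / 4" using f_f0[OF y0(1)] f0(3) y0(2) by simp
    then have "f y0 > 1 / 2" by linarith
    ultimately have "\<exists>g x s. linear g \<and> (\<exists>B. \<forall>z. \<bar>g z\<bar> \<le> B * norm z) \<and>
        (\<forall>y\<in>Y. \<bar>g y - f y\<bar> \<le> \<theta> / 2 * norm y) \<and> x \<in> Y \<and> norm x \<le> 1 \<and> s < g x \<and>
        (\<forall>y\<in>Y. norm y \<le> 1 \<longrightarrow> s < g y \<longrightarrow> norm (y - x) < 2 / (real (Suc n) + 1))"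
      using f(3) y0 by (intro slice_perturbation[OF RNP Y(1) f(1,2), of "5 / 4" y0 "1 / 2"]) auto
    then obtain g x' s' where g: "linear g" "\<exists>B. \<forall>z. \<bar>g z\<bar> \<le> B * norm z"
        "\<And>y. y \<in> Y \<Longrightarrow> \<bar>g y - f y\<bar> \<le> \<theta> / 2 * norm y" "x' \<in> Y" "norm x' \<le> 1" "s' < g x'"
        "\<And>y. y \<in> Y \<Longrightarrow> norm y \<le> 1 \<Longrightarrow> s' < g y \<Longrightarrow> norm (y - x') < 2 / (real (Suc n) + 1)"
      by blast
    define \<theta>' where "\<theta>' = min (\<theta> / 2) ((g x' - s') / 4)"
    have \<theta>': "\<theta>' > 0" "\<theta>' \<le> \<theta> / 2" "s' + 4 * \<theta>' \<le> g x'" using f(3) g(6) by (auto simp: \<theta>'_def min_def field_simps)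
    have "\<bar>g y - f0 y\<bar> \<le> (1 / 4 - \<theta>') * norm y" if "y \<in> Y" for y
    proof -
      have "\<bar>g y - f0 y\<bar> \<le> \<theta> / 2 * norm y + (1 / 4 - \<theta>) * norm y"
        using g(3)[OF that] f(4)[OF that] by linarith
      also have "\<dots> = (1 / 4 - \<theta> / 2) * norm y" by (simp add: algebra_simps)
      also have "\<dots> \<le> (1 / 4 - \<theta>') * norm y" using \<theta>'(2) by (intro mult_right_mono) auto
      finally show ?thesis .
    qed
    then have "good (Suc n) (g, x', s', \<theta>')"
      unfolding good_def using g \<theta>' by (auto intro: less_imp_le)
    moreover have "near n p (g, x', s', \<theta>')"
      unfolding near_def p_eq using \<theta>'(2) g(3) by simp
    ultimately show "\<exists>q. good (Suc n) q \<and> near n p q" by blast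
  qed
  then obtain p where p: "\<And>n. good n (p n)" "\<And>n. near n (p n) (p (Suc n))" by blast
  define F X S T where "F n = fst (p n)" and "X n = fst (snd (p n))"
    and "S n = fst (snd (snd (p n)))" and "T n = snd (snd (snd (p n)))" for n
  have p_eq: "p n = (F n, X n, S n, T n)" for n by (simp add: F_def X_def S_def T_def)
  have F: "linear (F n)" and T0: "T n > 0"
    and F_f0: "\<And>y. y \<in> Y \<Longrightarrow> \<bar>F n y - f0 y\<bar> \<le> (1 / 4 - T n) * norm y"
    and X: "X n \<in> Y" "norm (X n) \<le> 1" and SF: "S n + 4 * T n \<le> F n (X n)"
    and slice: "\<And>y. y \<in> Y \<Longrightarrow> norm y \<le> 1 \<Longrightarrow> S n < F n y \<Longrightarrow> norm (y - X n) \<le> 2 / (real n + 1)" for n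
    using p(1)[of n] unfolding p_eq good_def by auto
  have T_half: "T (Suc n) \<le> T n / 2"
    and F_Suc: "\<And>y. y \<in> Y \<Longrightarrow> \<bar>F (Suc n) y - F n y\<bar> \<le> T n / 2 * norm y" for n
    using p(2)[of n] unfolding p_eq near_def by auto
  have T_le: "T n \<le> T 0 * (1 / 2) ^ n" for n
  proof (induction n)
    case (Suc n)
    then show ?case using T_half[of n] by simp
  qed simp
  have T_lim: "T \<longlonglongrightarrow> 0"
  proof (rule tendsto_sandwich[of "\<lambda>_. 0" T sequentially "\<lambda>n. T 0 * (1 / 2) ^ n"])
    show "(\<lambda>n. T 0 * (1 / 2) ^ n) \<longlonglongrightarrow> 0"
      by (intro tendsto_mult_right_zero LIMSEQ_power_zero) simp
  qed (use T0 T_le less_imp_le in \<open>auto intro!: always_eventually\<close>)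
  have F_diff: "\<bar>F (n + k) y - F n y\<bar> \<le> (T n - T (n + k)) * norm y" if y: "y \<in> Y" for n k y
  proof (induction k)
    case (Suc k)
    have "\<bar>F (n + Suc k) y - F n y\<bar> \<le> T (n + k) / 2 * norm y + (T n - T (n + k)) * norm y"
      using F_Suc[OF y, of "n + k"] Suc unfolding add_Suc_right by linarith
    also have "\<dots> = (T n - T (n + k) / 2) * norm y" by (simp add: algebra_simps)
    also have "\<dots> \<le> (T n - T (n + Suc k)) * norm y"
      using T_half[of "n + k"] by (intro mult_right_mono) auto
    finally show ?case .
  qed simp
  have F_diff': "\<bar>F (n + k) y - F n y\<bar> \<le> T n * norm y" if y: "y \<in> Y" for n k y
  proof -
    have "(T n - T (n + k)) * norm y \<le> T n * norm y"
      using T0[of "n + k"] by (intro mult_right_mono) auto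
    then show ?thesis using F_diff[OF y, of n k] by simp
  qed
  have conv: "convergent (\<lambda>n. F n y)" if y: "y \<in> Y" for y
  proof (rule Cauchy_convergent, rule metric_CauchyI)
    fix e :: real assume e: "e > 0"
    have "(\<lambda>n. T n * norm y) \<longlonglongrightarrow> 0" using T_lim by (rule tendsto_mult_left_zero)
    then have "eventually (\<lambda>n. T n * norm y < e / 2) sequentially"
      by (rule order_tendstoD) (use e in simp)
    then obtain N where N: "T N * norm y < e / 2" by (auto simp: eventually_sequentially)
    have near: "\<bar>F m y - F N y\<bar> < e / 2" if m: "m \<ge> N" for m
      using F_diff'[OF y, of N "m - N"] N m by simp
    show "\<exists>M. \<forall>m\<ge>M. \<forall>n\<ge>M. dist (F m y) (F n y) < e"
    proof (intro exI allI impI)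
      fix m n assume "m \<ge> N" "n \<ge> N"
      then show "dist (F m y) (F n y) < e" using near[of m] near[of n] unfolding dist_real_def by linarith
    qed
  qed
  define f where "f y = lim (\<lambda>n. F n y)" for y
  have F_lim: "(\<lambda>n. F n y) \<longlonglongrightarrow> f y" if "y \<in> Y" for y
    using conv[OF that] by (simp add: f_def convergent_LIMSEQ_iff)
  have f_F: "\<bar>f y - F n y\<bar> \<le> T n * norm y" if y: "y \<in> Y" for n y
  proof (rule LIMSEQ_le_const2)
    have "(\<lambda>k. F (n + k) y) \<longlonglongrightarrow> f y"
      using LIMSEQ_ignore_initial_segment[OF F_lim[OF y], of n] by (simp add: add.commute)
    then show "(\<lambda>k. \<bar>F (n + k) y - F n y\<bar>) \<longlonglongrightarrow> \<bar>f y - F n y\<bar>"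
      by (intro tendsto_intros)
  qed (use F_diff'[OF y, of n] in blast)
  have f_f0: "\<bar>f y - f0 y\<bar> \<le> 1 / 4 * norm y" if y: "y \<in> Y" for y
  proof (rule LIMSEQ_le_const2)
    show "(\<lambda>n. \<bar>F n y - f0 y\<bar>) \<longlonglongrightarrow> \<bar>f y - f0 y\<bar>"
      by (intro tendsto_intros F_lim y)
    have "(1 / 4 - T n) * norm y \<le> 1 / 4 * norm y" for n
      using T0[of n] by (intro mult_right_mono) auto
    then show "\<exists>N. \<forall>n\<ge>N. \<bar>F n y - f0 y\<bar> \<le> 1 / 4 * norm y"
      using F_f0[OF y] order_trans by blast
  qed
  obtain g where g: "linear g" "\<And>z. \<bar>g z\<bar> \<le> 2 * norm z" "\<And>y. y \<in> Y \<Longrightarrow> g y = f y"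
  proof (rule Hahn_Banach_extension[OF Y(1), of 2 f])
    show "f (x + y) = f x + f y" if "x \<in> Y" "y \<in> Y" for x y
    proof (rule LIMSEQ_unique)
      show "(\<lambda>n. F n (x + y)) \<longlonglongrightarrow> f (x + y)" using that Y(1) by (intro F_lim subspace_add)
      show "(\<lambda>n. F n (x + y)) \<longlonglongrightarrow> f x + f y"
        using tendsto_add[OF F_lim[OF that(1)] F_lim[OF that(2)]] by (simp add: linear_add[OF F])
    qed
    show "f (r *\<^sub>R x) = r * f x" if "x \<in> Y" for r x
    proof (rule LIMSEQ_unique)
      show "(\<lambda>n. F n (r *\<^sub>R x)) \<longlonglongrightarrow> f (r *\<^sub>R x)" using that Y(1) by (intro F_lim subspace_scale)
      show "(\<lambda>n. F n (r *\<^sub>R x)) \<longlonglongrightarrow> r * f x"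
        using tendsto_mult_left[OF F_lim[OF that], of r] by (simp add: linear_scale[OF F])
    qed
    show "f x \<le> 2 * norm x" if "x \<in> Y" for x
      using f_f0[OF that] f0(2)[of x] norm_ge_zero[of x] by linarith
  qed (simp, rule that)
  have g_F: "\<bar>g y - F n y\<bar> \<le> T n" if y: "y \<in> Y" "norm y \<le> 1" for n y
  proof -
    have "T n * norm y \<le> T n * 1" using y(2) T0[of n] by (intro mult_left_mono) auto
    then show ?thesis using f_F[OF y(1), of n] g(3)[OF y(1)] by simp
  qed
  have g_slice: "norm (y - X n) \<le> 2 / (real n + 1)"
    if y: "y \<in> Y" "norm y \<le> 1" "S n + T n < g y" for n y
    using g_F[OF y(1,2), of n] y(3) by (intro slice y(1,2)) simp
  define \<sigma> where "\<sigma> = (SUP y\<in>{y\<in>Y. norm y \<le> 1}. g y)"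
  have bdd: "bdd_above (g ` {y\<in>Y. norm y \<le> 1})"
  proof (rule bdd_aboveI2)
    fix y assume "y \<in> {y\<in>Y. norm y \<le> 1}"
    then have "2 * norm y \<le> 2" by simp
    then show "g y \<le> 2" using g(2)[of y] by linarith
  qed
  have \<sigma>_ge: "g y \<le> \<sigma>" if "y \<in> Y" "norm y \<le> 1" for y
    unfolding \<sigma>_def using that by (intro cSUP_upper bdd) auto
  have \<sigma>_gt: "S n + T n < \<sigma>" for n
    using g_F[OF X, of n n] SF[of n] T0[of n] \<sigma>_ge[OF X, of n] by simp
  have "\<exists>y. y \<in> Y \<and> norm y \<le> 1 \<and> \<sigma> - 1 / (real k + 1) < g y" for k
  proof -
    have "\<sigma> - 1 / (real k + 1) < (SUP y\<in>{y\<in>Y. norm y \<le> 1}. g y)" by (simp add: \<sigma>_def)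
    moreover have "{y\<in>Y. norm y \<le> 1} \<noteq> {}" using y0 by auto
    ultimately show ?thesis using less_cSUP_iff[OF _ bdd] by auto
  qed
  then obtain z where z: "\<And>k. z k \<in> Y" "\<And>k. norm (z k) \<le> 1" "\<And>k. \<sigma> - 1 / (real k + 1) < g (z k)"
    by metis
  have inv_lim: "(\<lambda>k. c / (real k + 1)) \<longlonglongrightarrow> 0" for c
    using tendsto_mult_right_zero[OF LIMSEQ_inverse_real_of_nat, of c] by (simp add: inverse_eq_divide add.commute)
  have z_lim: "(\<lambda>k. g (z k)) \<longlonglongrightarrow> \<sigma>"
  proof (rule tendsto_sandwich)
    show "(\<lambda>k. \<sigma> - 1 / (real k + 1)) \<longlonglongrightarrow> \<sigma>"
      using tendsto_diff[OF tendsto_const inv_lim[of 1], of \<sigma>] by simp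
    show "(\<lambda>k. \<sigma>) \<longlonglongrightarrow> \<sigma>" by simp
  qed (use z \<sigma>_ge in \<open>auto intro!: always_eventually less_imp_le\<close>)
  have "Cauchy z"
  proof (rule metric_CauchyI)
    fix e :: real assume e: "e > 0"
    have "eventually (\<lambda>n. 4 / (real n + 1) < e) sequentially"
      by (rule order_tendstoD(2)[OF inv_lim e])
    then obtain n where n: "4 / (real n + 1) < e" by (auto simp: eventually_sequentially)
    have "eventually (\<lambda>k. S n + T n < g (z k)) sequentially"
      by (rule order_tendstoD(1)[OF z_lim \<sigma>_gt])
    then obtain N where N: "\<And>k. k \<ge> N \<Longrightarrow> S n + T n < g (z k)" by (auto simp: eventually_sequentially)
    show "\<exists>M. \<forall>m\<ge>M. \<forall>k\<ge>M. dist (z m) (z k) < e"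
    proof (intro exI allI impI)
      fix m k assume "m \<ge> N" "k \<ge> N"
      then have "norm (z m - X n) \<le> 2 / (real n + 1)" "norm (z k - X n) \<le> 2 / (real n + 1)"
        using N z by (auto intro!: g_slice)
      then have "dist (z m) (z k) \<le> 2 / (real n + 1) + 2 / (real n + 1)"
        using dist_triangle2[of "z m" "z k" "X n"] by (simp add: dist_norm)
      then show "dist (z m) (z k) < e" using n by simp
    qed
  qed
  then obtain x where x: "z \<longlonglongrightarrow> x" by (auto simp: Cauchy_convergent_iff convergent_def)
  have xY: "x \<in> Y" using closed_sequentially[OF Y(2)] z(1) x by blast
  have x1: "norm x \<le> 1" by (rule LIMSEQ_le_const2[OF tendsto_norm[OF x]]) (use z in blast)
  have "bounded_linear g"
    by (rule bounded_linear_intro[of g 2])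
      (use g in \<open>auto simp: linear_add linear_scale mult.commute\<close>)
  then have "(\<lambda>k. g (z k)) \<longlonglongrightarrow> g x" using x by (rule bounded_linear.tendsto)
  then have gx: "g x = \<sigma>" using z_lim LIMSEQ_unique by blast
  have less: "g y < g x" if y: "y \<in> Y" "norm y \<le> 1" "y \<noteq> x" for y
  proof (rule ccontr)
    assume "\<not> g y < g x"
    then have gy: "g y = \<sigma>" using \<sigma>_ge[OF y(1,2)] gx by simp
    have "norm (y - x) \<le> 4 / (real n + 1)" for n
    proof -
      have "norm (y - X n) \<le> 2 / (real n + 1)" "norm (x - X n) \<le> 2 / (real n + 1)"
        using \<sigma>_gt[of n] gy gx y xY x1 by (auto intro!: g_slice)
      then have "dist y x \<le> 2 / (real n + 1) + 2 / (real n + 1)"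
        using dist_triangle2[of y x "X n"] by (simp add: dist_norm)
      then show ?thesis by (simp add: dist_norm)
    qed
    then have "norm (y - x) \<le> 0" by (intro LIMSEQ_le_const[OF inv_lim[of 4]]) blast
    then show False using y(3) by simp
  qed
  have "\<bar>g y0 - 1\<bar> \<le> 1 / 4" using g(3)[OF y0(1)] f_f0[OF y0(1)] f0(3) y0(2) by simp
  then have pos: "g x > 0" using \<sigma>_ge[OF y0(1)] gx y0(2) by linarith
  have "norm x = 1"
  proof (rule ccontr)
    assume "norm x \<noteq> 1"
    then have n1: "norm x < 1" using x1 by simp
    have x0: "norm x > 0" using pos linear_0[OF g(1)] by auto
    let ?y = "(1 / norm x) *\<^sub>R x"
    have "?y \<in> Y" "norm ?y \<le> 1" using xY Y(1) x0 by (auto simp: subspace_scale)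
    then have "g ?y \<le> g x" unfolding gx by (rule \<sigma>_ge)
    then have "g x \<le> norm x * g x" using x0 by (simp add: linear_scale[OF g(1)] field_simps)
    moreover have "norm x * g x < 1 * g x" using n1 pos by (rule mult_strict_right_mono)
    ultimately show False by simp
  qed
  then show ?thesis using xY g(1,2) less by (intro that)
qed

section \<open>The weak-star density character\<close>

lemma card_of_lists_infinite:
  assumes "infinite A"
  shows "|lists A| \<le>o |A|"
proof -
  have "|{xs \<in> lists A. length xs = n}| \<le>o |A|" for n
  proof (induction n)
    case 0
    have "{xs \<in> lists A. length xs = 0} = {[]}" by auto
    then show ?case using assms by (simp add: card_of_singl_ordLeq infinite_imp_nonempty)
  next
    case (Suc n)
    let ?L = "{xs \<in> lists A. length xs = n}"
    have "{xs \<in> lists A. length xs = Suc n} = (\<lambda>(x, xs). x # xs) ` (A \<times> ?L)"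
      by (auto simp: length_Suc_conv image_iff)
    then have "|{xs \<in> lists A. length xs = Suc n}| \<le>o |A \<times> ?L|"
      by (simp add: card_of_image)
    also have "|A \<times> ?L| \<le>o |A \<times> A|" by (rule card_of_Times_mono2[OF Suc])
    also have "|A \<times> A| =o |A|" using assms by (rule card_of_Times_same_infinite)
    finally show ?case .
  qed
  moreover have "lists A = (\<Union>n. {xs \<in> lists A. length xs = n})" by auto
  moreover have "|UNIV :: nat set| \<le>o |A|" using assms infinite_iff_card_of_nat by blast
  ultimately show ?thesis
    using card_of_UNION_ordLeq_infinite[OF assms, of "UNIV :: nat set" "\<lambda>n. {xs \<in> lists A. length xs = n}"]
    by simp
qed

lemma real_or_complex_field_separable:
  assumes "real_or_complex_field TYPE('k)"
  obtains Q :: "'k::real_normed_field set" where "countable Q" "\<And>c e. e > 0 \<Longrightarrow> \<exists>q\<in>Q. norm (c - q) < e"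
proof -
  obtain h :: "'k \<Rightarrow> complex" where h: "\<And>a b. h (a + b) = h a + h b" "\<And>a. norm (h a) = norm a"
    using assms unfolding real_or_complex_field_def by blast
  obtain T where T: "countable T" "T \<subseteq> range h" "range h \<subseteq> closure T"
    using separable[of "range h"] by blast
  have h_diff: "h (a - b) = h a - h b" for a b using h(1)[of "a - b" b] by simp
  show ?thesis
  proof (rule that[of "inv h ` T"])
    show "countable (inv h ` T)" using T(1) by simp
    fix c and e :: real assume "e > 0"
    moreover have "h c \<in> closure T" using T(3) by blast
    ultimately obtain t where t: "t \<in> T" "dist t (h c) < e"
      unfolding closure_approachable by blast
    have "h (inv h t) = t" using t(1) T(2) by (intro f_inv_into_f) blast
    then have "norm (c - inv h t) = norm (h c - t)" using h(2)[of "c - inv h t"] by (simp add: h_diff)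
    then have "norm (c - inv h t) < e" using t(2) by (simp add: dist_norm norm_minus_commute)
    then show "\<exists>q\<in>inv h ` T. norm (c - q) < e" using t(1) by blast
  qed
qed

text \<open>
  Combinations are given by lists of coefficients and functionals, so that their number is bounded
  by the number of lists.
\<close>

definition linear_combination :: "('k::semiring_0 \<times> ('a \<Rightarrow> 'k)) list \<Rightarrow> 'a \<Rightarrow> 'k" where
  "linear_combination l x = (\<Sum>(c, f)\<leftarrow>l. c * f x)"

lemma linear_combination_simps [simp]:
  "linear_combination [] x = 0"
  "linear_combination ((c, f) # l) x = c * f x + linear_combination l x"
  "linear_combination (l @ l') x = linear_combination l x + linear_combination l' x"
  by (simp_all add: linear_combination_def)

context normed_space_over
begin

lemma dual_space_iff:
  "f \<in> dual_space smul \<longleftrightarrow> (\<forall>x y. f (x + y) = f x + f y) \<and> (\<forall>c x. f (smul c x) = c * f x) \<and>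
     (\<exists>C. \<forall>x. norm (f x) \<le> C * norm x)"
proof -
  have "vector_space ((*) :: 'k \<Rightarrow> 'k \<Rightarrow> 'k)" by unfold_locales (auto simp: algebra_simps)
  then show ?thesis
    unfolding dual_space_def Vector_Spaces.linear_iff using vector_space_axioms by auto
qed

lemma dual_add: "f \<in> dual_space smul \<Longrightarrow> f (x + y) = f x + f y"
  and dual_scale: "f \<in> dual_space smul \<Longrightarrow> f (smul c x) = c * f x"
  by (simp_all add: dual_space_iff)

lemma dual_diff: "f \<in> dual_space smul \<Longrightarrow> f (x - y) = f x - f y"
  using dual_add[of f "x - y" y] by simp

lemma dual_zero: "f \<in> dual_space smul \<Longrightarrow> f 0 = 0"
  using dual_diff[of f 0 0] by simp

lemma dual_eq_on_span:
  assumes "f \<in> dual_space smul" "g \<in> dual_space smul" "\<And>s. s \<in> S \<Longrightarrow> f s = g s" "x \<in> span S"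
  shows "f x = g x"
  using assms(4)
proof (induction rule: span_induct_alt)
  case base
  show ?case using assms(1,2) by (simp add: dual_zero)
next
  case (step c s y)
  then show ?case using assms(1-3) by (simp add: dual_add dual_scale)
qed

lemma dual_space_zero: "(\<lambda>_. 0) \<in> dual_space smul"
  by (auto simp: dual_space_iff intro!: exI[of _ 0])

lemma dual_space_add:
  assumes "f \<in> dual_space smul" "g \<in> dual_space smul"
  shows "(\<lambda>x. f x + g x) \<in> dual_space smul"
proof -
  obtain B C where "\<And>x. norm (f x) \<le> B * norm x" "\<And>x. norm (g x) \<le> C * norm x"
    using assms unfolding dual_space_iff by blast
  then have "norm (f x + g x) \<le> (B + C) * norm x" for x
    by (metis (no_types, lifting) add_mono distrib_right norm_triangle_le)
  then have "\<exists>D. \<forall>x. norm (f x + g x) \<le> D * norm x" by blast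
  then show ?thesis using assms by (simp add: dual_space_iff algebra_simps)
qed

lemma dual_space_scale:
  assumes "f \<in> dual_space smul"
  shows "(\<lambda>x. c * f x) \<in> dual_space smul"
proof -
  obtain B where "\<And>x. norm (f x) \<le> B * norm x" using assms unfolding dual_space_iff by blast
  then have "norm (c * f x) \<le> (norm c * B) * norm x" for x
    by (simp add: norm_mult mult.assoc mult_left_mono)
  then have "\<exists>D. \<forall>x. norm (c * f x) \<le> D * norm x" by blast
  then show ?thesis using assms by (simp add: dual_space_iff algebra_simps)
qed

lemma linear_combination_dual:
  assumes "l \<in> lists (UNIV \<times> F)" "F \<subseteq> dual_space smul"
  shows "linear_combination l \<in> dual_space smul"
  using assms(1)
proof (induction l)
  case Nil
  then show ?case using dual_space_zero by (simp add: linear_combination_def)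
next
  case (Cons p l)
  obtain c f where p: "p = (c, f)" "f \<in> F" using Cons.hyps by auto
  have "linear_combination (p # l) = (\<lambda>x. c * f x + linear_combination l x)"
    by (rule ext) (simp add: p)
  then show ?case
    using Cons p(2) assms(2) by (auto intro!: dual_space_add dual_space_scale)
qed

text \<open>
  Finitely many functionals have a common kernel of finite codimension.
\<close>

lemma span_modulo_kernel:
  assumes "finite F" "F \<subseteq> dual_space smul"
  shows "\<exists>B. finite B \<and> (\<forall>x. \<exists>b\<in>span B. \<forall>f\<in>F. f (x - b) = 0)"
  using assms
proof (induction F rule: finite_induct)
  case empty
  show ?case by (intro exI[of _ "{}"]) auto
next
  case (insert f F)
  then obtain B where B: "finite B" "\<And>x. \<exists>b\<in>span B. \<forall>g\<in>F. g (x - b) = 0" by auto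
  have f: "f \<in> dual_space smul" and F: "\<And>g. g \<in> F \<Longrightarrow> g \<in> dual_space smul" using insert.prems by auto
  show ?case
  proof (cases "\<exists>e. f e \<noteq> 0 \<and> (\<forall>g\<in>F. g e = 0)")
    case False
    then have "\<exists>b\<in>span B. \<forall>g\<in>insert f F. g (x - b) = 0" for x using B(2)[of x] by blast
    then show ?thesis using B(1) by blast
  next
    case True
    then obtain e where e: "f e \<noteq> 0" "\<And>g. g \<in> F \<Longrightarrow> g e = 0" by blast
    have "\<exists>b\<in>span (insert e B). \<forall>g\<in>insert f F. g (x - b) = 0" for x
    proof -
      obtain b where b: "b \<in> span B" "\<And>g. g \<in> F \<Longrightarrow> g (x - b) = 0" using B(2)[of x] by blast
      let ?b = "b + smul (f (x - b) / f e) e"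
      have "b \<in> span (insert e B)" using b(1) span_mono[of B "insert e B"] by blast
      then have "?b \<in> span (insert e B)"
        by (intro span_add span_scale) (auto intro: span_base)
      moreover have "g (x - ?b) = 0" if "g \<in> insert f F" for g
      proof -
        have "x - ?b = (x - b) - smul (f (x - b) / f e) e" by simp
        then have "g (x - ?b) = g (x - b) - f (x - b) / f e * g e"
          using that f F by (metis dual_diff dual_scale insert_iff)
        then show ?thesis using that b(2)[of g] e(1) e(2)[of g] by (cases "g = f") auto
      qed
      ultimately show ?thesis by blast
    qed
    then show ?thesis using B(1) by (intro exI[of _ "insert e B"]) auto
  qed
qed

lemma finite_dual_set_not_total:
  assumes inf: "infinite_dimensional smul" and F: "finite F" "F \<subseteq> dual_space smul"
  shows "\<exists>x. x \<noteq> 0 \<and> (\<forall>f\<in>F. f x = 0)"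
proof (rule ccontr)
  assume "\<not> ?thesis"
  then have total: "x = 0" if "\<forall>f\<in>F. f x = 0" for x using that by blast
  obtain B where B: "finite B" "\<And>x. \<exists>b\<in>span B. \<forall>f\<in>F. f (x - b) = 0"
    using span_modulo_kernel[OF F] by blast
  have "x \<in> span B" for x
  proof -
    obtain b where "b \<in> span B" "\<forall>f\<in>F. f (x - b) = 0" using B(2) by blast
    then show ?thesis using total[of "x - b"] by simp
  qed
  then have "span B = UNIV" by blast
  then show False using inf B(1) unfolding infinite_dimensional_def by blast
qed

text \<open>
  Induction over \<open>S\<close>. For a new point \<open>a\<close> outside the span of \<open>S\<close> the induction hypothesis gives a
  combination \<open>e\<close> that vanishes on \<open>S\<close> and has the value 1 at \<open>a\<close>, and \<open>y = x - e x a\<close> is outside the span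
  of \<open>S\<close> as well. A combination \<open>l\<close> for \<open>y\<close>, corrected by the multiple \<open>- l a\<close> of \<open>e\<close>, is the one for \<open>x\<close>.
\<close>

lemma total_combination_separates:
  assumes F: "F \<subseteq> dual_space smul" and total: "\<And>x. x \<noteq> 0 \<Longrightarrow> \<exists>f\<in>F. f x \<noteq> 0"
    and S: "finite S" and x: "x \<notin> span S"
  shows "\<exists>l\<in>lists (UNIV \<times> F). (\<forall>s\<in>S. linear_combination l s = 0) \<and> linear_combination l x = 1"
  using S x
proof (induction S arbitrary: x rule: finite_induct)
  case empty
  then have "x \<noteq> 0" by auto
  then obtain f where f: "f \<in> F" "f x \<noteq> 0" using total by blast
  then show ?case by (intro bexI[of _ "[(1 / f x, f)]"]) auto
next
  case (insert a S)
  have dual: "linear_combination l \<in> dual_space smul" if "l \<in> lists (UNIV \<times> F)" for l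
    by (rule linear_combination_dual[OF that F])
  have x: "x \<notin> span S" using insert.prems span_mono[of S "insert a S"] by blast
  show ?case
  proof (cases "a \<in> span S")
    case True
    obtain l where l: "l \<in> lists (UNIV \<times> F)" "\<forall>s\<in>S. linear_combination l s = 0" "linear_combination l x = 1"
      using insert.IH[OF x] by blast
    then have "linear_combination l a = 0"
      using dual_eq_on_span[OF dual[OF l(1)] dual_space_zero _ True] by blast
    then show ?thesis using l by auto
  next
    case False
    obtain e where e: "e \<in> lists (UNIV \<times> F)" "\<forall>s\<in>S. linear_combination e s = 0" "linear_combination e a = 1"
      using insert.IH[OF False] by blast
    let ?y = "x - smul (linear_combination e x) a"
    have "?y \<notin> span S"
    proof
      assume "?y \<in> span S"
      then have "?y \<in> span (insert a S)" using span_mono[of S "insert a S"] by blast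
      then have "?y + smul (linear_combination e x) a \<in> span (insert a S)"
        by (intro span_add span_scale) (auto intro: span_base)
      then show False using insert.prems by simp
    qed
    then obtain l where l: "l \<in> lists (UNIV \<times> F)" "\<forall>s\<in>S. linear_combination l s = 0"
        "linear_combination l ?y = 1"
      using insert.IH by blast
    define k where "k = - linear_combination l a"
    define m where "m = map (\<lambda>(c, f). (k * c, f)) e"
    have m: "linear_combination m z = k * linear_combination e z" for z
      unfolding m_def linear_combination_def
      by (induction e) (auto simp: algebra_simps)
    have "m \<in> lists (UNIV \<times> F)" using e(1) by (auto simp: m_def)
    then have "l @ m \<in> lists (UNIV \<times> F)" using l(1) by simp
    moreover have "linear_combination (l @ m) s = 0" if "s \<in> insert a S" for s
      using that l(2) e(2,3) by (auto simp: m k_def)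
    moreover have "linear_combination (l @ m) x = 1"
      using l(3) dual_diff[OF dual[OF l(1)], of x "smul (linear_combination e x) a"]
        dual_scale[OF dual[OF l(1)], of "linear_combination e x" a]
      by (simp add: m k_def mult.commute)
    ultimately show ?thesis by blast
  qed
qed

text \<open>
  On finite sets the combinations of a total set of functionals are indistinguishable from the whole
  dual space; this is its weak-star density.
\<close>

lemma total_combination_interpolates:
  assumes F: "F \<subseteq> dual_space smul" and total: "\<And>x. x \<noteq> 0 \<Longrightarrow> \<exists>f\<in>F. f x \<noteq> 0"
    and g: "g \<in> dual_space smul" and S: "finite S"
  shows "\<exists>l\<in>lists (UNIV \<times> F). \<forall>s\<in>S. linear_combination l s = g s"
  using S
proof (induction S rule: finite_induct)
  case empty
  show ?case by (intro bexI[of _ "[]"]) auto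
next
  case (insert a S)
  then obtain l where l: "l \<in> lists (UNIV \<times> F)" "\<And>s. s \<in> S \<Longrightarrow> linear_combination l s = g s" by blast
  show ?case
  proof (cases "a \<in> span S")
    case True
    then have "linear_combination l a = g a"
      using dual_eq_on_span[OF linear_combination_dual[OF l(1) F] g l(2)] by blast
    then show ?thesis using l by auto
  next
    case False
    obtain e where e: "e \<in> lists (UNIV \<times> F)" "\<forall>s\<in>S. linear_combination e s = 0" "linear_combination e a = 1"
      using total_combination_separates[OF F total insert.hyps(1) False] by blast
    define k where "k = g a - linear_combination l a"
    define m where "m = map (\<lambda>(c, f). (k * c, f)) e"
    have m: "linear_combination m z = k * linear_combination e z" for z
      unfolding m_def linear_combination_def
      by (induction e) (auto simp: algebra_simps)
    have "m \<in> lists (UNIV \<times> F)" using e(1) by (auto simp: m_def)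
    then have "l @ m \<in> lists (UNIV \<times> F)" using l(1) by simp
    moreover have "linear_combination (l @ m) s = g s" if "s \<in> insert a S" for s
      using that l(2) e(2,3) by (auto simp: m k_def)
    ultimately show ?thesis by blast
  qed
qed

text \<open>
  The coefficients are replaced by elements of \<open>Q\<close> one at a time; each error is measured against a
  bound for the functional on the finite set \<open>S\<close>.
\<close>

lemma linear_combination_approx:
  assumes Q: "\<And>c e. e > 0 \<Longrightarrow> \<exists>q\<in>Q. norm (c - q :: 'k) < e"
    and l: "l \<in> lists (UNIV \<times> F)" and S: "finite S" and e: "e > 0"
  shows "\<exists>m\<in>lists (Q \<times> F). \<forall>s\<in>S. norm (linear_combination l s - linear_combination m s) < e"
  using l e
proof (induction l arbitrary: e)
  case Nil
  then show ?case by (intro bexI[of _ "[]"]) auto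
next
  case (Cons p l)
  obtain c f where p: "p = (c, f)" "f \<in> F" using Cons.hyps by auto
  have "0 < e / 2" using Cons.prems by simp
  from Cons.IH[OF this] obtain m where m: "m \<in> lists (Q \<times> F)"
    "\<And>s. s \<in> S \<Longrightarrow> norm (linear_combination l s - linear_combination m s) < e / 2"
    by blast
  define b where "b = 1 + (\<Sum>s\<in>S. norm (f s))"
  have b: "b > 0" unfolding b_def by (intro add_pos_nonneg sum_nonneg) auto
  obtain q where q: "q \<in> Q" "norm (c - q) < e / (2 * b)"
    using Q[of "e / (2 * b)"] Cons.prems b by auto
  have "norm (linear_combination (p # l) s - linear_combination ((q, f) # m) s) < e" if s: "s \<in> S" for s
  proof -
    have "norm (f s) \<le> (\<Sum>s\<in>S. norm (f s))" using S s by (intro member_le_sum) auto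
    then have "norm ((c - q) * f s) \<le> e / (2 * b) * b"
      unfolding norm_mult using q(2) b Cons.prems by (intro mult_mono) (auto simp: b_def)
    then have "norm ((c - q) * f s) \<le> e / 2" using b by simp
    moreover have eq: "linear_combination (p # l) s - linear_combination ((q, f) # m) s =
        (c - q) * f s + (linear_combination l s - linear_combination m s)"
      by (simp add: p algebra_simps)
    ultimately show ?thesis
      using norm_triangle_ineq[of "(c - q) * f s" "linear_combination l s - linear_combination m s"] m(2)[OF s]
      unfolding eq by linarith
  qed
  moreover have "(q, f) # m \<in> lists (Q \<times> F)" using q(1) p(2) m(1) by simp
  ultimately show ?case by blast
qed

lemma topspace_weak_star: "topspace (weak_star_topology smul) = dual_space smul"
  unfolding weak_star_topology_def by simp

lemma dense_in_weak_starI: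
  assumes D: "D \<subseteq> dual_space smul"
    and approx: "\<And>g S e. g \<in> dual_space smul \<Longrightarrow> finite S \<Longrightarrow> e > 0 \<Longrightarrow>
      \<exists>d\<in>D. \<forall>s\<in>S. norm (g s - d s) < e"
  shows "dense_in (weak_star_topology smul) D"
  unfolding dense_in_def topspace_weak_star
proof (intro conjI D subset_antisym)
  show "weak_star_topology smul closure_of D \<subseteq> dual_space smul"
    using closure_of_subset_topspace[of "weak_star_topology smul" D] by (simp add: topspace_weak_star)
  show "dual_space smul \<subseteq> weak_star_topology smul closure_of D"
  proof
    fix g assume g: "g \<in> dual_space smul"
    show "g \<in> weak_star_topology smul closure_of D"
      unfolding in_closure_of topspace_weak_star
    proof (intro conjI g allI impI, elim conjE)
      fix T assume gT: "g \<in> T" and "openin (weak_star_topology smul) T"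
      then obtain V where V: "openin (product_topology (\<lambda>_. euclidean) UNIV) V" "T = V \<inter> dual_space smul"
        unfolding weak_star_topology_def openin_subtopology by blast
      have "g \<in> V" using gT V(2) by blast
      then obtain U where U: "finite {i. U i \<noteq> UNIV}" "\<And>i. open (U i)" "g \<in> Pi\<^sub>E UNIV U" "Pi\<^sub>E UNIV U \<subseteq> V"
        using V(1) unfolding openin_product_topology_alt by auto
      let ?S = "{i. U i \<noteq> UNIV}"
      have "\<forall>i. \<exists>e>0. ball (g i) e \<subseteq> U i"
        using U(2,3) by (auto simp: PiE_iff intro: openE)
      then obtain e where e: "\<And>i. e i > 0" "\<And>i. ball (g i) (e i) \<subseteq> U i" by metis
      define \<delta> where "\<delta> = Min (insert 1 (e ` ?S))"
      have \<delta>: "\<delta> > 0" "\<And>i. i \<in> ?S \<Longrightarrow> \<delta> \<le> e i"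
        using U(1) e(1) by (auto simp: \<delta>_def)
      obtain d where d: "d \<in> D" "\<And>s. s \<in> ?S \<Longrightarrow> norm (g s - d s) < \<delta>"
        using approx[OF g U(1) \<delta>(1)] by blast
      have "d i \<in> U i" for i
      proof (cases "i \<in> ?S")
        case True
        then have "d i \<in> ball (g i) (e i)" using d(2) \<delta>(2) by (fastforce simp: dist_norm)
        then show ?thesis using e(2) by blast
      qed simp
      then have "d \<in> V" using U(4) by (auto simp: PiE_iff)
      then show "\<exists>y. y \<in> D \<and> y \<in> T" using d(1) D V(2) by blast
    qed
  qed
qed

text \<open>
  The combinations of \<open>F\<close> with coefficients in a countable dense set of scalars are weak-star dense,
  and there are no more of them than finite lists over a set of the cardinality of \<open>F\<close>.
\<close>

theorem density_character_le_total:
  assumes k: "real_or_complex_field TYPE('k)"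
    and F: "F \<subseteq> dual_space smul" "infinite F" and total: "\<And>x. x \<noteq> 0 \<Longrightarrow> \<exists>f\<in>F. f x \<noteq> 0"
  shows "density_character (weak_star_topology smul) \<le>o |F|"
proof -
  obtain Q :: "'k set" where Q: "countable Q" "\<And>c e. e > 0 \<Longrightarrow> \<exists>q\<in>Q. norm (c - q) < e"
    by (rule real_or_complex_field_separable[OF k]) (rule that)
  define D where "D = linear_combination ` lists (Q \<times> F)"
  have "dense_in (weak_star_topology smul) D"
  proof (rule dense_in_weak_starI)
    show "D \<subseteq> dual_space smul"
    proof -
      have "lists (Q \<times> F) \<subseteq> lists (UNIV \<times> F)" by (rule lists_mono) auto
      then show ?thesis unfolding D_def using linear_combination_dual[OF _ F(1)] by blast
    qed
    fix g :: "'a \<Rightarrow> 'k" and S :: "'a set" and e :: real assume g: "g \<in> dual_space smul" and S: "finite S" and e: "e > 0"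
    obtain l where l: "l \<in> lists (UNIV \<times> F)" "\<And>s. s \<in> S \<Longrightarrow> linear_combination l s = g s"
      using total_combination_interpolates[OF F(1) total g S] by blast
    obtain m where "m \<in> lists (Q \<times> F)" "\<forall>s\<in>S. norm (linear_combination l s - linear_combination m s) < e"
      using linear_combination_approx[OF Q(2) l(1) S e] by blast
    then show "\<exists>d\<in>D. \<forall>s\<in>S. norm (g s - d s) < e" unfolding D_def using l(2) by auto
  qed
  then have "density_character (weak_star_topology smul) \<le>o |D|"
    using density_character_attained[of "weak_star_topology smul"] by metis
  also have "|D| \<le>o |lists (Q \<times> F)|" unfolding D_def by (rule card_of_image)
  also have "|lists (Q \<times> F)| \<le>o |F|"
  proof -
    have "Q \<noteq> {}" using Q(2)[of 1 0] by auto
    moreover have "|Q| \<le>o |UNIV :: nat set|"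
      using Q(1) unfolding countable_def card_of_ordLeq[symmetric] by blast
    then have "|Q| \<le>o |F|"
      using F(2) unfolding infinite_iff_card_of_nat by (rule ordLeq_transitive)
    ultimately have QF: "|Q \<times> F| =o |F|" using card_of_Times_infinite_simps(3)[OF F(2)] by blast
    have "infinite (Q \<times> F)" using F(2) \<open>Q \<noteq> {}\<close> by (auto simp: finite_cartesian_product_iff)
    then have "|lists (Q \<times> F)| \<le>o |Q \<times> F|" by (rule card_of_lists_infinite)
    then show ?thesis using QF by (rule ordLeq_ordIso_trans)
  qed
  finally show ?thesis .
qed

text \<open>
  For real scalars \<open>f\<close> is \<open>g\<close> itself; for complex scalars, with \<open>j\<close> the imaginary unit of the field, it
  is \<open>f x = g x - j (g (j x))\<close>, which has real part \<open>g\<close>.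
\<close>

lemma dual_space_dominates_real_functional:
  fixes g :: "'a \<Rightarrow> real"
  assumes k: "real_or_complex_field TYPE('k)"
    and g: "linear g" "\<And>z. \<bar>g z\<bar> \<le> C * norm z"
  obtains f where "f \<in> dual_space smul" "\<And>z. f z = 0 \<Longrightarrow> g z = 0"
proof -
  obtain h :: "'k \<Rightarrow> complex" where h: "\<And>a b. h (a + b) = h a + h b" "\<And>a b. h (a * b) = h a * h b"
      "\<And>r. h (of_real r) = of_real r" "\<And>a. norm (h a) = norm a" "range h = \<real> \<or> range h = UNIV"
    using k unfolding real_or_complex_field_def by blast
  have h_diff: "h (a - b) = h a - h b" for a b using h(1)[of "a - b" b] by simp
  have h_inj: "a = b" if "h a = h b" for a b
    using h(4)[of "a - b"] that by (simp add: h_diff)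
  have g_real: "g (smul (of_real r) x) = r * g x" for r x
    by (simp add: scale_of_real linear_scale[OF g(1)])
  show ?thesis
  proof (cases "\<exists>j. h j = \<i>")
    case False
    then have range: "range h = \<real>" using h(5) by (metis UNIV_I rangeE)
    have real: "\<exists>r. a = of_real r" for a :: 'k
    proof -
      have "h a \<in> \<real>" using range by blast
      then obtain r where "h a = of_real r" by (rule Reals_cases)
      then have "h a = h (of_real r)" by (simp only: h(3))
      then show ?thesis using h_inj by blast
    qed
    show ?thesis
    proof (rule that[of "\<lambda>x. of_real (g x)"])
      have "of_real (g (smul c x)) = c * of_real (g x)" for c x
        using real[of c] by (auto simp: g_real)
      then show "(\<lambda>x. of_real (g x)) \<in> dual_space smul"
        using g(2) by (auto simp: dual_space_iff linear_add[OF g(1)])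
    qed simp
  next
    case True
    then obtain j where j: "h j = \<i>" by blast
    have jj: "j * j = - 1"
    proof (rule h_inj)
      have "h (-1) = -1" using h(3)[of "-1"] by simp
      then show "h (j * j) = h (- 1)" by (simp add: h(2) j)
    qed
    have norm_j: "norm j = 1" using h(4)[of j] j by simp
    have decomp: "\<exists>r s. a = of_real r + of_real s * j" for a
    proof (intro exI)
      show "a = of_real (Re (h a)) + of_real (Im (h a)) * j"
        by (rule h_inj) (simp add: h j complex_eq mult.commute)
    qed
    define f where "f x = of_real (g x) - j * of_real (g (smul j x))" for x
    have f_add: "f (x + y) = f x + f y" for x y
      by (simp add: f_def linear_add[OF g(1)] scale_right_distrib algebra_simps)
    have f_real: "f (smul (of_real r) x) = of_real r * f x" for r x
    proof -
      have eq: "smul j (smul (of_real r) x) = smul (of_real r) (smul j x)" by (simp add: mult.commute)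
      show ?thesis unfolding f_def eq g_real of_real_mult by (simp only: algebra_simps)
    qed
    have f_j: "f (smul j x) = j * f x" for x
    proof -
      have "smul j (smul j x) = smul (of_real (-1)) x" by (simp add: jj)
      then have "g (smul j (smul j x)) = - g x" by (simp only: g_real)
      then show ?thesis by (simp add: f_def right_diff_distrib jj flip: mult.assoc)
    qed
    have f_scale: "f (smul c x) = c * f x" for c x
    proof -
      obtain r s where c: "c = of_real r + of_real s * j" using decomp by blast
      have "smul c x = smul (of_real r) x + smul (of_real s) (smul j x)"
        by (simp add: c scale_left_distrib)
      then have "f (smul c x) = of_real r * f x + of_real s * (j * f x)"
        by (simp only: f_add f_real f_j)
      then show ?thesis by (simp add: c algebra_simps)
    qed
    have "norm (f x) \<le> 2 * C * norm x" for x
    proof -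
      have "norm (f x) \<le> \<bar>g x\<bar> + \<bar>g (smul j x)\<bar>"
        unfolding f_def using norm_triangle_ineq4[of "of_real (g x) :: 'k"] norm_j
        by (metis mult_1 norm_mult norm_of_real)
      also have "\<dots> \<le> 2 * C * norm x"
        using g(2)[of x] g(2)[of "smul j x"] by (simp add: norm_scale norm_j)
      finally show ?thesis .
    qed
    then have "f \<in> dual_space smul" using f_add f_scale by (auto simp: dual_space_iff)
    moreover have "g z = 0" if "f z = 0" for z
    proof -
      have "Re (h (f z)) = g z" by (simp add: f_def h_diff h(2,3) j)
      moreover have "h 0 = 0" using h(3)[of 0] by simp
      ultimately show ?thesis using that by simp
    qed
    ultimately show ?thesis by (rule that)
  qed
qed

lemma dual_kernel_subspace: 
  assumes "F \<subseteq> dual_space smul"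
  shows "Real_Vector_Spaces.subspace {y. \<forall>f\<in>F. f y = 0}"
proof (rule Real_Vector_Spaces.subspaceI)
  show "0 \<in> {y. \<forall>f\<in>F. f y = 0}" using assms dual_zero by blast
  show "x + y \<in> {y. \<forall>f\<in>F. f y = 0}"
    if "x \<in> {y. \<forall>f\<in>F. f y = 0}" "y \<in> {y. \<forall>f\<in>F. f y = 0}" for x y
  proof (intro CollectI ballI)
    fix f assume f: "f \<in> F"
    then have "f \<in> dual_space smul" using assms by blast
    moreover have "f x = 0" "f y = 0" using f that by blast+
    ultimately show "f (x + y) = 0" by (simp add: dual_add)
  qed
  show "r *\<^sub>R x \<in> {y. \<forall>f\<in>F. f y = 0}" if "x \<in> {y. \<forall>f\<in>F. f y = 0}" for r x
  proof (intro CollectI ballI)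
    fix f assume f: "f \<in> F"
    then have "f \<in> dual_space smul" using assms by blast
    moreover have "f x = 0" using f that by blast
    ultimately show "f (r *\<^sub>R x) = 0" using dual_scale[of f "of_real r" x] by (simp add: scale_of_real)
  qed
qed

lemma dual_kernel_closed:
  assumes "F \<subseteq> dual_space smul"
  shows "closed {y. \<forall>f\<in>F. f y = 0}"
proof -
  have "closed {y. f y = 0}" if "f \<in> dual_space smul" for f
  proof -
    obtain C where C: "\<And>x. norm (f x) \<le> C * norm x" using \<open>f \<in> dual_space smul\<close> unfolding dual_space_iff by blast
    have "bounded_linear f"
    proof (rule bounded_linear_intro)
      show "f (r *\<^sub>R x) = r *\<^sub>R f x" for r x
        using dual_scale[OF that, of "of_real r" x] by (simp add: scale_of_real scaleR_conv_of_real)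
      show "norm (f x) \<le> norm x * C" for x using C[of x] by (simp add: mult.commute)
    qed (simp add: dual_add[OF that])
    then have "continuous_on UNIV f" by (rule linear_continuous_on)
    then show ?thesis by (intro closed_Collect_eq continuous_on_const)
  qed
  then have "closed (\<Inter>f\<in>F. {y. f y = 0})" using assms by (intro closed_INT) auto
  moreover have "(\<Inter>f\<in>F. {y. f y = 0}) = {y. \<forall>f\<in>F. f y = 0}" by auto
  ultimately show ?thesis by simp
qed

end

section \<open>Construction of the separated family\<close>

theorem theorem4p8:
  fixes smul :: "'k::real_normed_field \<Rightarrow> 'a::banach \<Rightarrow> 'a"
  assumes "real_or_complex_field TYPE('k)"
    and "normed_space_over smul"
    and "infinite_dimensional smul"
    and "radon_nikodym_property TYPE('a)"
  shows "\<exists>A :: 'a set. (\<forall>x\<in>A. norm x = 1) \<and> symmetrically_one_plus_separated A \<and>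
           |A| =o density_character (weak_star_topology smul)"
proof -
  interpret normed_space_over smul by (rule assms(2))
  obtain D where D: "|D| = density_character (weak_star_topology smul)"
    using density_character_attained by blast
  \<comment> \<open>\<open>|D|\<close> is a well-order on \<open>D\<close> whose proper initial segments have smaller cardinality; the vectors
    are indexed by \<open>D\<close> and chosen by recursion along its strict part \<open>R\<close>\<close>
  define R where "R = |D| - Id"
  \<comment> \<open>the common kernel of the functionals chosen before stage \<open>\<alpha>\<close>\<close>
  define Y where "Y \<phi> \<alpha> = {y. \<forall>f\<in>(\<lambda>\<beta>. snd (\<phi> \<beta>)) ` underS |D| \<alpha>. f y = 0}"
    for \<phi> :: "('a \<Rightarrow> 'k) \<Rightarrow> 'a \<times> ('a \<Rightarrow> 'k)" and \<alpha>
  define good where "good \<phi> \<alpha> p \<longleftrightarrow> (\<alpha> \<in> D \<longrightarrow> fst p \<in> Y \<phi> \<alpha> \<and> norm (fst p) = 1 \<and> snd p \<in> dual_space smul \<and>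
      (\<exists>g::'a \<Rightarrow> real. linear g \<and> (\<forall>z. snd p z = 0 \<longrightarrow> g z = 0) \<and>
         (\<forall>y\<in>Y \<phi> \<alpha>. norm y \<le> 1 \<longrightarrow> y \<noteq> fst p \<longrightarrow> g y < g (fst p))))"
    for \<phi> :: "('a \<Rightarrow> 'k) \<Rightarrow> 'a \<times> ('a \<Rightarrow> 'k)" and \<alpha> p
  have card: "Card_order |D|" and Field: "Field |D| = D" and wo: "Well_order |D|"
    by (rule card_of_Card_order, rule Field_card_of, rule card_of_Well_order)
  have underS_R: "underS |D| \<alpha> = {\<beta>. (\<beta>, \<alpha>) \<in> R}" for \<alpha> by (auto simp: underS_def R_def)
  have "\<exists>\<phi>. \<forall>\<alpha>. good \<phi> \<alpha> (\<phi> \<alpha>)"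
  proof (rule dependent_wf_choice[of R])
    show "wf R" using wo unfolding R_def well_order_on_def by blast
    show "good \<phi> \<alpha> p = good \<psi> \<alpha> p" if "\<And>\<beta>. (\<beta>, \<alpha>) \<in> R \<Longrightarrow> \<phi> \<beta> = \<psi> \<beta>" for \<phi> \<psi> \<alpha> p
    proof -
      have "Y \<phi> \<alpha> = Y \<psi> \<alpha>" unfolding Y_def using that by (auto simp: underS_R)
      then show ?thesis by (simp add: good_def)
    qed
    fix \<alpha> \<phi> assume IH: "\<And>\<beta>. (\<beta>, \<alpha>) \<in> R \<Longrightarrow> good \<phi> \<beta> (\<phi> \<beta>)"
    show "\<exists>p. good \<phi> \<alpha> p"
    proof (cases "\<alpha> \<in> D")
      case False
      then show ?thesis by (simp add: good_def)
    next
      case True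
      \<comment> \<open>fewer functionals than the density character are not total\<close>
      define F where "F = (\<lambda>\<beta>. snd (\<phi> \<beta>)) ` underS |D| \<alpha>"
      have F: "F \<subseteq> dual_space smul"
      proof
        fix f assume "f \<in> F"
        then obtain \<beta> where \<beta>: "(\<beta>, \<alpha>) \<in> R" "f = snd (\<phi> \<beta>)" by (auto simp: F_def underS_R)
        have "\<beta> \<in> D" using \<beta>(1) Field by (auto simp: R_def Field_def)
        then show "f \<in> dual_space smul" using IH[OF \<beta>(1)] \<beta>(2) by (simp add: good_def)
      qed
      have "|F| \<le>o |underS |D| \<alpha>|" unfolding F_def by (rule card_of_image)
      also have "|underS |D| \<alpha>| <o |D|" by (rule card_of_underS[OF card]) (simp add: True Field)
      finally have small: "|F| <o |D|" .
      have "\<exists>x. x \<noteq> 0 \<and> (\<forall>f\<in>F. f x = 0)"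
      proof (cases "finite F")
        case True
        then show ?thesis by (rule finite_dual_set_not_total[OF assms(3) _ F])
      next
        case False
        show ?thesis
        proof (rule ccontr)
          assume "\<not> ?thesis"
          then have "\<And>x. x \<noteq> 0 \<Longrightarrow> \<exists>f\<in>F. f x \<noteq> 0" by blast
          from density_character_le_total[OF assms(1) F False this] have "|D| \<le>o |F|" by (simp add: D)
          then show False using small not_ordLess_ordLeq by blast
        qed
      qed
      then have ne: "Y \<phi> \<alpha> \<noteq> {0}" unfolding Y_def F_def by blast
      have sub: "Real_Vector_Spaces.subspace (Y \<phi> \<alpha>)" "closed (Y \<phi> \<alpha>)"
        using dual_kernel_subspace[OF F] dual_kernel_closed[OF F] by (simp_all add: Y_def F_def)
      obtain x g C where x: "x \<in> Y \<phi> \<alpha>" "norm x = 1" "linear g" "\<And>z. \<bar>g z\<bar> \<le> C * norm z"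
        "\<And>y. y \<in> Y \<phi> \<alpha> \<Longrightarrow> norm y \<le> 1 \<Longrightarrow> y \<noteq> x \<Longrightarrow> g y < g x"
        by (rule RNP_exposed_point_of_ball[OF assms(4) sub ne]) (rule that)
      obtain f where "f \<in> dual_space smul" "\<And>z. f z = 0 \<Longrightarrow> g z = 0"
        by (rule dual_space_dominates_real_functional[OF assms(1) x(3,4)]) (rule that)
      then have "good \<phi> \<alpha> (x, f)" unfolding good_def using x by auto
      then show ?thesis ..
    qed
  qed
  then obtain \<phi> where \<phi>: "\<And>\<alpha>. good \<phi> \<alpha> (\<phi> \<alpha>)" by blast
  define X where "X \<alpha> = fst (\<phi> \<alpha>)" for \<alpha>
  have X: "norm (X \<alpha>) = 1" "X \<alpha> \<in> Y \<phi> \<alpha>" if "\<alpha> \<in> D" for \<alpha>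
    using \<phi>[of \<alpha>] that by (auto simp: good_def X_def)
  have less: "norm (X \<beta> + X \<alpha>) > 1 \<and> norm (X \<beta> - X \<alpha>) > 1" if R: "(\<beta>, \<alpha>) \<in> R" for \<alpha> \<beta>
  proof -
    have D2: "\<alpha> \<in> D" "\<beta> \<in> D" using R Field by (auto simp: R_def Field_def)
    define F where "F = (\<lambda>\<gamma>. snd (\<phi> \<gamma>)) ` underS |D| \<beta>"
    have "underS |D| \<beta> \<subseteq> D" using Field by (auto simp: underS_def Field_def)
    then have F: "F \<subseteq> dual_space smul" using \<phi> by (auto simp: F_def good_def)
    have Y: "Y \<phi> \<beta> = {y. \<forall>f\<in>F. f y = 0}" by (simp add: Y_def F_def)
    have "underS |D| \<beta> \<subseteq> underS |D| \<alpha>"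
      using wo R unfolding underS_def R_def order_on_defs by (auto dest: transD antisymD)
    then have "X \<alpha> \<in> Y \<phi> \<beta>" using X(2)[OF D2(1)] by (auto simp: Y_def)
    moreover have "X \<beta> \<in> Y \<phi> \<beta>" by (rule X(2)[OF D2(2)])
    moreover have "Real_Vector_Spaces.subspace (Y \<phi> \<beta>)" unfolding Y by (rule dual_kernel_subspace[OF F])
    ultimately have mem: "X \<beta> + X \<alpha> \<in> Y \<phi> \<beta>" "X \<beta> - X \<alpha> \<in> Y \<phi> \<beta>"
      using Real_Vector_Spaces.subspace_add Real_Vector_Spaces.subspace_diff by blast+
    have "snd (\<phi> \<beta>) (X \<alpha>) = 0" using X(2)[OF D2(1)] R by (auto simp: Y_def underS_R)
    then obtain g :: "'a \<Rightarrow> real" where g: "linear g" "g (X \<alpha>) = 0"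
      "\<And>y. y \<in> Y \<phi> \<beta> \<Longrightarrow> norm y \<le> 1 \<Longrightarrow> y \<noteq> X \<beta> \<Longrightarrow> g y < g (X \<beta>)"
      using \<phi>[of \<beta>] D2(2) unfolding good_def X_def[symmetric] by blast
    \<comment> \<open>\<open>g\<close> has the same value at \<open>X \<beta> + X \<alpha>\<close>, \<open>X \<beta> - X \<alpha>\<close> and \<open>X \<beta>\<close>, but exposes \<open>X \<beta>\<close> in the unit ball\<close>
    have "X \<alpha> \<noteq> 0" using X(1)[OF D2(1)] by auto
    then show ?thesis
      using g(3)[OF mem(1)] g(3)[OF mem(2)] g(2) linear_add[OF g(1)] linear_diff[OF g(1)]
      by (auto simp: not_le[symmetric])
  qed
  have sep: "norm (X \<alpha> - X \<beta>) > 1 \<and> norm (X \<alpha> + X \<beta>) > 1" if "\<alpha> \<in> D" "\<beta> \<in> D" "\<alpha> \<noteq> \<beta>" for \<alpha> \<beta>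
  proof -
    have "(\<alpha>, \<beta>) \<in> R \<or> (\<beta>, \<alpha>) \<in> R"
      using wo that Field unfolding R_def order_on_defs total_on_def by auto
    then show ?thesis
      using less[of \<alpha> \<beta>] less[of \<beta> \<alpha>] by (auto simp: norm_minus_commute add.commute)
  qed
  have "inj_on X D"
  proof (rule inj_onI, rule ccontr)
    fix \<alpha> \<beta> assume "\<alpha> \<in> D" "\<beta> \<in> D" "X \<alpha> = X \<beta>" "\<alpha> \<noteq> \<beta>"
    then show False using sep[of \<alpha> \<beta>] by simp
  qed
  then have "|X ` D| =o |D|"
    by (intro ordIso_symmetric[OF card_of_ordIsoI]) (rule inj_on_imp_bij_betw)
  then have "|X ` D| =o density_character (weak_star_topology smul)" by (simp add: D)
  moreover have "symmetrically_one_plus_separated (X ` D)"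
    unfolding symmetrically_one_plus_separated_def using sep by (metis imageE)
  moreover have "\<forall>x\<in>X ` D. norm x = 1" using X(1) by blast
  ultimately show ?thesis by blast
qed

end
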